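(* Let $C$ be a $\mathbb Q$-algebra and an integral domain such that for every maximal ideal $M$ of $C$ the localization $C_M$ is a unique factorization domain. Let $X$ be a set. For $\lambda\in C$, the complete shuffle Baxter algebra $\widehat{\mathrm{Sh}}_C(X)=\widehat{\mathrm{Sh}}_{C,\lambda}(C[X])$ of weight $\lambda$ is an integral domain if and only if $\lambda$ is not a unit of $C$.
   Context: All rings are commutative with identity. $\mathbb N=\{0,1,2,\dots\}$. Tensor products are over $C$. $C[X]$ is the polynomial ring on the set $X$; put $A=C[X]$ below. Mixable shuffles. For $m,n\ge 1$, let $S(m,n)$ be the set of $\sigma\in S_{m+n}$ with $\sigma^{-1}(1)<\dots<\sigma^{-1}(m)$ and $\sigma^{-1}(m+1)<\dots<\sigma^{-1}(m+n)$. A pair $(k,k+1)$, $1\le k<m+n$, is admissible for $\sigma$ if $\sigma(k)\le m<\sigma(k+1)$; let $\mathcal T^\sigma$ be the set of admissible pairs, and $\bar S(m,n)=\{(\sigma,T)\mid \sigma\in S(m,n),\ T\subseteq\mathcal T^\sigma\}$. For $x=x_1\otimes\dots\otimes x_m$, $y=y_1\otimes\dots\otimes y_n$, set $u_k=x_k$ for $k\le m$ and $u_k=y_{k-m}$ for $k>m$. Then $\sigma(x\otimes y;T)\in A^{\otimes(m+n-|T|)}$ is obtained from $u_{\sigma(1)}\otimes\dots\otimes u_{\sigma(m+n)}$ by replacing, for each $(k,k+1)\in T$, the tensor sign between $u_{\sigma(k)}$ and $u_{\sigma(k+1)}$ by the product in $A$. Shuffle Baxter algebra. $\mathrm{Sh}_{C,\lambda}(A)=\bigoplus_{k\in\mathbb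 N}A^{\otimes(k+1)}$ as a $C$-module, with the $C$-bilinear commutative product $$(x_0\otimes x^+)\diamond(y_0\otimes y^+)=\sum_{(\sigma,T)\in\bar S(m,n)}\lambda^{|T|}\,x_0y_0\otimes\sigma(x^+\otimes y^+;T)$$ for $x^+\in A^{\otimes m}$, $y^+\in A^{\otimes n}$ pure tensors, $m,n\geq 1$; when $m=0$ or $n=0$ the product is $x_0y_0\otimes y^+$, resp. $x_0y_0\otimes x^+$ (and $x_0y_0$ if both are $0$). The identity is $1_A\in A$. Complete version. Let $\mathrm{Fil}^k=\bigoplus_{n\ge k}A^{\otimes(n+1)}$, an ideal of $\mathrm{Sh}_{C,\lambda}(A)$. Then $\widehat{\mathrm{Sh}}_{C,\lambda}(A)=\varprojlim_k\mathrm{Sh}_{C,\lambda}(A)/\mathrm{Fil}^k$, identified with $\prod_{k\in\mathbb N}A^{\otimes(k+1)}$ with the product extended by continuity. *)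

theory Defs
  imports
    "HOL-Algebra.Algebraic_Closure_Type"
    "HOL-Algebra.Module"
    "HOL-Algebra.Ring_Divisibility"
    "HOL-Combinatorics.Permutations"
    "HOL-Computational_Algebra.Fraction_Field"
    "HOL-Library.Poly_Mapping"
    "HOL-Library.Set_Algebras"
begin

section \<open>The base ring\<close>

text \<open>The base ring is an integral domain given as a type; \<^const>\<open>ring_of_type_algebra\<close>
  turns it into a ring record.\<close>

definition rat_algebra :: "'c::comm_ring_1 itself \<Rightarrow> bool" where
  "rat_algebra (_ :: 'c itself) \<longleftrightarrow>
     (\<exists>h. h \<in> ring_hom (ring_of_type_algebra :: rat ring) (ring_of_type_algebra :: 'c ring))"

text \<open>As the base ring is an integral domain, its localization at a prime ideal \<open>M\<close> is the
  subring of the fraction field of all fractions with a denominator outside \<open>M\<close>.\<close>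

definition localization_at :: "'c::idom set \<Rightarrow> 'c fract ring" where
  "localization_at M =
     \<lparr>carrier = {Fract a s | a s. s \<notin> M}, monoid.mult = (*), one = 1, ring.zero = 0, add = (+)\<rparr>"


section \<open>Polynomial algebras\<close>

text \<open>A monomial is a finitely supported exponent function. The variables form a subset of
  the type \<open>'x\<close>, which may be empty.\<close>

definition mpoly_algebra :: "'x set \<Rightarrow> ('c::comm_ring_1, ('x \<Rightarrow>\<^sub>0 nat) \<Rightarrow>\<^sub>0 'c) module" where
  "mpoly_algebra V =
     \<lparr>carrier = {p. \<forall>m \<in> Poly_Mapping.keys p. Poly_Mapping.keys m \<subseteq> V},
      monoid.mult = (*), one = 1, ring.zero = 0, add = (+),
      module.smult = (\<lambda>c p. Poly_Mapping.single 0 c * p)\<rparr>"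


section \<open>Tensor powers\<close>

text \<open>Let \<open>A\<close> be a commutative algebra over the ring \<open>'c\<close>. The \<open>n\<close>-th tensor power of \<open>A\<close> is
  the free module on the words \<open>[a\<^sub>1, \<dots>, a\<^sub>n]\<close> of length \<open>n\<close> over \<open>A\<close>, modulo the submodule
  generated by the relations of multilinearity. Its elements are cosets of that submodule;
  the class of \<open>[a\<^sub>1, \<dots>, a\<^sub>n]\<close> is the pure tensor \<open>a\<^sub>1 \<otimes> \<dots> \<otimes> a\<^sub>n\<close>.\<close>

definition formal_scale :: "'c \<Rightarrow> ('a list \<Rightarrow>\<^sub>0 'c) \<Rightarrow> ('a list \<Rightarrow>\<^sub>0 'c::comm_ring_1)" where
  "formal_scale c p = Poly_Mapping.map ((*) c) p"

definition formal_tensors :: "('c::comm_ring_1, 'a) module \<Rightarrow> nat \<Rightarrow> ('a list \<Rightarrow>\<^sub>0 'c) set" where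
  "formal_tensors A n =
     {p. \<forall>w \<in> Poly_Mapping.keys p. length w = n \<and> set w \<subseteq> carrier A}"

abbreviation word :: "'a list \<Rightarrow> ('a list \<Rightarrow>\<^sub>0 'c::comm_ring_1)" where
  "word w \<equiv> Poly_Mapping.single w 1"

definition tensor_relations :: "('c::comm_ring_1, 'a) module \<Rightarrow> nat \<Rightarrow> ('a list \<Rightarrow>\<^sub>0 'c) set" where
  "tensor_relations A n = Modules.module.span formal_scale
     ({word (us @ (a \<oplus>\<^bsub>A\<^esub> b) # vs) - word (us @ a # vs) - word (us @ b # vs) | us a b vs.
         length us + 1 + length vs = n \<and> set us \<subseteq> carrier A \<and> set vs \<subseteq> carrier A \<and>
         a \<in> carrier A \<and> b \<in> carrier A} \<union>
      {word (us @ (c \<odot>\<^bsub>A\<^esub> a) # vs) - formal_scale c (word (us @ a # vs)) | us c a vs.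
         length us + 1 + length vs = n \<and> set us \<subseteq> carrier A \<and> set vs \<subseteq> carrier A \<and>
         a \<in> carrier A})"

definition tensor_class ::
    "('c::comm_ring_1, 'a) module \<Rightarrow> nat \<Rightarrow> ('a list \<Rightarrow>\<^sub>0 'c) \<Rightarrow> ('a list \<Rightarrow>\<^sub>0 'c) set" where
  "tensor_class A n p = p +o tensor_relations A n"

definition tensor_power ::
    "('c::comm_ring_1, 'a) module \<Rightarrow> nat \<Rightarrow> ('a list \<Rightarrow>\<^sub>0 'c) set set" where
  "tensor_power A n = tensor_class A n ` formal_tensors A n"

text \<open>The sum of two elements of a tensor power is their sum \<open>P + Q\<close> as sets.\<close>


section \<open>Mixable shuffles\<close>

text \<open>\<^term>\<open>inv_into UNIV \<sigma>\<close> is the inverse permutation; the notation \<open>inv\<close> is taken by group inverses.\<close>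

definition shuffle_perms :: "nat \<Rightarrow> nat \<Rightarrow> (nat \<Rightarrow> nat) set" where
  "shuffle_perms m n =
     {\<sigma>. \<sigma> permutes {1..m+n} \<and> strict_mono_on {1..m} (inv_into UNIV \<sigma>) \<and>
         strict_mono_on {m+1..m+n} (inv_into UNIV \<sigma>)}"

definition admissible_pairs :: "nat \<Rightarrow> nat \<Rightarrow> (nat \<Rightarrow> nat) \<Rightarrow> (nat \<times> nat) set" where
  "admissible_pairs m n \<sigma> =
     {(k, k + 1) | k. 1 \<le> k \<and> k < m + n \<and> \<sigma> k \<le> m \<and> m < \<sigma> (k + 1)}"

definition mixable_shuffles ::
    "nat \<Rightarrow> nat \<Rightarrow> ((nat \<Rightarrow> nat) \<times> (nat \<times> nat) set) set" where
  "mixable_shuffles m n = {(\<sigma>, T). \<sigma> \<in> shuffle_perms m n \<and> T \<subseteq> admissible_pairs m n \<sigma>}"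

text \<open>Admissible pairs of the same permutation are disjoint, so merging the pairs in \<open>T\<close> means
  that a position \<open>k\<close> with \<open>(k - 1, k) \<in> T\<close> is dropped and its letter is multiplied onto the
  preceding one. Positions start at 1, whereas list indices start at 0.\<close>

definition mixed_word ::
    "('c, 'a) module \<Rightarrow> 'a list \<Rightarrow> 'a list \<Rightarrow> (nat \<Rightarrow> nat) \<Rightarrow> (nat \<times> nat) set \<Rightarrow> 'a list" where
  "mixed_word A xs ys \<sigma> T =
     (let u = (\<lambda>k. (xs @ ys) ! (k - 1)) in
      map (\<lambda>k. if (k, k + 1) \<in> T then u (\<sigma> k) \<otimes>\<^bsub>A\<^esub> u (\<sigma> (k + 1)) else u (\<sigma> k))
        (filter (\<lambda>k. (k - 1, k) \<notin> T) [1..<length xs + length ys + 1]))"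


section \<open>The shuffle Baxter algebra\<close>

text \<open>The product of the pure tensors given by two nonempty words, on the level of formal sums,
  and its bilinear extension.\<close>

definition word_product ::
    "'c \<Rightarrow> ('c::comm_ring_1, 'a) module \<Rightarrow> 'a list \<Rightarrow> 'a list \<Rightarrow> ('a list \<Rightarrow>\<^sub>0 'c)" where
  "word_product lam A xs ys =
     (let x0 = hd xs; xp = tl xs; y0 = hd ys; yp = tl ys in
      if xp = [] \<or> yp = [] then word ((x0 \<otimes>\<^bsub>A\<^esub> y0) # xp @ yp)
      else \<Sum>(\<sigma>, T) \<in> mixable_shuffles (length xp) (length yp).
             formal_scale (lam ^ card T) (word ((x0 \<otimes>\<^bsub>A\<^esub> y0) # mixed_word A xp yp \<sigma> T)))"

definition formal_product ::
    "'c \<Rightarrow> ('c::comm_ring_1, 'a) module \<Rightarrow> ('a list \<Rightarrow>\<^sub>0 'c) \<Rightarrow> ('a list \<Rightarrow>\<^sub>0 'c) \<Rightarrow> ('a list \<Rightarrow>\<^sub>0 'c)" where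
  "formal_product lam A p q =
     (\<Sum>xs \<in> Poly_Mapping.keys p. \<Sum>ys \<in> Poly_Mapping.keys q.
        formal_scale (Poly_Mapping.lookup p xs * Poly_Mapping.lookup q ys)
          (word_product lam A xs ys))"

definition length_part :: "nat \<Rightarrow> ('a list \<Rightarrow>\<^sub>0 'c) \<Rightarrow> ('a list \<Rightarrow>\<^sub>0 'c::comm_ring_1)" where
  "length_part n p =
     (\<Sum>w \<in> {w \<in> Poly_Mapping.keys p. length w = n}. Poly_Mapping.single w (Poly_Mapping.lookup p w))"

text \<open>For \<open>P \<in> A\<^sup>\<otimes>\<^sup>(\<^sup>i\<^sup>+\<^sup>1\<^sup>)\<close> and \<open>Q \<in> A\<^sup>\<otimes>\<^sup>(\<^sup>j\<^sup>+\<^sup>1\<^sup>)\<close>: the component of the product of \<open>P\<close> and \<open>Q\<close> in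
  \<open>A\<^sup>\<otimes>\<^sup>(\<^sup>k\<^sup>+\<^sup>1\<^sup>)\<close>. The union is over one and the same coset for all choices of representatives.\<close>

definition component_product ::
    "'c \<Rightarrow> ('c::comm_ring_1, 'a) module \<Rightarrow> nat \<Rightarrow>
     ('a list \<Rightarrow>\<^sub>0 'c) set \<Rightarrow> ('a list \<Rightarrow>\<^sub>0 'c) set \<Rightarrow> ('a list \<Rightarrow>\<^sub>0 'c) set" where
  "component_product lam A k P Q =
     (\<Union>p \<in> P. \<Union>q \<in> Q. tensor_class A (k + 1) (length_part (k + 1) (formal_product lam A p q)))"

text \<open>Elements of the direct sum (and, below, of the direct product) of the tensor powers are
  families \<open>f\<close> with \<open>f k \<in> A\<^sup>\<otimes>\<^sup>(\<^sup>k\<^sup>+\<^sup>1\<^sup>)\<close>. The zero of \<open>A\<^sup>\<otimes>\<^sup>(\<^sup>k\<^sup>+\<^sup>1\<^sup>)\<close> is the coset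
  \<open>tensor_relations A (k + 1)\<close>; it is added in the product since an empty sum of sets is
  \<open>{0}\<close>.\<close>

definition family_support ::
    "('c::comm_ring_1, 'a) module \<Rightarrow> (nat \<Rightarrow> ('a list \<Rightarrow>\<^sub>0 'c) set) \<Rightarrow> nat set" where
  "family_support A f = {k. f k \<noteq> tensor_relations A (k + 1)}"

definition shuffle_algebra ::
    "'c \<Rightarrow> ('c::comm_ring_1, 'a) module \<Rightarrow> (nat \<Rightarrow> ('a list \<Rightarrow>\<^sub>0 'c) set) ring" where
  "shuffle_algebra lam A =
     \<lparr>carrier = {f. (\<forall>k. f k \<in> tensor_power A (k + 1)) \<and> finite (family_support A f)},
      monoid.mult = (\<lambda>f g k. tensor_relations A (k + 1) +
        (\<Sum>i \<in> family_support A f. \<Sum>j \<in> family_support A g.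
           component_product lam A k (f i) (g j))),
      one = (\<lambda>k. if k = 0 then tensor_class A 1 (word [\<one>\<^bsub>A\<^esub>]) else tensor_relations A (k + 1)),
      ring.zero = (\<lambda>k. tensor_relations A (k + 1)),
      add = (\<lambda>f g k. f k + g k)\<rparr>"


section \<open>The complete shuffle Baxter algebra\<close>

definition truncate_family ::
    "('c::comm_ring_1, 'a) module \<Rightarrow> nat \<Rightarrow> (nat \<Rightarrow> ('a list \<Rightarrow>\<^sub>0 'c) set) \<Rightarrow>
     (nat \<Rightarrow> ('a list \<Rightarrow>\<^sub>0 'c) set)" where
  "truncate_family A n f = (\<lambda>k. if k \<le> n then f k else tensor_relations A (k + 1))"

text \<open>The completion with respect to the ideals \<open>Fil\<^sup>k\<close> of families vanishing below \<open>k\<close>, as the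
  direct product of the tensor powers. In the shuffle algebra, the \<open>k\<close>-th component of a
  product depends on its factors modulo \<open>Fil\<^sup>k\<^sup>+\<^sup>1\<close> only, and so by continuity the \<open>k\<close>-th component
  of a product in the completion is obtained from the truncations of the factors.\<close>

definition complete_shuffle_algebra ::
    "'c \<Rightarrow> ('c::comm_ring_1, 'a) module \<Rightarrow> (nat \<Rightarrow> ('a list \<Rightarrow>\<^sub>0 'c) set) ring" where
  "complete_shuffle_algebra lam A =
     \<lparr>carrier = {f. \<forall>k. f k \<in> tensor_power A (k + 1)},
      monoid.mult = (\<lambda>f g k.
        (truncate_family A k f \<otimes>\<^bsub>shuffle_algebra lam A\<^esub> truncate_family A k g) k),
      one = \<one>\<^bsub>shuffle_algebra lam A\<^esub>,
      ring.zero = \<zero>\<^bsub>shuffle_algebra lam A\<^esub>,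
      add = (\<lambda>f g k. f k + g k)\<rparr>"

end

theory Submission
  imports Defs "HOL-Library.List_Lexorder"
begin

text \<open>In the basis of words of monomials, the elements of the complete shuffle algebra are functions
  on words, and the coefficient of a product at a word is given by recursion on that word: each of
  its letters stems from the left factor, from the right factor, or, with weight \<open>lam\<close>, from
  both. Associativity and commutativity are plain inductions in this form.

  If \<open>lam\<close> is not a unit, it lies in a maximal ideal and, unless it is \<open>0\<close>, has a prime factor in
  the localization there; let \<open>v\<close> be the valuation of that prime. Among the words at which the
  coefficients of a nonzero element have minimal \<open>v\<close>, single out those of minimal length, and of
  these the lexicographically largest one. Modulo higher \<open>v\<close> the weight may be taken to be \<open>0\<close>, and
  then the product of the leading words of two elements has a largest ordinary shuffle, whose
  coefficient is the product of the leading coefficients times a positive integer, which is a unit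
  of the base ring. If \<open>lam\<close> is a unit, there are explicit zero divisors.\<close>

section \<open>Quasi-shuffles in coordinates\<close>

text \<open>The polynomial ring is free over the base ring on its monomials, so a tensor amounts to
  its coordinates.

  The obstacle is merging. It shortens words, so longer words of the factors also reach the length
  at which the product of the leading words is expected and may cancel it there; this is what
  happens for the zero divisors when \<open>lam\<close> is a unit. Passing to higher values removes
  all merged terms, which is why the value is minimized before the length. The length is minimized,
  not maximized, because an element of the completion may have nonzero coefficients at arbitrarily
  long words, but only finitely many at each length.

  The first letters of two words are multiplied, not shuffled, so the comparison of letters has to
  respect products of monomials. Instead of a monomial order on an arbitrary set of variables, an
  additive map to the natural numbers is used that is injective on the finitely many monomials
  occurring in the leading words.\<close>

definition decompositions :: "('x \<Rightarrow>\<^sub>0 nat) \<Rightarrow> (('x \<Rightarrow>\<^sub>0 nat) \<times> ('x \<Rightarrow>\<^sub>0 nat)) set" where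
  "decompositions c = {(a, b). a + b = c}"

text \<open>Both summands are bounded by \<open>c\<close> pointwise, so they are functions supported
  in the keys of \<open>c\<close>; the sum \<open>N\<close> of all exponents is a common bound for
  their values.\<close>

lemma finite_decompositions [simp]: "finite (decompositions c)"
proof -
  define N where "N = (\<Sum>x\<in>Poly_Mapping.keys c. Poly_Mapping.lookup c x)"
  define S where "S = {f. \<forall>x. (x \<in> Poly_Mapping.keys c \<longrightarrow> f x \<in> {..N}) \<and>
     (x \<notin> Poly_Mapping.keys c \<longrightarrow> f x = (0::nat))}"
  have "finite S"
    unfolding S_def by (rule finite_set_of_finite_funs) auto
  have lookup_le: "Poly_Mapping.lookup a \<in> S"
    if le: "\<And>x. Poly_Mapping.lookup a x \<le> Poly_Mapping.lookup c x" for a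
  proof -
    have "Poly_Mapping.lookup c x \<le> N" if "x \<in> Poly_Mapping.keys c" for x
      unfolding N_def by (rule member_le_sum) (use that in auto)
    moreover have "Poly_Mapping.lookup a x = 0" if "x \<notin> Poly_Mapping.keys c" for x
      using le[of x] that by (simp add: in_keys_iff)
    ultimately show ?thesis
      using le by (auto simp: S_def simp del: lookup_not_eq_zero_eq_in_keys intro: order.trans[OF le])
  qed
  have "finite {a. Poly_Mapping.lookup a \<in> S}"
    using finite_vimageI[OF \<open>finite S\<close>, of Poly_Mapping.lookup]
    by (simp add: vimage_def inj_def Poly_Mapping.lookup_inject)
  moreover have "decompositions c \<subseteq> {a. Poly_Mapping.lookup a \<in> S} \<times> {a. Poly_Mapping.lookup a \<in> S}"
    by (auto simp: decompositions_def lookup_add intro!: lookup_le)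
  ultimately show ?thesis
    by (meson finite_SigmaI finite_subset)
qed

lemma sum_decompositions_swap:
  "(\<Sum>(a, b)\<in>decompositions c. f a b) = (\<Sum>(a, b)\<in>decompositions c. f b a)"
  by (rule sum.reindex_bij_witness[of _ "\<lambda>(a, b). (b, a)" "\<lambda>(a, b). (b, a)"])
    (auto simp: decompositions_def add.commute)

text \<open>Both sides run over the triples of monomials with sum \<open>c\<close>; only the
  bracketing differs.\<close>

lemma sum_decompositions_assoc:
  "(\<Sum>(a, b)\<in>decompositions c. \<Sum>(a1, a2)\<in>decompositions a. f a1 a2 b) =
   (\<Sum>(a, b)\<in>decompositions c. \<Sum>(b1, b2)\<in>decompositions b. f a b1 b2)"
proof -
  have "(\<Sum>(a, b)\<in>decompositions c. \<Sum>(a1, a2)\<in>decompositions a. f a1 a2 b) =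
    (\<Sum>((a, b), (a1, a2))\<in>Sigma (decompositions c) (\<lambda>(a, b). decompositions a). f a1 a2 b)"
    by (subst sum.Sigma[symmetric]) (auto simp: case_prod_beta)
  also have "\<dots> = (\<Sum>((a, b), (b1, b2))\<in>Sigma (decompositions c) (\<lambda>(a, b). decompositions b). f a b1 b2)"
    by (rule sum.reindex_bij_witness[of _ "\<lambda>((a, b), (b1, b2)). ((a + b1, b2), (a, b1))"
          "\<lambda>((a, b), (a1, a2)). ((a1, a2 + b), (a2, b))"])
      (auto simp: decompositions_def add.assoc)
  also have "\<dots> = (\<Sum>(a, b)\<in>decompositions c. \<Sum>(b1, b2)\<in>decompositions b. f a b1 b2)"
    by (subst sum.Sigma[symmetric]) (auto simp: case_prod_beta)
  finally show ?thesis .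
qed

text \<open>Recursion on the output word, not on the factors, gives a product of functions with
  infinite support: each coefficient involves only finitely many values of \<open>F\<close> and
  \<open>G\<close>.\<close>

primrec qsh :: "'c::comm_ring_1 \<Rightarrow> (('x \<Rightarrow>\<^sub>0 nat) list \<Rightarrow> 'c) \<Rightarrow> (('x \<Rightarrow>\<^sub>0 nat) list \<Rightarrow> 'c) \<Rightarrow>
    ('x \<Rightarrow>\<^sub>0 nat) list \<Rightarrow> 'c" where
  "qsh lam F G [] = F [] * G []"
| "qsh lam F G (c # t) = qsh lam (\<lambda>u. F (c # u)) G t + qsh lam F (\<lambda>u. G (c # u)) t +
     lam * (\<Sum>(a, b)\<in>decompositions c. qsh lam (\<lambda>u. F (a # u)) (\<lambda>u. G (b # u)) t)"

lemma qsh_commute: "qsh lam F G t = qsh lam G F t"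
proof (induction t arbitrary: F G)
  case (Cons c t)
  have "(\<Sum>(a, b)\<in>decompositions c. qsh lam (\<lambda>u. F (a # u)) (\<lambda>u. G (b # u)) t) =
    (\<Sum>(a, b)\<in>decompositions c. qsh lam (\<lambda>u. G (a # u)) (\<lambda>u. F (b # u)) t)"
    by (subst sum_decompositions_swap, subst Cons) (rule refl)
  then show ?case
    unfolding qsh.simps by (subst (1 2) Cons) (simp only: add.commute)
qed simp

lemma qsh_add_left: "qsh lam (\<lambda>u. F u + F' u) G t = qsh lam F G t + qsh lam F' G t"
  by (induction t arbitrary: F F' G)
    (simp_all add: algebra_simps sum.distrib case_prod_beta)

lemma qsh_scale_left: "qsh lam (\<lambda>u. k * F u) G t = k * qsh lam F G t"
  by (induction t arbitrary: F G)
    (simp_all add: algebra_simps case_prod_beta flip: sum_distrib_left)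

lemma qsh_sum_left: "qsh lam (\<lambda>u. \<Sum>i\<in>I. F i u) G t = (\<Sum>i\<in>I. qsh lam (F i) G t)"
proof (induction t arbitrary: F G)
  case (Cons c t)
  have "(\<Sum>p\<in>decompositions c. \<Sum>i\<in>I. qsh lam (\<lambda>u. F i (fst p # u)) (\<lambda>u. G (snd p # u)) t) =
    (\<Sum>i\<in>I. \<Sum>p\<in>decompositions c. qsh lam (\<lambda>u. F i (fst p # u)) (\<lambda>u. G (snd p # u)) t)"
    by (rule sum.swap)
  then show ?case
    by (simp add: Cons sum.distrib case_prod_beta flip: sum_distrib_left)
qed (simp add: sum_distrib_right)

lemma qsh_add_right: "qsh lam F (\<lambda>u. G u + G' u) t = qsh lam F G t + qsh lam F G' t"
  by (simp add: qsh_commute[of _ F] qsh_add_left)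

lemma qsh_scale_right: "qsh lam F (\<lambda>u. k * G u) t = k * qsh lam F G t"
  by (simp add: qsh_commute[of _ F] qsh_scale_left)

lemma qsh_sum_right: "qsh lam F (\<lambda>u. \<Sum>i\<in>I. G i u) t = (\<Sum>i\<in>I. qsh lam F (G i) t)"
  by (simp add: qsh_commute[of _ F] qsh_sum_left)

lemma qsh_zero_left [simp]: "qsh lam (\<lambda>u. 0) G t = 0"
  using qsh_scale_left[of lam 0 "\<lambda>u. 0" G t] by simp

lemma qsh_zero_right [simp]: "qsh lam F (\<lambda>u. 0) t = 0"
  by (simp add: qsh_commute[of _ F])

text \<open>On either side the first letter stems from one of the seven nonempty subsets of the
  three factors. Six cases match by induction; the one with all three, of weight \<open>lam\<close>
  squared, also needs the reassociation of decompositions.\<close>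

lemma qsh_assoc:
  fixes F G H :: "('x \<Rightarrow>\<^sub>0 nat) list \<Rightarrow> 'c::comm_ring_1"
  shows "qsh lam (qsh lam F G) H t = qsh lam F (qsh lam G H) t"
proof (induction t arbitrary: F G H)
  case (Cons c t)
  have lin: "qsh lam (\<lambda>u. P u + Q u + lam * (\<Sum>i\<in>I. R i u)) K t =
      qsh lam P K t + qsh lam Q K t + lam * (\<Sum>i\<in>I. qsh lam (R i) K t)"
    "qsh lam K (\<lambda>u. P u + Q u + lam * (\<Sum>i\<in>I. R i u)) t =
      qsh lam K P t + qsh lam K Q t + lam * (\<Sum>i\<in>I. qsh lam K (R i) t)"
    for P Q R K and I :: "(('x \<Rightarrow>\<^sub>0 nat) \<times> ('x \<Rightarrow>\<^sub>0 nat)) set"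
    by (simp_all add: qsh_add_left qsh_add_right qsh_scale_left qsh_scale_right qsh_sum_left qsh_sum_right)
  have "(\<Sum>(a, b)\<in>decompositions c. \<Sum>(a1, a2)\<in>decompositions a.
          qsh lam (\<lambda>u. F (a1 # u)) (qsh lam (\<lambda>u. G (a2 # u)) (\<lambda>u. H (b # u))) t) =
        (\<Sum>(a, b)\<in>decompositions c. \<Sum>(b1, b2)\<in>decompositions b.
          qsh lam (\<lambda>u. F (a # u)) (qsh lam (\<lambda>u. G (b1 # u)) (\<lambda>u. H (b2 # u))) t)"
    by (rule sum_decompositions_assoc)
  then show ?case
    by (simp add: lin Cons case_prod_beta sum.distrib flip: sum_distrib_left)
      (simp add: algebra_simps)
qed simp

lemma qsh_unit_left: "qsh lam (\<lambda>u. if u = [] then 1 else 0) G t = G t"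
  by (induction t arbitrary: G) (simp_all add: case_prod_beta)

text \<open>The product of the shuffle Baxter algebra in coordinates. Tensors live on nonempty words,
  whence the value \<open>0\<close> at the empty word.\<close>

primrec baxter_prod :: "'c::comm_ring_1 \<Rightarrow> (('x \<Rightarrow>\<^sub>0 nat) list \<Rightarrow> 'c) \<Rightarrow>
    (('x \<Rightarrow>\<^sub>0 nat) list \<Rightarrow> 'c) \<Rightarrow> ('x \<Rightarrow>\<^sub>0 nat) list \<Rightarrow> 'c" where
  "baxter_prod lam F G [] = 0"
| "baxter_prod lam F G (c # t) =
     (\<Sum>(a, b)\<in>decompositions c. qsh lam (\<lambda>u. F (a # u)) (\<lambda>u. G (b # u)) t)"

lemma baxter_prod_commute: "baxter_prod lam F G t = baxter_prod lam G F t"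
proof (cases t)
  case (Cons c t)
  then show ?thesis
    by (simp, subst sum_decompositions_swap) (simp add: qsh_commute)
qed simp

lemma baxter_prod_add_left:
  "baxter_prod lam (\<lambda>u. F u + F' u) G t = baxter_prod lam F G t + baxter_prod lam F' G t"
  by (cases t) (simp_all add: qsh_add_left sum.distrib case_prod_beta)

lemma baxter_prod_scale_left: "baxter_prod lam (\<lambda>u. k * F u) G t = k * baxter_prod lam F G t"
  by (cases t) (simp_all add: qsh_scale_left case_prod_beta flip: sum_distrib_left)

lemma baxter_prod_sum_left:
  "baxter_prod lam (\<lambda>u. \<Sum>i\<in>I. F i u) G t = (\<Sum>i\<in>I. baxter_prod lam (F i) G t)"
proof (cases t)
  case (Cons c t)
  then show ?thesis
    using sum.swap[of "\<lambda>p i. qsh lam (\<lambda>u. F i (fst p # u)) (\<lambda>u. G (snd p # u)) t" I "decompositions c"]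
    by (simp add: qsh_sum_left case_prod_beta)
qed simp

lemma baxter_prod_scale_right: "baxter_prod lam F (\<lambda>u. k * G u) t = k * baxter_prod lam F G t"
  by (simp add: baxter_prod_commute[of _ F] baxter_prod_scale_left)

lemma baxter_prod_sum_right:
  "baxter_prod lam F (\<lambda>u. \<Sum>i\<in>I. G i u) t = (\<Sum>i\<in>I. baxter_prod lam F (G i) t)"
  by (simp add: baxter_prod_commute[of _ F] baxter_prod_sum_left)

lemma baxter_prod_assoc:
  "baxter_prod lam (baxter_prod lam F G) H t = baxter_prod lam F (baxter_prod lam G H) t"
proof (cases t)
  case (Cons c s)
  have "(\<Sum>(a, b)\<in>decompositions c. \<Sum>(a1, a2)\<in>decompositions a.
          qsh lam (\<lambda>u. F (a1 # u)) (qsh lam (\<lambda>u. G (a2 # u)) (\<lambda>u. H (b # u))) s) =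
        (\<Sum>(a, b)\<in>decompositions c. \<Sum>(b1, b2)\<in>decompositions b.
          qsh lam (\<lambda>u. F (a # u)) (qsh lam (\<lambda>u. G (b1 # u)) (\<lambda>u. H (b2 # u))) s)"
    by (rule sum_decompositions_assoc)
  then show ?thesis
    by (simp add: Cons case_prod_beta qsh_sum_left qsh_sum_right qsh_assoc)
qed simp

lemma decompositions_zero: "(0, c) \<in> decompositions c"
  by (simp add: decompositions_def)

text \<open>Of all decompositions of the first letter only \<open>(0, c)\<close> meets the support
  of the unit; on the tails the unit then becomes the empty word. The hypothesis fits the default
  value at \<open>[]\<close>.\<close>

lemma baxter_prod_unit_left:
  fixes G :: "('x \<Rightarrow>\<^sub>0 nat) list \<Rightarrow> 'c::comm_ring_1"
  assumes "G [] = 0"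
  shows "baxter_prod lam (\<lambda>u. if u = [0] then 1 else 0) G t = G t"
proof (cases t)
  case (Cons c s)
  have "(\<Sum>p\<in>decompositions c. qsh lam (\<lambda>u. if fst p = 0 \<and> u = [] then 1 else 0) (\<lambda>u. G (snd p # u)) s) =
    (\<Sum>p\<in>{(0 :: 'x \<Rightarrow>\<^sub>0 nat, c)}. qsh lam (\<lambda>u. if u = [] then 1 else 0) (\<lambda>u. G (snd p # u)) s)"
  proof (rule sum.mono_neutral_cong_right)
    show "\<forall>p\<in>decompositions c - {(0, c)}.
      qsh lam (\<lambda>u. if fst p = 0 \<and> u = [] then 1 else 0) (\<lambda>u. G (snd p # u)) s = 0"
    proof
      fix p assume "p \<in> decompositions c - {(0, c)}"
      then have "fst p \<noteq> 0" by (auto simp: decompositions_def)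
      then show "qsh lam (\<lambda>u. if fst p = 0 \<and> u = [] then 1 else 0) (\<lambda>u. G (snd p # u)) s = 0"
        by simp
    qed
  qed (auto simp: decompositions_zero)
  then show ?thesis
    by (simp add: Cons case_prod_beta qsh_unit_left)
qed (use assms in simp)

text \<open>A coefficient at \<open>t\<close> never looks at words longer than \<open>t\<close>.
  This is what makes the truncations in the product of the completion harmless.\<close>

lemma qsh_cong:
  assumes "\<And>u. length u \<le> length t \<Longrightarrow> F u = F' u" "\<And>u. length u \<le> length t \<Longrightarrow> G u = G' u"
  shows "qsh lam F G t = qsh lam F' G' t"
  using assms
proof (induction t arbitrary: F F' G G')
  case (Cons c t)
  have "qsh lam (\<lambda>u. F (c # u)) G t = qsh lam (\<lambda>u. F' (c # u)) G' t"
    "qsh lam F (\<lambda>u. G (c # u)) t = qsh lam F' (\<lambda>u. G' (c # u)) t"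
    "qsh lam (\<lambda>u. F (a # u)) (\<lambda>u. G (b # u)) t = qsh lam (\<lambda>u. F' (a # u)) (\<lambda>u. G' (b # u)) t" for a b
    by (rule Cons.IH; simp add: Cons.prems)+
  then show ?case by simp
qed simp

lemma baxter_prod_cong:
  assumes "\<And>u. length u \<le> length t \<Longrightarrow> F u = F' u" "\<And>u. length u \<le> length t \<Longrightarrow> G u = G' u"
  shows "baxter_prod lam F G t = baxter_prod lam F' G' t"
  using assms by (cases t) (auto intro!: sum.cong qsh_cong)

section \<open>Mixable shuffles as masks with merged positions\<close>

text \<open>A mask records for each output position whether its letter comes from the left word.
  Unlike a permutation it admits induction along both words. The heads make sense as long as the
  mask has as many entries of each kind as the words have letters.\<close>

primrec riffle :: "bool list \<Rightarrow> 'a list \<Rightarrow> 'a list \<Rightarrow> 'a list" where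
  "riffle [] xs ys = []"
| "riffle (b # bs) xs ys =
     (if b then hd xs # riffle bs (tl xs) ys else hd ys # riffle bs xs (tl ys))"

definition masks :: "nat \<Rightarrow> nat \<Rightarrow> bool list set" where
  "masks m n = {bs. count_list bs True = m \<and> count_list bs False = n}"

lemma count_list_True_False: "count_list bs True + count_list bs False = length bs"
  by (induction bs) auto

lemma length_masks: "bs \<in> masks m n \<Longrightarrow> length bs = m + n"
  using count_list_True_False[of bs] by (simp add: masks_def)

lemma finite_masks [simp]: "finite (masks m n)"
  by (rule finite_subset[OF _ finite_lists_length_eq[of UNIV "m + n"]])
    (auto dest: length_masks)

lemma masks_0_left: "masks 0 n = {replicate n False}"
proof -
  have "bs = replicate n False" if "count_list bs True = 0" "count_list bs False = n" for bs
    using that by (induction bs arbitrary: n) (auto split: if_splits)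
  moreover have "replicate n False \<in> masks 0 n"
    by (induction n) (auto simp: masks_def)
  ultimately show ?thesis by (auto simp: masks_def)
qed

lemma masks_0_right: "masks m 0 = {replicate m True}"
proof -
  have "bs = replicate m True" if "count_list bs False = 0" "count_list bs True = m" for bs
    using that by (induction bs arbitrary: m) (auto split: if_splits)
  moreover have "replicate m True \<in> masks m 0"
    by (induction m) (auto simp: masks_def)
  ultimately show ?thesis by (auto simp: masks_def)
qed

lemma masks_Suc_Suc:
  "masks (Suc m) (Suc n) = (#) True ` masks m (Suc n) \<union> (#) False ` masks (Suc m) n"
proof (rule Set.set_eqI)
  fix bs show "bs \<in> masks (Suc m) (Suc n) \<longleftrightarrow>
      bs \<in> (#) True ` masks m (Suc n) \<union> (#) False ` masks (Suc m) n"
    by (cases bs) (auto simp: masks_def)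
qed

lemma masks_Suc_right_hd:
  "{bs \<in> masks m (Suc n). \<not> hd bs} = (#) False ` masks m n"
proof (rule Set.set_eqI)
  fix bs show "bs \<in> {bs \<in> masks m (Suc n). \<not> hd bs} \<longleftrightarrow> bs \<in> (#) False ` masks m n"
    by (cases bs) (auto simp: masks_def)
qed

lemma length_riffle [simp]: "length (riffle bs xs ys) = length bs"
  by (induction bs arbitrary: xs ys) auto

lemma riffle_nth:
  assumes "bs \<in> masks (length xs) (length ys)" "i < length bs"
  shows "riffle bs xs ys ! i =
    (if bs ! i then xs ! count_list (take i bs) True else ys ! count_list (take i bs) False)"
  using assms
proof (induction bs arbitrary: xs ys i)
  case (Cons b bs)
  show ?case
  proof (cases b)
    case True
    then obtain x xs' where xs: "xs = x # xs'"
      using Cons.prems(1) by (cases xs) (auto simp: masks_def)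
    then have "bs \<in> masks (length xs') (length ys)"
      using Cons.prems True by (auto simp: masks_def)
    then show ?thesis
      using Cons.IH[of xs' ys] Cons.prems(2) True xs by (cases i) auto
  next
    case False
    then obtain y ys' where ys: "ys = y # ys'"
      using Cons.prems(1) by (cases ys) (auto simp: masks_def)
    then have "bs \<in> masks (length xs) (length ys')"
      using Cons.prems False by (auto simp: masks_def)
    then show ?thesis
      using Cons.IH[of xs ys'] Cons.prems(2) False ys by (cases i) auto
  qed
qed simp

lemma riffle_replicate_False: "riffle (replicate (length ys) False) xs ys = ys"
  by (induction ys) auto

lemma riffle_replicate_True: "riffle (replicate (length xs) True) xs ys = xs"
  by (induction xs) auto

text \<open>A set \<open>K\<close> of positions, counted from 0, marks the letters that are multiplied by their
  successors.\<close>

definition merge_positions :: "('a \<Rightarrow> 'a \<Rightarrow> 'a) \<Rightarrow> 'a list \<Rightarrow> nat set \<Rightarrow> 'a list" where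
  "merge_positions mul z K =
     map (\<lambda>k. if k \<in> K then mul (z ! k) (z ! Suc k) else z ! k)
       (filter (\<lambda>k. k = 0 \<or> k - 1 \<notin> K) [0..<length z])"

definition mergeable :: "bool list \<Rightarrow> nat set" where
  "mergeable bs = {k. Suc k < length bs \<and> bs ! k \<and> \<not> bs ! Suc k}"

lemma finite_mergeable [simp]: "finite (mergeable bs)"
  by (rule finite_subset[of _ "{..<length bs}"]) (auto simp: mergeable_def)

lemma merge_positions_empty [simp]: "merge_positions mul z {} = z"
  by (simp add: merge_positions_def map_nth)

lemma upt_Cons_Suc: "[0..<Suc n] = 0 # map Suc [0..<n]"
  by (simp add: map_Suc_upt upt_conv_Cons del: upt_Suc)

lemma not_in_Suc_image: "k \<notin> Suc ` K \<longleftrightarrow> k = 0 \<or> k - 1 \<notin> K"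
  by (cases k) auto

lemma merge_positions_Cons:
  "merge_positions mul (a # z) (Suc ` K) = a # merge_positions mul z K"
  by (simp add: merge_positions_def upt_Cons_Suc filter_map o_def inj_image_mem_iff
      not_in_Suc_image del: upt_Suc)

lemma merge_positions_Cons_Cons:
  "merge_positions mul (a # b # z) (insert 0 (Suc ` Suc ` K)) = mul a b # merge_positions mul z K"
  by (simp add: merge_positions_def upt_Cons_Suc filter_map o_def inj_image_mem_iff
      not_in_Suc_image del: upt_Suc)

lemma mergeable_Cons:
  "mergeable (b # bs) =
     (if b \<and> bs \<noteq> [] \<and> \<not> hd bs then insert 0 (Suc ` mergeable bs) else Suc ` mergeable bs)"
proof (rule Set.set_eqI)
  fix k show "k \<in> mergeable (b # bs) \<longleftrightarrow> k \<in>
     (if b \<and> bs \<noteq> [] \<and> \<not> hd bs then insert 0 (Suc ` mergeable bs) else Suc ` mergeable bs)"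
    by (cases k; cases bs) (auto simp: mergeable_def)
qed

definition merge_sum :: "('a \<Rightarrow> 'a \<Rightarrow> 'a) \<Rightarrow> 'c::comm_ring_1 \<Rightarrow> bool list \<Rightarrow> 'a list \<Rightarrow>
    ('a list \<Rightarrow> 'c) \<Rightarrow> 'c" where
  "merge_sum mul lam bs z g =
     (\<Sum>K\<in>Pow (mergeable bs). lam ^ card K * g (merge_positions mul z K))"

lemma sum_Pow_Suc_image:
  "(\<Sum>K\<in>Pow (Suc ` M). f K) = (\<Sum>K\<in>Pow M. f (Suc ` K))"
proof -
  have "inj_on ((`) Suc) (Pow M)"
    by (rule inj_on_image) simp
  moreover have "Pow (Suc ` M) = (`) Suc ` Pow M"
    by (rule image_Pow_surj[symmetric]) (rule refl)
  ultimately show ?thesis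
    by (simp only: sum.reindex o_def)
qed

lemma merge_sum_Cons_plain:
  assumes "\<not> (b \<and> bs \<noteq> [] \<and> \<not> hd bs)"
  shows "merge_sum mul lam (b # bs) (a # z) g = merge_sum mul lam bs z (\<lambda>w. g (a # w))"
  using assms
  by (auto simp: merge_sum_def mergeable_Cons sum_Pow_Suc_image merge_positions_Cons card_image)

text \<open>The sets \<open>K\<close> are split by whether they contain \<open>0\<close>. Position
  \<open>1\<close> carries a letter of the right word and is never mergeable, so the rest of
  \<open>K\<close> starts two positions further on.\<close>

lemma merge_sum_True_False:
  "merge_sum mul lam (True # False # bs) (a # b # z) g =
     merge_sum mul lam (False # bs) (b # z) (\<lambda>w. g (a # w)) +
     lam * merge_sum mul lam bs z (\<lambda>w. g (mul a b # w))"
proof -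
  let ?M = "mergeable bs"
  have "inj_on (insert 0) (Pow (Suc ` Suc ` ?M))"
    by (rule inj_onI, subst (asm) insert_ident) auto
  moreover have "mergeable (True # False # bs) = insert 0 (Suc ` Suc ` ?M)"
    by (simp add: mergeable_Cons)
  ultimately have "merge_sum mul lam (True # False # bs) (a # b # z) g =
    (\<Sum>K\<in>Pow (Suc ` Suc ` ?M). lam ^ card K * g (merge_positions mul (a # b # z) K)) +
    (\<Sum>K\<in>Pow (Suc ` Suc ` ?M).
      lam ^ card (insert 0 K) * g (merge_positions mul (a # b # z) (insert 0 K)))"
    unfolding merge_sum_def by (simp only: Pow_insert, subst sum.union_disjoint) (auto simp only: sum.reindex o_def finite_Pow_iff finite_imageI finite_mergeable)
  moreover have "card (insert 0 (Suc ` Suc ` K)) = Suc (card K)" if "K \<subseteq> ?M" for K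
    using that by (subst card_insert_disjoint) (auto simp: card_image finite_subset)
  ultimately show ?thesis
    by (simp add: merge_sum_def mergeable_Cons sum_Pow_Suc_image merge_positions_Cons
        merge_positions_Cons_Cons card_image mult.assoc flip: sum_distrib_left)
qed

text \<open>The usual recursion for the quasi-shuffle product of two words, paired with a functional
  \<open>g\<close>; prepending a letter to all words of a formal sum becomes a change of
  \<open>g\<close>.\<close>

fun quasi_shuffle_sum :: "('a \<Rightarrow> 'a \<Rightarrow> 'a) \<Rightarrow> 'c::comm_ring_1 \<Rightarrow> 'a list \<Rightarrow> 'a list \<Rightarrow>
    ('a list \<Rightarrow> 'c) \<Rightarrow> 'c" where
  "quasi_shuffle_sum mul lam [] ys g = g ys"
| "quasi_shuffle_sum mul lam (x # xs) [] g = g (x # xs)"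
| "quasi_shuffle_sum mul lam (x # xs) (y # ys) g =
     quasi_shuffle_sum mul lam xs (y # ys) (\<lambda>w. g (x # w)) +
     quasi_shuffle_sum mul lam (x # xs) ys (\<lambda>w. g (y # w)) +
     lam * quasi_shuffle_sum mul lam xs ys (\<lambda>w. g (mul x y # w))"

lemma mergeable_replicate [simp]: "mergeable (replicate n b) = {}"
  by (auto simp: mergeable_def)

text \<open>Masks are sorted by their first entry: \<open>True\<close> yields the first summand of
  the recursion and, if \<open>False\<close> follows, also the merged third one;
  \<open>False\<close> yields the second.\<close>

lemma sum_merge_sum_masks:
  "(\<Sum>bs\<in>masks (length xs) (length ys). merge_sum mul lam bs (riffle bs xs ys) g) =
     quasi_shuffle_sum mul lam xs ys g"
proof (induction mul lam xs ys g rule: quasi_shuffle_sum.induct)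
  case (1 mul lam ys g)
  show ?case
    by (simp add: masks_0_left riffle_replicate_False merge_sum_def)
next
  case (2 mul lam x xs g)
  show ?case
    using riffle_replicate_True[of "x # xs" "[]"] mergeable_replicate[of "Suc (length xs)" True]
    by (simp add: masks_0_right merge_sum_def)
next
  case (3 mul lam x xs y ys g)
  let ?m = "length xs" and ?n = "length ys"
  let ?P = "\<lambda>bs. merge_sum mul lam bs (riffle bs xs (y # ys)) (\<lambda>w. g (x # w))"
  \<comment> \<open>\<open>?Q\<close> is meant for masks that begin with \<open>False\<close>;
    \<open>tl\<close> drops that entry because its letter \<open>y\<close> has been merged into
    \<open>x\<close>.\<close>
  let ?Q = "\<lambda>bs. lam * merge_sum mul lam (tl bs) (riffle (tl bs) xs ys) (\<lambda>w. g (mul x y # w))"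
  have "merge_sum mul lam (True # bs) (riffle (True # bs) (x # xs) (y # ys)) g =
      ?P bs + (if hd bs then 0 else ?Q bs)" if "bs \<in> masks ?m (Suc ?n)" for bs
  proof -
    from length_masks[OF that] obtain b bs' where bs: "bs = b # bs'"
      by (cases bs) auto
    show ?thesis
      by (cases b) (simp_all add: bs merge_sum_True_False merge_sum_Cons_plain)
  qed
  then have "(\<Sum>bs\<in>masks ?m (Suc ?n).
        merge_sum mul lam (True # bs) (riffle (True # bs) (x # xs) (y # ys)) g) =
      (\<Sum>bs\<in>masks ?m (Suc ?n). ?P bs) + (\<Sum>bs\<in>masks ?m (Suc ?n). if hd bs then 0 else ?Q bs)"
    by (simp add: sum.distrib)
  moreover have "(\<Sum>bs\<in>masks ?m (Suc ?n). if hd bs then 0 else ?Q bs) =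
      (\<Sum>bs\<in>{bs \<in> masks ?m (Suc ?n). \<not> hd bs}. ?Q bs)"
    by (rule sum.mono_neutral_cong_right) auto
  moreover have "\<dots> = (\<Sum>bs\<in>masks ?m ?n. ?Q (False # bs))"
    by (simp add: masks_Suc_right_hd sum.reindex)
  moreover have "merge_sum mul lam (False # bs) (riffle (False # bs) (x # xs) (y # ys)) g =
      merge_sum mul lam bs (riffle bs (x # xs) ys) (\<lambda>w. g (y # w))" for bs
    by (simp add: merge_sum_Cons_plain)
  moreover have "(\<Sum>bs\<in>masks (Suc ?m) (Suc ?n).
        merge_sum mul lam bs (riffle bs (x # xs) (y # ys)) g) =
      (\<Sum>bs\<in>masks ?m (Suc ?n).
        merge_sum mul lam (True # bs) (riffle (True # bs) (x # xs) (y # ys)) g) +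
      (\<Sum>bs\<in>masks (Suc ?m) ?n.
        merge_sum mul lam (False # bs) (riffle (False # bs) (x # xs) (y # ys)) g)"
    unfolding masks_Suc_Suc by (subst sum.union_disjoint) (auto simp: sum.reindex simp del: riffle.simps)
  ultimately show ?case
    using 3 by (simp add: flip: sum_distrib_left)
qed

section \<open>The bijection between shuffle permutations and masks\<close>

lemma count_list_take_eq_card:
  assumes "i \<le> length bs"
  shows "count_list (take i bs) b = card {j \<in> {1..i}. bs ! (j - 1) = b}"
  using assms
proof (induction i)
  case (Suc i)
  have "{j \<in> {1..Suc i}. bs ! (j - 1) = b} =
    {j \<in> {1..i}. bs ! (j - 1) = b} \<union> (if bs ! i = b then {Suc i} else {})"
    by (auto simp: le_Suc_eq)
  then show ?case
    using Suc by (simp add: take_Suc_conv_app_nth)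
qed simp

definition shuffle_mask :: "nat \<Rightarrow> nat \<Rightarrow> (nat \<Rightarrow> nat) \<Rightarrow> bool list" where
  "shuffle_mask m n \<sigma> = map (\<lambda>k. \<sigma> k \<le> m) [1..<m + n + 1]"

lemma length_shuffle_mask [simp]: "length (shuffle_mask m n \<sigma>) = m + n"
  by (simp add: shuffle_mask_def del: upt_Suc)

lemma shuffle_mask_nth: "i < m + n \<Longrightarrow> shuffle_mask m n \<sigma> ! i \<longleftrightarrow> \<sigma> (Suc i) \<le> m"
  by (simp add: shuffle_mask_def del: upt_Suc)

text \<open>As the inverse of \<open>\<sigma>\<close> increases on the block, the letters of the
  block placed up to position \<open>k\<close> are exactly those with index up to
  \<open>\<sigma> k\<close>.\<close>

lemma card_block_initial:
  assumes "\<sigma> permutes {1..N}" "strict_mono_on {lo+1..hi} (inv_into UNIV \<sigma>)" "hi \<le> N"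
    and "\<sigma> k \<in> {lo+1..hi}"
  shows "card {j \<in> {1..k}. \<sigma> j \<in> {lo+1..hi}} = \<sigma> k - lo"
proof -
  let ?i = "inv_into UNIV \<sigma>"
  note inverses = permutes_inverses[OF assms(1)]
  have mem: "?i i \<in> {1..N}" if "i \<in> {1..N}" for i
    using permutes_in_image[OF permutes_inv[OF assms(1)]] that by blast
  have "{j \<in> {1..k}. \<sigma> j \<in> {lo+1..hi}} = ?i ` {lo+1..\<sigma> k}"
  proof (intro Set.equalityI subsetI)
    fix j assume j: "j \<in> {j \<in> {1..k}. \<sigma> j \<in> {lo+1..hi}}"
    have "\<sigma> j \<le> \<sigma> k"
    proof (rule ccontr)
      assume "\<not> \<sigma> j \<le> \<sigma> k"
      then have "?i (\<sigma> k) < ?i (\<sigma> j)"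
        using j assms(4) by (intro strict_mono_onD[OF assms(2)]) auto
      then show False using j by (simp add: inverses)
    qed
    then show "j \<in> ?i ` {lo+1..\<sigma> k}"
      using j by (intro image_eqI[of _ _ "\<sigma> j"]) (auto simp: inverses)
  next
    fix j assume "j \<in> ?i ` {lo+1..\<sigma> k}"
    then obtain i where i: "j = ?i i" "i \<in> {lo+1..\<sigma> k}" by blast
    have "?i i \<le> ?i (\<sigma> k)"
    proof (cases "i = \<sigma> k")
      case False
      then show ?thesis
        using i assms(4) by (intro less_imp_le strict_mono_onD[OF assms(2)]) auto
    qed simp
    then show "j \<in> {j \<in> {1..k}. \<sigma> j \<in> {lo+1..hi}}"
      using i mem[of i] assms(3,4) by (auto simp: inverses)
  qed
  moreover have "inj_on ?i {lo+1..\<sigma> k}"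
    using permutes_inj[OF permutes_inv[OF assms(1)]] by (rule inj_on_subset) simp
  ultimately show ?thesis
    by (simp add: card_image)
qed

lemma card_block:
  assumes "\<sigma> permutes {1..N}" "hi \<le> N"
  shows "card {j \<in> {1..N}. \<sigma> j \<in> {lo+1..hi}} = hi - lo"
proof -
  let ?i = "inv_into UNIV \<sigma>"
  note inverses = permutes_inverses[OF assms(1)]
  have "{j \<in> {1..N}. \<sigma> j \<in> {lo+1..hi}} = ?i ` {lo+1..hi}"
  proof (intro Set.equalityI subsetI)
    fix j assume "j \<in> {j \<in> {1..N}. \<sigma> j \<in> {lo+1..hi}}"
    then show "j \<in> ?i ` {lo+1..hi}"
      by (intro image_eqI[of _ _ "\<sigma> j"]) (auto simp: inverses)
  next
    fix j assume "j \<in> ?i ` {lo+1..hi}"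
    then obtain i where i: "j = ?i i" "i \<in> {lo+1..hi}" by blast
    moreover have "i \<in> {1..N}" using i assms(2) by simp
    then have "?i i \<in> {1..N}"
      using permutes_in_image[OF permutes_inv[OF assms(1)]] by blast
    ultimately show "j \<in> {j \<in> {1..N}. \<sigma> j \<in> {lo+1..hi}}"
      by (simp add: inverses)
  qed
  moreover have "inj_on ?i {lo+1..hi}"
    using permutes_inj[OF permutes_inv[OF assms(1)]] by (rule inj_on_subset) simp
  ultimately show ?thesis
    by (simp add: card_image)
qed

lemma shuffle_perms_value:
  assumes "\<sigma> \<in> shuffle_perms m n" "i < m + n"
  shows "\<sigma> (Suc i) =
    (if shuffle_mask m n \<sigma> ! i then Suc (count_list (take i (shuffle_mask m n \<sigma>)) True)
     else Suc (m + count_list (take i (shuffle_mask m n \<sigma>)) False))"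
proof -
  have perm: "\<sigma> permutes {1..m+n}" and mono: "strict_mono_on {0+1..m} (inv_into UNIV \<sigma>)"
    "strict_mono_on {m+1..m+n} (inv_into UNIV \<sigma>)"
    using assms(1) by (auto simp: shuffle_perms_def)
  let ?bs = "shuffle_mask m n \<sigma>"
  have in_range: "\<sigma> j \<in> {1..m+n} \<longleftrightarrow> j \<in> {1..m+n}" for j
    by (rule permutes_in_image[OF perm])
  have count: "count_list (take (Suc i) ?bs) b = card {j \<in> {1..Suc i}. \<sigma> j \<in> {lo+1..hi}}"
    if "\<And>j. j \<in> {1..Suc i} \<Longrightarrow> ((\<sigma> j \<le> m) = b) = (\<sigma> j \<in> {lo+1..hi})" for b lo hi
  proof -
    have "{j \<in> {1..Suc i}. ?bs ! (j - 1) = b} = {j \<in> {1..Suc i}. \<sigma> j \<in> {lo+1..hi}}"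
    proof (intro Collect_cong conj_cong refl)
      fix j assume j: "j \<in> {1..Suc i}"
      then have "?bs ! (j - 1) = (\<sigma> j \<le> m)"
        using assms(2) by (cases j) (auto simp: shuffle_mask_nth)
      then show "(?bs ! (j - 1) = b) = (\<sigma> j \<in> {lo+1..hi})"
        using that[OF j] by simp
    qed
    then show ?thesis
      using assms(2) by (simp add: count_list_take_eq_card)
  qed
  have step: "count_list (take (Suc i) ?bs) b = count_list (take i ?bs) b + (if ?bs ! i = b then 1 else 0)" for b
    using assms(2) by (simp add: take_Suc_conv_app_nth)
  show ?thesis
  proof (cases "?bs ! i")
    case True
    have "((\<sigma> j \<le> m) = True) = (\<sigma> j \<in> {0+1..m})" if "j \<in> {1..Suc i}" for j
      using in_range[of j] that assms(2) by auto
    moreover have mem: "\<sigma> (Suc i) \<in> {0+1..m}"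
      using True in_range[of "Suc i"] assms(2) by (auto simp: shuffle_mask_nth)
    ultimately show ?thesis
      using card_block_initial[OF perm mono(1) _ mem] count[of True 0 m] step[of True] True by simp
  next
    case False
    have "((\<sigma> j \<le> m) = False) = (\<sigma> j \<in> {m+1..m+n})" if "j \<in> {1..Suc i}" for j
      using in_range[of j] that assms(2) by auto
    moreover have mem: "\<sigma> (Suc i) \<in> {m+1..m+n}"
      using False in_range[of "Suc i"] assms(2) by (auto simp: shuffle_mask_nth)
    ultimately show ?thesis
      using card_block_initial[OF perm mono(2) _ mem] mem count[of False m "m + n"] step[of False] False by auto
  qed
qed

lemma shuffle_mask_in_masks:
  assumes "\<sigma> \<in> shuffle_perms m n"
  shows "shuffle_mask m n \<sigma> \<in> masks m n"
proof -
  have perm: "\<sigma> permutes {1..m+n}"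
    using assms by (auto simp: shuffle_perms_def)
  have pos: "Suc 0 \<le> \<sigma> j" if "Suc 0 \<le> j" "j \<le> m + n" for j
    using permutes_in_image[OF perm, of j] that by simp
  have "count_list (take (m + n) (shuffle_mask m n \<sigma>)) True = card {j \<in> {1..m+n}. \<sigma> j \<in> {0+1..m}}"
    using pos by (subst count_list_take_eq_card) (auto simp: shuffle_mask_nth intro!: arg_cong[where f = card])
  then have "count_list (shuffle_mask m n \<sigma>) True = m"
    using card_block[OF perm, of m 0] by simp
  then show ?thesis
    using count_list_True_False[of "shuffle_mask m n \<sigma>"] by (simp add: masks_def)
qed

lemma inj_on_shuffle_mask: "inj_on (shuffle_mask m n) (shuffle_perms m n)"
proof (rule inj_onI, rule ext)
  fix \<sigma> \<tau> k
  assume *: "\<sigma> \<in> shuffle_perms m n" "\<tau> \<in> shuffle_perms m n" "shuffle_mask m n \<sigma> = shuffle_mask m n \<tau>"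
  show "\<sigma> k = \<tau> k"
  proof (cases "k \<in> {1..m+n}")
    case True
    then obtain i where "k = Suc i" "i < m + n"
      by (cases k) auto
    then show ?thesis
      using shuffle_perms_value[OF *(1), of i] shuffle_perms_value[OF *(2), of i] *(3) by simp
  next
    case False
    then show ?thesis
      using * by (auto simp: shuffle_perms_def permutes_def)
  qed
qed

lemma shuffle_mask_surj:
  assumes bs: "bs \<in> masks m n"
  shows "bs \<in> shuffle_mask m n ` shuffle_perms m n"
proof -
  have len: "length bs = m + n"
    by (rule length_masks[OF bs])
  \<comment> \<open>\<open>c b k\<close> counts the entries \<open>b\<close> among the first
    \<open>k\<close>. The permutation defined from it is the only candidate, in view of
    \<open>shuffle_perms_value\<close>.\<close>
  define c where "c b k = card {j \<in> {1..k}. bs ! (j - 1) = b}" for b k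
  define \<sigma> where "\<sigma> k = (if k \<in> {1..m+n} then if bs ! (k - 1) then c True k else m + c False k else k)" for k
  have c_mono: "c b k \<le> c b k'" if "k \<le> k'" for b k k'
    unfolding c_def using that by (intro card_mono) auto
  have c_less: "c b k < c b k'" if "k < k'" "bs ! (k' - 1) = b" for b k k'
  proof -
    have "k' \<in> {j \<in> {1..k'}. bs ! (j - 1) = b}" "k' \<notin> {j \<in> {1..k}. bs ! (j - 1) = b}"
      "{j \<in> {1..k}. bs ! (j - 1) = b} \<subseteq> {j \<in> {1..k'}. bs ! (j - 1) = b}"
      using that by auto
    then show ?thesis
      unfolding c_def by (intro psubset_card_mono) (simp, blast)
  qed
  have c_le: "c b k \<le> count_list bs b" if "k \<le> m + n" for b k
    using c_mono[OF that, of b] count_list_take_eq_card[of "m + n" bs b] len by (simp add: c_def)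
  have count: "count_list bs True = m" "count_list bs False = n"
    using bs by (auto simp: masks_def)
  have c_pos: "0 < c b k" if "k > 0" "bs ! (k - 1) = b" for b k
    using c_less[of 0 k b] that by simp
  have range: "\<sigma> k \<in> (if bs ! (k - 1) then {1..m} else {m+1..m+n})" if "k \<in> {1..m+n}" for k
    using that c_le[of k True] c_le[of k False] c_pos[of k True] c_pos[of k False]
    by (auto simp: \<sigma>_def count)
  have inj: "inj_on \<sigma> {1..m+n}"
  proof (rule linorder_inj_onI)
    fix k k' assume *: "k < k'" "k \<in> {1..m+n}" "k' \<in> {1..m+n}"
    show "\<sigma> k \<noteq> \<sigma> k'"
    proof (cases "bs ! (k - 1) = bs ! (k' - 1)")
      case True
      then show ?thesis
        using c_less[OF *(1)] * by (auto simp: \<sigma>_def)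
    next
      case False
      then show ?thesis
        using range[of k] range[of k'] * by (auto split: if_splits)
    qed
  qed auto
  have "\<sigma> ` {1..m+n} \<subseteq> {1..m+n}"
    using range by (fastforce split: if_splits)
  then have "bij_betw \<sigma> {1..m+n} {1..m+n}"
    using inj endo_inj_surj[of "{1..m+n}" \<sigma>] by (auto simp: bij_betw_def)
  then have perm: "\<sigma> permutes {1..m+n}"
    by (rule bij_imp_permutes) (auto simp: \<sigma>_def)
  note inverses = permutes_inverses[OF perm]
  have mask_iff: "bs ! (k - 1) \<longleftrightarrow> \<sigma> k \<le> m" if "k \<in> {1..m+n}" for k
    using range[OF that] by (auto split: if_splits)
  have \<sigma>_mono: "\<sigma> k' \<le> \<sigma> k"
    if "k' \<le> k" "k' \<in> {1..m+n}" "k \<in> {1..m+n}" "bs ! (k - 1) = bs ! (k' - 1)" for k k'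
    using that c_mono[OF that(1)] by (simp add: \<sigma>_def)
  have inv_mono: "inv_into UNIV \<sigma> i < inv_into UNIV \<sigma> i'"
    if "i < i'" "i \<in> {1..m+n}" "i' \<in> {1..m+n}" "i \<le> m \<longleftrightarrow> i' \<le> m" for i i'
  proof (rule ccontr)
    let ?k = "inv_into UNIV \<sigma> i" and ?k' = "inv_into UNIV \<sigma> i'"
    assume "\<not> ?k < ?k'"
    then have le: "?k' \<le> ?k" by simp
    have k: "?k \<in> {1..m+n}" "?k' \<in> {1..m+n}"
      using permutes_in_image[OF permutes_inv[OF perm]] that by blast+
    have "bs ! (?k - 1) = bs ! (?k' - 1)"
      using mask_iff[OF k(1)] mask_iff[OF k(2)] that(4) by (simp add: inverses)
    then have "\<sigma> ?k' \<le> \<sigma> ?k"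
      by (rule \<sigma>_mono[OF le k(2,1)])
    then show False
      using that(1) by (simp add: inverses)
  qed
  have "\<sigma> \<in> shuffle_perms m n"
    using perm by (auto simp: shuffle_perms_def intro!: strict_mono_onI inv_mono)
  moreover have "bs = shuffle_mask m n \<sigma>"
    using mask_iff[of "Suc i" for i] by (intro nth_equalityI) (auto simp: len shuffle_mask_nth)
  ultimately show ?thesis by blast
qed

lemma bij_betw_shuffle_mask:
  "bij_betw (shuffle_mask m n) (shuffle_perms m n) (masks m n)"
  unfolding bij_betw_def
  using inj_on_shuffle_mask shuffle_mask_in_masks shuffle_mask_surj by blast

text \<open>Mask positions are counted from 0 and arguments of permutations from 1, so the mergeable
  position \<open>k\<close> stands for the pair \<open>(k + 1, k + 2)\<close>.\<close>

lemma admissible_pairs_mask: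
  "admissible_pairs m n \<sigma> = (\<lambda>k. (k + 1, k + 2)) ` mergeable (shuffle_mask m n \<sigma>)"
proof (intro Set.equalityI subsetI)
  fix p assume "p \<in> admissible_pairs m n \<sigma>"
  then obtain k where k: "p = (k, k + 1)" "1 \<le> k" "k < m + n" "\<sigma> k \<le> m" "m < \<sigma> (k + 1)"
    by (auto simp: admissible_pairs_def)
  then show "p \<in> (\<lambda>k. (k + 1, k + 2)) ` mergeable (shuffle_mask m n \<sigma>)"
    by (intro image_eqI[of _ _ "k - 1"]) (auto simp: mergeable_def shuffle_mask_nth)
qed (auto simp: admissible_pairs_def mergeable_def shuffle_mask_nth)

lemma riffle_shuffle_mask_nth:
  assumes "\<sigma> \<in> shuffle_perms (length xs) (length ys)" "i < length xs + length ys"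
  shows "riffle (shuffle_mask (length xs) (length ys) \<sigma>) xs ys ! i = (xs @ ys) ! (\<sigma> (Suc i) - 1)"
proof -
  let ?bs = "shuffle_mask (length xs) (length ys) \<sigma>"
  have mem: "?bs \<in> masks (length xs) (length ys)"
    by (rule shuffle_mask_in_masks[OF assms(1)])
  have "?bs ! i \<longleftrightarrow> \<sigma> (Suc i) \<le> length xs"
    using assms(2) by (simp add: shuffle_mask_nth)
  then show ?thesis
    using riffle_nth[OF mem, of i] shuffle_perms_value[OF assms] assms(2)
    by (auto simp: nth_append)
qed

lemma mixed_word_eq_merge_positions:
  assumes "\<sigma> \<in> shuffle_perms (length xs) (length ys)"
    and "K \<subseteq> mergeable (shuffle_mask (length xs) (length ys) \<sigma>)"
  shows "mixed_word A xs ys \<sigma> ((\<lambda>k. (k + 1, k + 2)) ` K) =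
    merge_positions (\<lambda>a b. a \<otimes>\<^bsub>A\<^esub> b) (riffle (shuffle_mask (length xs) (length ys) \<sigma>) xs ys) K"
proof -
  let ?N = "length xs + length ys"
  have pair: "(Suc k, Suc (Suc k)) \<in> (\<lambda>k. (Suc k, k + 2)) ` K \<longleftrightarrow> k \<in> K" for k
    by auto
  have pred: "(k, Suc k) \<in> (\<lambda>k. (Suc k, k + 2)) ` K \<longleftrightarrow> \<not> (k = 0 \<or> k - 1 \<notin> K)" for k
    by (cases k) auto
  have "[1..<?N + 1] = map Suc [0..<?N]"
    by (simp add: map_Suc_upt del: upt_Suc)
  then have "mixed_word A xs ys \<sigma> ((\<lambda>k. (k + 1, k + 2)) ` K) =
    map (\<lambda>k. if k \<in> K then (xs @ ys) ! (\<sigma> (Suc k) - 1) \<otimes>\<^bsub>A\<^esub> (xs @ ys) ! (\<sigma> (Suc (Suc k)) - 1)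
              else (xs @ ys) ! (\<sigma> (Suc k) - 1))
      (filter (\<lambda>k. k = 0 \<or> k - 1 \<notin> K) [0..<?N])"
    unfolding mixed_word_def Let_def
    by (simp only: filter_map map_map o_def diff_Suc_1 pair pred not_not Suc_eq_plus1[symmetric])
      simp
  also have "\<dots> = merge_positions (\<lambda>a b. a \<otimes>\<^bsub>A\<^esub> b) (riffle (shuffle_mask (length xs) (length ys) \<sigma>) xs ys) K"
    unfolding merge_positions_def
    using assms(2) by (auto simp: riffle_shuffle_mask_nth[OF assms(1)] mergeable_def)
  finally show ?thesis .
qed

lemma finite_shuffle_perms [simp]: "finite (shuffle_perms m n)"
  by (rule finite_subset[OF _ finite_permutations[of "{1..m+n}"]]) (auto simp: shuffle_perms_def)

text \<open>The bridge from permutations with sets of admissible pairs to a recursion on lists; the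
  coefficients of the product are computed through it.\<close>

lemma sum_mixable_shuffles:
  "(\<Sum>(\<sigma>, T)\<in>mixable_shuffles (length xs) (length ys). lam ^ card T * g (mixed_word A xs ys \<sigma> T)) =
    quasi_shuffle_sum (\<lambda>a b. a \<otimes>\<^bsub>A\<^esub> b) lam xs ys g"
proof -
  let ?m = "length xs" and ?n = "length ys"
  let ?pair = "\<lambda>k::nat. (k + 1, k + 2)"
  have inj: "inj_on ((`) ?pair) (Pow M)" for M
    by (rule inj_on_image) (auto intro: inj_onI)
  have "mixable_shuffles ?m ?n = Sigma (shuffle_perms ?m ?n) (\<lambda>\<sigma>. Pow (admissible_pairs ?m ?n \<sigma>))"
    by (auto simp: mixable_shuffles_def)
  then have "(\<Sum>(\<sigma>, T)\<in>mixable_shuffles ?m ?n. lam ^ card T * g (mixed_word A xs ys \<sigma> T)) =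
    (\<Sum>\<sigma>\<in>shuffle_perms ?m ?n. \<Sum>T\<in>Pow (admissible_pairs ?m ?n \<sigma>).
      lam ^ card T * g (mixed_word A xs ys \<sigma> T))"
    by (simp add: sum.Sigma admissible_pairs_mask)
  also have "\<dots> = (\<Sum>\<sigma>\<in>shuffle_perms ?m ?n. merge_sum (\<lambda>a b. a \<otimes>\<^bsub>A\<^esub> b) lam (shuffle_mask ?m ?n \<sigma>)
      (riffle (shuffle_mask ?m ?n \<sigma>) xs ys) g)"
  proof (rule sum.cong[OF refl])
    fix \<sigma> assume \<sigma>: "\<sigma> \<in> shuffle_perms ?m ?n"
    let ?M = "mergeable (shuffle_mask ?m ?n \<sigma>)"
    have "Pow (admissible_pairs ?m ?n \<sigma>) = (`) ?pair ` Pow ?M"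
      by (simp only: admissible_pairs_mask image_Pow_surj[OF refl])
    then have "(\<Sum>T\<in>Pow (admissible_pairs ?m ?n \<sigma>). lam ^ card T * g (mixed_word A xs ys \<sigma> T)) =
      (\<Sum>K\<in>Pow ?M. lam ^ card (?pair ` K) * g (mixed_word A xs ys \<sigma> (?pair ` K)))"
      by (simp only: sum.reindex[OF inj] o_def)
    also have "\<dots> = (\<Sum>K\<in>Pow ?M. lam ^ card K * g (merge_positions (\<lambda>a b. a \<otimes>\<^bsub>A\<^esub> b)
        (riffle (shuffle_mask ?m ?n \<sigma>) xs ys) K))"
    proof (rule sum.cong[OF refl])
      fix K assume "K \<in> Pow ?M"
      then have "mixed_word A xs ys \<sigma> (?pair ` K) =
        merge_positions (\<lambda>a b. a \<otimes>\<^bsub>A\<^esub> b) (riffle (shuffle_mask ?m ?n \<sigma>) xs ys) K"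
        by (intro mixed_word_eq_merge_positions[OF \<sigma>]) simp
      moreover have "card (?pair ` K) = card K"
        by (rule card_image) (auto intro: inj_onI)
      ultimately show "lam ^ card (?pair ` K) * g (mixed_word A xs ys \<sigma> (?pair ` K)) =
        lam ^ card K * g (merge_positions (\<lambda>a b. a \<otimes>\<^bsub>A\<^esub> b) (riffle (shuffle_mask ?m ?n \<sigma>) xs ys) K)"
        by (simp only:)
    qed
    finally show "(\<Sum>T\<in>Pow (admissible_pairs ?m ?n \<sigma>). lam ^ card T * g (mixed_word A xs ys \<sigma> T)) =
      merge_sum (\<lambda>a b. a \<otimes>\<^bsub>A\<^esub> b) lam (shuffle_mask ?m ?n \<sigma>) (riffle (shuffle_mask ?m ?n \<sigma>) xs ys) g"
      by (simp only: merge_sum_def)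
  qed
  also have "\<dots> = (\<Sum>bs\<in>masks ?m ?n. merge_sum (\<lambda>a b. a \<otimes>\<^bsub>A\<^esub> b) lam bs (riffle bs xs ys) g)"
    by (rule sum.reindex_bij_betw[OF bij_betw_shuffle_mask])
  finally show ?thesis
    by (simp only: sum_merge_sum_masks)
qed

section \<open>Coordinates of tensors\<close>

text \<open>The words of monomials are a basis of the tensor power; these are the values of the dual
  basis on a pure tensor.\<close>

fun word_coeff :: "(('x \<Rightarrow>\<^sub>0 nat) \<Rightarrow>\<^sub>0 'c::comm_ring_1) list \<Rightarrow> ('x \<Rightarrow>\<^sub>0 nat) list \<Rightarrow> 'c" where
  "word_coeff [] [] = 1"
| "word_coeff (a # w) (m # ms) = Poly_Mapping.lookup a m * word_coeff w ms"
| "word_coeff _ _ = 0"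

definition coord :: "((('x \<Rightarrow>\<^sub>0 nat) \<Rightarrow>\<^sub>0 'c::comm_ring_1) list \<Rightarrow>\<^sub>0 'c) \<Rightarrow> ('x \<Rightarrow>\<^sub>0 nat) list \<Rightarrow> 'c" where
  "coord p ms = (\<Sum>w\<in>Poly_Mapping.keys p. Poly_Mapping.lookup p w * word_coeff w ms)"

lemma word_coeff_length: "length w \<noteq> length ms \<Longrightarrow> word_coeff w ms = 0"
  by (induction w ms rule: word_coeff.induct) auto

lemma word_coeff_Nil: "word_coeff [] = (\<lambda>u. if u = [] then 1 else 0)"
proof
  fix u show "word_coeff [] u = (if u = [] then 1 else 0)" by (cases u) auto
qed

lemma lookup_mult_decompositions:
  fixes x y :: "('x \<Rightarrow>\<^sub>0 nat) \<Rightarrow>\<^sub>0 'c::comm_ring_1"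
  shows "Poly_Mapping.lookup (x * y) c =
    (\<Sum>(a, b)\<in>decompositions c. Poly_Mapping.lookup x a * Poly_Mapping.lookup y b)"
proof -
  have "Poly_Mapping.lookup (x * y) c =
    (\<Sum>(a, b). Poly_Mapping.lookup x a * Poly_Mapping.lookup y b when c = a + b)"
    by (simp add: times_poly_mapping.rep_eq prod_fun_unfold_prod)
  also have "\<dots> = (\<Sum>p\<in>decompositions c. case p of (a, b) \<Rightarrow>
      Poly_Mapping.lookup x a * Poly_Mapping.lookup y b when c = a + b)"
    by (rule Sum_any.expand_superset[OF finite_decompositions]) (auto simp: decompositions_def)
  also have "\<dots> = (\<Sum>(a, b)\<in>decompositions c. Poly_Mapping.lookup x a * Poly_Mapping.lookup y b)"
    by (rule sum.cong) (auto simp: decompositions_def)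
  finally show ?thesis .
qed

lemma quasi_shuffle_sum_scale:
  "quasi_shuffle_sum mul lam xs ys (\<lambda>w. k * g w) = k * quasi_shuffle_sum mul lam xs ys g"
  by (induction mul lam xs ys g rule: quasi_shuffle_sum.induct) (simp_all add: algebra_simps)

lemma quasi_shuffle_sum_zero [simp]: "quasi_shuffle_sum mul lam xs ys (\<lambda>w. 0) = 0"
  using quasi_shuffle_sum_scale[of mul lam xs ys 0 "\<lambda>w. 0"] by simp

lemma quasi_shuffle_sum_Nil_right: "quasi_shuffle_sum mul lam xs [] g = g xs"
  by (cases xs) auto

text \<open>Here recursion on the input words is exchanged for recursion on the output word. A
  merged letter \<open>x * y\<close> contributes its coefficient at \<open>c\<close>, which is the
  convolution over the decompositions of \<open>c\<close>.\<close>

lemma quasi_shuffle_sum_word_coeff: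
  "quasi_shuffle_sum (*) lam xs ys (\<lambda>w. word_coeff w t) = qsh lam (word_coeff xs) (word_coeff ys) t"
proof (induction t arbitrary: xs ys)
  case Nil
  then show ?case by (cases xs; cases ys) auto
next
  case (Cons c t)
  show ?case
  proof (cases "xs = [] \<or> ys = []")
    case True
    then show ?thesis
    proof
      assume "xs = []"
      then show ?thesis by (simp only: quasi_shuffle_sum.simps word_coeff_Nil qsh_unit_left)
    next
      assume "ys = []"
      then show ?thesis
        by (simp only: quasi_shuffle_sum_Nil_right word_coeff_Nil qsh_commute[of _ "word_coeff xs"] qsh_unit_left)
    qed
  next
    case False
    then obtain x xs' y ys' where xy: "xs = x # xs'" "ys = y # ys'"
      by (auto simp: neq_Nil_conv)
    have "(\<Sum>(a, b)\<in>decompositions c. qsh lam (\<lambda>u. Poly_Mapping.lookup x a * word_coeff xs' u)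
        (\<lambda>u. Poly_Mapping.lookup y b * word_coeff ys' u) t) =
      Poly_Mapping.lookup (x * y) c * qsh lam (word_coeff xs') (word_coeff ys') t"
      by (simp add: lookup_mult_decompositions qsh_scale_left qsh_scale_right sum_distrib_right
          case_prod_beta mult.assoc)
    then show ?thesis
      by (simp add: xy quasi_shuffle_sum_scale qsh_scale_left qsh_scale_right flip: Cons)
  qed
qed

lemma lookup_formal_scale [simp]:
  "Poly_Mapping.lookup (formal_scale c p) w = c * Poly_Mapping.lookup p w"
  by (simp add: formal_scale_def Poly_Mapping.map.rep_eq when_def)

lemma coord_superset:
  assumes "finite S" "Poly_Mapping.keys p \<subseteq> S"
  shows "coord p ms = (\<Sum>w\<in>S. Poly_Mapping.lookup p w * word_coeff w ms)"
  unfolding coord_def using assms by (intro sum.mono_neutral_left) (auto simp: in_keys_iff)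

lemma coord_zero [simp]: "coord 0 ms = 0"
  by (simp add: coord_def)

lemma coord_add: "coord (p + q) ms = coord p ms + coord q ms"
proof -
  let ?S = "Poly_Mapping.keys p \<union> Poly_Mapping.keys q"
  have "Poly_Mapping.keys (p + q) \<subseteq> ?S" by (rule Poly_Mapping.keys_add)
  then show ?thesis
    by (simp add: coord_superset[of ?S] lookup_add algebra_simps sum.distrib)
qed

lemma coord_scale: "coord (formal_scale c p) ms = c * coord p ms"
proof -
  have "Poly_Mapping.keys (formal_scale c p) \<subseteq> Poly_Mapping.keys p"
    by (auto simp: in_keys_iff)
  then show ?thesis
    by (simp add: coord_superset[of "Poly_Mapping.keys p"] sum_distrib_left mult.assoc)
qed

lemma formal_scale_minus_one: "formal_scale (- 1) p = - p"
  by (rule poly_mapping_eqI) simp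

lemma coord_uminus: "coord (- p) ms = - coord p ms"
  using coord_scale[of "- 1" p ms] by (simp add: formal_scale_minus_one)

lemma coord_diff: "coord (p - q) ms = coord p ms - coord q ms"
  using coord_add[of p "- q" ms] by (simp add: coord_uminus)

lemma coord_sum: "coord (\<Sum>i\<in>I. p i) ms = (\<Sum>i\<in>I. coord (p i) ms)"
  by (induction I rule: infinite_finite_induct) (auto simp: coord_add)

lemma coord_single [simp]: "coord (Poly_Mapping.single w k) ms = k * word_coeff w ms"
  by (simp add: coord_superset[of "{w}"])

lemma mpoly_algebra_simps [simp]:
  "a \<otimes>\<^bsub>mpoly_algebra V\<^esub> b = a * b" "a \<oplus>\<^bsub>mpoly_algebra V\<^esub> b = a + b" "\<one>\<^bsub>mpoly_algebra V\<^esub> = 1"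
  "c \<odot>\<^bsub>mpoly_algebra V\<^esub> a = Poly_Mapping.single 0 c * a" "\<zero>\<^bsub>mpoly_algebra V\<^esub> = 0"
  by (simp_all add: mpoly_algebra_def)

lemma coord_word_product:
  assumes "xs \<noteq> []" "ys \<noteq> []"
  shows "coord (word_product lam (mpoly_algebra V) xs ys) t =
    baxter_prod lam (word_coeff xs) (word_coeff ys) t"
proof -
  obtain x xp y yp where xy: "xs = x # xp" "ys = y # yp"
    using assms by (auto simp: neq_Nil_conv)
  have "coord (word_product lam (mpoly_algebra V) xs ys) t =
    quasi_shuffle_sum (*) lam xp yp (\<lambda>w. word_coeff (x * y # w) t)"
  proof (cases "xp = [] \<or> yp = []")
    case True
    then show ?thesis
      by (auto simp: word_product_def xy quasi_shuffle_sum_Nil_right)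
  next
    case False
    then show ?thesis
      using sum_mixable_shuffles[of lam "\<lambda>w. word_coeff (x * y # w) t" "mpoly_algebra V" xp yp]
      by (simp add: word_product_def xy coord_sum coord_scale case_prod_beta)
  qed
  also have "\<dots> = baxter_prod lam (word_coeff xs) (word_coeff ys) t"
  proof (cases t)
    case (Cons c s)
    then show ?thesis
      by (simp add: xy quasi_shuffle_sum_scale quasi_shuffle_sum_word_coeff qsh_scale_left qsh_scale_right)
        (simp add: lookup_mult_decompositions sum_distrib_right case_prod_beta mult.assoc)
  qed (simp add: xy)
  finally show ?thesis .
qed

text \<open>Both sides are bilinear, which reduces the claim to words; the empty word is excluded
  since \<open>word_product\<close> takes heads.\<close>

lemma coord_formal_product:
  assumes "[] \<notin> Poly_Mapping.keys p" "[] \<notin> Poly_Mapping.keys q"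
  shows "coord (formal_product lam (mpoly_algebra V) p q) t = baxter_prod lam (coord p) (coord q) t"
proof -
  have "coord (word_product lam (mpoly_algebra V) xs ys) t =
      baxter_prod lam (word_coeff xs) (word_coeff ys) t"
    if "xs \<in> Poly_Mapping.keys p" "ys \<in> Poly_Mapping.keys q" for xs ys
    using that assms by (intro coord_word_product) auto
  then have "coord (formal_product lam (mpoly_algebra V) p q) t =
    (\<Sum>xs\<in>Poly_Mapping.keys p. \<Sum>ys\<in>Poly_Mapping.keys q.
      Poly_Mapping.lookup p xs * Poly_Mapping.lookup q ys * baxter_prod lam (word_coeff xs) (word_coeff ys) t)"
    by (simp add: formal_product_def coord_sum coord_scale)
  also have "\<dots> = baxter_prod lam (coord p) (coord q) t"
    by (simp add: coord_def[abs_def] baxter_prod_sum_left baxter_prod_sum_right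
        baxter_prod_scale_left baxter_prod_scale_right sum_distrib_left mult.assoc)
  finally show ?thesis .
qed

lemma coord_length_part:
  "coord (length_part n p) t = (if length t = n then coord p t else 0)"
proof -
  have "coord (length_part n p) t = (\<Sum>w\<in>{w \<in> Poly_Mapping.keys p. length w = n}.
      Poly_Mapping.lookup p w * word_coeff w t)"
    by (simp add: length_part_def coord_sum)
  also have "\<dots> = (\<Sum>w\<in>Poly_Mapping.keys p. if length w = n then Poly_Mapping.lookup p w * word_coeff w t else 0)"
    by (rule sum.mono_neutral_cong_left) auto
  also have "\<dots> = (if length t = n then coord p t else 0)"
    by (auto simp: coord_def word_coeff_length intro!: sum.cong sum.neutral)
  finally show ?thesis .
qed

section \<open>The tensor relations as the common kernel of the coordinates\<close>

interpretation formal_module: Modules.module formal_scale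
  by unfold_locales (auto intro!: poly_mapping_eqI simp: lookup_add algebra_simps)

lemma tensor_relations_subspace:
  fixes p q :: "(('x \<Rightarrow>\<^sub>0 nat) \<Rightarrow>\<^sub>0 'c::comm_ring_1) list \<Rightarrow>\<^sub>0 'c" and V :: "'x set"
  shows
  "(0 :: (('x \<Rightarrow>\<^sub>0 nat) \<Rightarrow>\<^sub>0 'c) list \<Rightarrow>\<^sub>0 'c) \<in> tensor_relations (mpoly_algebra V) n"
  "p \<in> tensor_relations (mpoly_algebra V) n \<Longrightarrow> q \<in> tensor_relations (mpoly_algebra V) n \<Longrightarrow> p + q \<in> tensor_relations (mpoly_algebra V) n"
  "p \<in> tensor_relations (mpoly_algebra V) n \<Longrightarrow> q \<in> tensor_relations (mpoly_algebra V) n \<Longrightarrow> p - q \<in> tensor_relations (mpoly_algebra V) n"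
  "p \<in> tensor_relations (mpoly_algebra V) n \<Longrightarrow> - p \<in> tensor_relations (mpoly_algebra V) n"
  "p \<in> tensor_relations (mpoly_algebra V) n \<Longrightarrow> formal_scale c p \<in> tensor_relations (mpoly_algebra V) n"
  "(\<And>i. i \<in> I \<Longrightarrow> P i \<in> tensor_relations (mpoly_algebra V) n) \<Longrightarrow> (\<Sum>i\<in>I. P i) \<in> tensor_relations (mpoly_algebra V) n"
  unfolding tensor_relations_def
  by (auto intro: formal_module.span_zero formal_module.span_add formal_module.span_diff
      formal_module.span_neg formal_module.span_scale formal_module.span_sum)

lemma mem_carrier_mpoly_algebra:
  "a \<in> carrier (mpoly_algebra V) \<longleftrightarrow> (\<forall>m \<in> Poly_Mapping.keys a. Poly_Mapping.keys m \<subseteq> V)"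
  by (simp add: mpoly_algebra_def)

lemma lookup_scalar_mult:
  "Poly_Mapping.lookup (Poly_Mapping.single 0 c * a) m = c * Poly_Mapping.lookup a m"
  for a :: "('x \<Rightarrow>\<^sub>0 nat) \<Rightarrow>\<^sub>0 'c::comm_ring_1"
  by (simp add: Poly_Mapping.map.rep_eq when_def flip: mult_map_scale_conv_mult)

lemma mpoly_algebra_closed:
  fixes a b :: "('x \<Rightarrow>\<^sub>0 nat) \<Rightarrow>\<^sub>0 'c::comm_ring_1" and V :: "'x set"
  shows "(0 :: ('x \<Rightarrow>\<^sub>0 nat) \<Rightarrow>\<^sub>0 'c) \<in> carrier (mpoly_algebra V)"
  "(1 :: ('x \<Rightarrow>\<^sub>0 nat) \<Rightarrow>\<^sub>0 'c) \<in> carrier (mpoly_algebra V)"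
  "a \<in> carrier (mpoly_algebra V) \<Longrightarrow> b \<in> carrier (mpoly_algebra V) \<Longrightarrow> a + b \<in> carrier (mpoly_algebra V)"
  "a \<in> carrier (mpoly_algebra V) \<Longrightarrow> Poly_Mapping.single 0 c * a \<in> carrier (mpoly_algebra V)"
  "a \<in> carrier (mpoly_algebra V) \<Longrightarrow> b \<in> carrier (mpoly_algebra V) \<Longrightarrow> a * b \<in> carrier (mpoly_algebra V)"
  "Poly_Mapping.keys m \<subseteq> V \<Longrightarrow> Poly_Mapping.single m (c :: 'c) \<in> carrier (mpoly_algebra V)"
proof -
  show "(0 :: ('x \<Rightarrow>\<^sub>0 nat) \<Rightarrow>\<^sub>0 'c) \<in> carrier (mpoly_algebra V)"
    "(1 :: ('x \<Rightarrow>\<^sub>0 nat) \<Rightarrow>\<^sub>0 'c) \<in> carrier (mpoly_algebra V)"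
    by (simp_all add: mem_carrier_mpoly_algebra)
  show "a + b \<in> carrier (mpoly_algebra V)" if "a \<in> carrier (mpoly_algebra V)" "b \<in> carrier (mpoly_algebra V)"
    using that Poly_Mapping.keys_add[of a b] by (auto simp: mem_carrier_mpoly_algebra)
  show "Poly_Mapping.single 0 c * a \<in> carrier (mpoly_algebra V)" if "a \<in> carrier (mpoly_algebra V)" for c :: 'c
    using that by (auto simp: mem_carrier_mpoly_algebra in_keys_iff lookup_scalar_mult)
  show "a * b \<in> carrier (mpoly_algebra V)" if "a \<in> carrier (mpoly_algebra V)" "b \<in> carrier (mpoly_algebra V)"
    unfolding mem_carrier_mpoly_algebra
  proof
    fix m assume "m \<in> Poly_Mapping.keys (a * b)"
    then obtain m1 m2 where m: "m = m1 + m2" "m1 \<in> Poly_Mapping.keys a" "m2 \<in> Poly_Mapping.keys b"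
      using keys_mult[of a b] by blast
    then show "Poly_Mapping.keys m \<subseteq> V"
      using that Poly_Mapping.keys_add[of m1 m2] by (fastforce simp: mem_carrier_mpoly_algebra)
  qed
  show "Poly_Mapping.single m c \<in> carrier (mpoly_algebra V)" if "Poly_Mapping.keys m \<subseteq> V" for c :: 'c and m
    using that by (simp add: mem_carrier_mpoly_algebra)
qed

lemma formal_tensors_iff:
  "p \<in> formal_tensors (mpoly_algebra V) n \<longleftrightarrow>
    (\<forall>w. \<not> (length w = n \<and> set w \<subseteq> carrier (mpoly_algebra V)) \<longrightarrow> Poly_Mapping.lookup p w = 0)"
  by (simp only: formal_tensors_def mem_Collect_eq Ball_def in_keys_iff) blast

lemma formal_tensors_subspace:
  fixes p q :: "(('x \<Rightarrow>\<^sub>0 nat) \<Rightarrow>\<^sub>0 'c::comm_ring_1) list \<Rightarrow>\<^sub>0 'c" and V :: "'x set"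
  shows
  "(0 :: (('x \<Rightarrow>\<^sub>0 nat) \<Rightarrow>\<^sub>0 'c) list \<Rightarrow>\<^sub>0 'c) \<in> formal_tensors (mpoly_algebra V) n"
  "p \<in> formal_tensors (mpoly_algebra V) n \<Longrightarrow> q \<in> formal_tensors (mpoly_algebra V) n \<Longrightarrow> p + q \<in> formal_tensors (mpoly_algebra V) n"
  "p \<in> formal_tensors (mpoly_algebra V) n \<Longrightarrow> q \<in> formal_tensors (mpoly_algebra V) n \<Longrightarrow> p - q \<in> formal_tensors (mpoly_algebra V) n"
  "p \<in> formal_tensors (mpoly_algebra V) n \<Longrightarrow> - p \<in> formal_tensors (mpoly_algebra V) n"
  "p \<in> formal_tensors (mpoly_algebra V) n \<Longrightarrow> formal_scale c p \<in> formal_tensors (mpoly_algebra V) n"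
  by (simp_all only: formal_tensors_iff lookup_zero lookup_add lookup_minus lookup_uminus
      lookup_formal_scale) simp_all

lemma single_in_formal_tensors:
  "length w = n \<Longrightarrow> set w \<subseteq> carrier (mpoly_algebra V) \<Longrightarrow> Poly_Mapping.single w c \<in> formal_tensors (mpoly_algebra V) n"
  by (simp add: formal_tensors_def)

lemma tensor_relations_subset_formal_tensors:
  fixes V :: "'x set"
  shows "tensor_relations (mpoly_algebra V :: ('c::comm_ring_1, ('x \<Rightarrow>\<^sub>0 nat) \<Rightarrow>\<^sub>0 'c) module) n \<subseteq> formal_tensors (mpoly_algebra V) n"
  unfolding tensor_relations_def
proof (rule formal_module.span_minimal)
  show "formal_module.subspace (formal_tensors
      (mpoly_algebra V :: ('c, ('x \<Rightarrow>\<^sub>0 nat) \<Rightarrow>\<^sub>0 'c) module) n)"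
    by (simp add: formal_module.subspace_def formal_tensors_subspace)
qed (auto intro!: formal_tensors_subspace single_in_formal_tensors mpoly_algebra_closed)

lemma word_coeff_add:
  "word_coeff (us @ (a + b) # vs) t = word_coeff (us @ a # vs) t + word_coeff (us @ b # vs) t"
  for a :: "('x \<Rightarrow>\<^sub>0 nat) \<Rightarrow>\<^sub>0 'c::comm_ring_1"
proof (induction us arbitrary: t)
  case Nil
  then show ?case by (cases t) (auto simp: lookup_add algebra_simps)
next
  case (Cons u us)
  then show ?case by (cases t) (auto simp: algebra_simps)
qed

lemma word_coeff_scalar_mult:
  "word_coeff (us @ (Poly_Mapping.single 0 c * a) # vs) t = c * word_coeff (us @ a # vs) t"
  for a :: "('x \<Rightarrow>\<^sub>0 nat) \<Rightarrow>\<^sub>0 'c::comm_ring_1"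
proof (induction us arbitrary: t)
  case Nil
  then show ?case by (cases t) (auto simp: lookup_scalar_mult mult.assoc)
next
  case (Cons u us)
  then show ?case by (cases t) (auto simp: algebra_simps)
qed

lemma coord_tensor_relations:
  fixes V :: "'x set" and r :: "(('x \<Rightarrow>\<^sub>0 nat) \<Rightarrow>\<^sub>0 'c::comm_ring_1) list \<Rightarrow>\<^sub>0 'c"
  assumes "r \<in> tensor_relations (mpoly_algebra V) n"
  shows "coord r t = 0"
proof -
  have "tensor_relations (mpoly_algebra V) n \<subseteq>
      {r :: (('x \<Rightarrow>\<^sub>0 nat) \<Rightarrow>\<^sub>0 'c) list \<Rightarrow>\<^sub>0 'c. \<forall>t. coord r t = 0}"
    unfolding tensor_relations_def
  proof (rule formal_module.span_minimal)
    show "formal_module.subspace {r :: (('x \<Rightarrow>\<^sub>0 nat) \<Rightarrow>\<^sub>0 'c) list \<Rightarrow>\<^sub>0 'c. \<forall>t. coord r t = 0}"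
      by (simp add: formal_module.subspace_def coord_add coord_scale)
  qed (auto simp: coord_diff coord_scale word_coeff_add word_coeff_scalar_mult)
  then show ?thesis
    using assms by blast
qed

lemma tensor_relations_add_letter:
  assumes "length us + 1 + length vs = n" "set us \<subseteq> carrier (mpoly_algebra V)" "set vs \<subseteq> carrier (mpoly_algebra V)"
    "a \<in> carrier (mpoly_algebra V)" "b \<in> carrier (mpoly_algebra V)"
  shows "word (us @ (a + b) # vs) - word (us @ a # vs) - word (us @ b # vs) \<in> tensor_relations (mpoly_algebra V) n"
  unfolding tensor_relations_def
  by (rule formal_module.span_base, rule UnI1) (use assms in force)

lemma tensor_relations_scale_letter:
  assumes "length us + 1 + length vs = n" "set us \<subseteq> carrier (mpoly_algebra V)" "set vs \<subseteq> carrier (mpoly_algebra V)" "a \<in> carrier (mpoly_algebra V)"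
  shows "word (us @ (Poly_Mapping.single 0 c * a) # vs) - formal_scale c (word (us @ a # vs))
    \<in> tensor_relations (mpoly_algebra V) n"
  unfolding tensor_relations_def
  by (rule formal_module.span_base, rule UnI2) (use assms in force)

text \<open>That the partial sums lie in the carrier is proved along, because the additivity
  relation in the induction step is available only for letters of the carrier.\<close>

lemma tensor_relations_sum_letter:
  assumes "length us + 1 + length vs = n" "set us \<subseteq> carrier (mpoly_algebra V)" "set vs \<subseteq> carrier (mpoly_algebra V)" "finite S"
    "\<And>m. m \<in> S \<Longrightarrow> b m \<in> carrier (mpoly_algebra V)"
  shows "word (us @ (\<Sum>m\<in>S. Poly_Mapping.single 0 (k m) * b m) # vs) -
      (\<Sum>m\<in>S. formal_scale (k m) (word (us @ b m # vs))) \<in> tensor_relations (mpoly_algebra V) n \<and>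
    (\<Sum>m\<in>S. Poly_Mapping.single 0 (k m) * b m) \<in> carrier (mpoly_algebra V)"
  using assms(4,5)
proof (induction S)
  case empty
  show ?case
    \<comment> \<open>Scaling the letter \<open>0\<close> by \<open>0\<close> shows that a word with
      a zero letter is itself a relation.\<close>
    using tensor_relations_scale_letter[OF assms(1-3), of 0 0]
    by (simp add: mpoly_algebra_closed)
next
  case (insert m S)
  let ?b = "\<Sum>m\<in>S. Poly_Mapping.single 0 (k m) * b m"
  let ?s = "\<Sum>m\<in>S. formal_scale (k m) (word (us @ b m # vs))"
  let ?a = "Poly_Mapping.single 0 (k m) * b m"
  have IH: "word (us @ ?b # vs) - ?s \<in> tensor_relations (mpoly_algebra V) n" "?b \<in> carrier (mpoly_algebra V)" "b m \<in> carrier (mpoly_algebra V)"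
    using insert by auto
  then have a: "?a \<in> carrier (mpoly_algebra V)"
    by (simp add: mpoly_algebra_closed)
  have "(word (us @ (?a + ?b) # vs) - word (us @ ?a # vs) - word (us @ ?b # vs)) +
      (word (us @ ?a # vs) - formal_scale (k m) (word (us @ b m # vs))) +
      (word (us @ ?b # vs) - ?s) \<in> tensor_relations (mpoly_algebra V) n"
    by (intro tensor_relations_subspace tensor_relations_add_letter tensor_relations_scale_letter
        assms(1-3) IH a)
  then show ?case
    using insert(1,2) IH(2) a by (simp add: algebra_simps mpoly_algebra_closed)
qed

abbreviation (input) monomial :: "('x \<Rightarrow>\<^sub>0 nat) \<Rightarrow> (('x \<Rightarrow>\<^sub>0 nat) \<Rightarrow>\<^sub>0 'c::comm_ring_1)" where
  "monomial m \<equiv> Poly_Mapping.single m 1"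

lemma mpoly_eq_sum_monomials:
  fixes a :: "('x \<Rightarrow>\<^sub>0 nat) \<Rightarrow>\<^sub>0 'c::comm_ring_1"
  assumes "finite S" "Poly_Mapping.keys a \<subseteq> S"
  shows "a = (\<Sum>m\<in>S. Poly_Mapping.single 0 (Poly_Mapping.lookup a m) * monomial m)"
proof (rule poly_mapping_eqI)
  fix m
  have "(\<Sum>m'\<in>S. if m' = m then Poly_Mapping.lookup a m' else 0) = Poly_Mapping.lookup a m"
    using assms by (auto simp: in_keys_iff sum.delta')
  then show "Poly_Mapping.lookup a m =
    Poly_Mapping.lookup (\<Sum>m\<in>S. Poly_Mapping.single 0 (Poly_Mapping.lookup a m) * monomial m) m"
    by (simp add: lookup_sum lookup_single mult_single when_def if_distrib cong: if_cong)
qed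

text \<open>The letters are expanded into monomials from left to right: \<open>us\<close> is the
  part already treated, \<open>vs\<close> the part still to come. A fixed finite set
  \<open>S\<close> containing the monomials of all letters of \<open>vs\<close> gives all expansions
  the same index set.\<close>

lemma word_expand:
  fixes V :: "'x set" and us vs :: "(('x \<Rightarrow>\<^sub>0 nat) \<Rightarrow>\<^sub>0 'c::comm_ring_1) list"
  assumes "finite S" "\<And>m. m \<in> S \<Longrightarrow> Poly_Mapping.keys m \<subseteq> V"
    and "set us \<subseteq> carrier (mpoly_algebra V)" "\<And>a. a \<in> set vs \<Longrightarrow> Poly_Mapping.keys a \<subseteq> S"
    and "length us + length vs = n"
  shows "word (us @ vs) - (\<Sum>ms | set ms \<subseteq> S \<and> length ms = length vs.
      formal_scale (word_coeff vs ms) (word (us @ map monomial ms)))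
    \<in> tensor_relations (mpoly_algebra V :: ('c, ('x \<Rightarrow>\<^sub>0 nat) \<Rightarrow>\<^sub>0 'c) module) n"
  using assms(3-)
proof (induction vs arbitrary: us)
  case Nil
  have "{ms. set ms \<subseteq> S \<and> ms = []} = {[]}" by auto
  then show ?case
    by (simp add: tensor_relations_subspace)
next
  case (Cons a vs)
  let ?A = "mpoly_algebra V :: ('c, ('x \<Rightarrow>\<^sub>0 nat) \<Rightarrow>\<^sub>0 'c) module"
  let ?R = "tensor_relations ?A n"
  let ?L = "{ms. set ms \<subseteq> S \<and> length ms = length vs}"
  have carrier: "monomial m \<in> carrier ?A" if "m \<in> S" for m
    using assms(2)[OF that] by (rule mpoly_algebra_closed)
  have "set vs \<subseteq> carrier ?A"
    using Cons.prems(2) assms(2) by (fastforce simp: mem_carrier_mpoly_algebra)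
  then have "word (us @ (\<Sum>m\<in>S. Poly_Mapping.single 0 (Poly_Mapping.lookup a m) * monomial m) # vs) -
      (\<Sum>m\<in>S. formal_scale (Poly_Mapping.lookup a m) (word (us @ monomial m # vs))) \<in> ?R"
    using Cons.prems carrier assms(1)
    by (intro tensor_relations_sum_letter[THEN conjunct1]) auto
  then have 1: "word (us @ a # vs) -
      (\<Sum>m\<in>S. formal_scale (Poly_Mapping.lookup a m) (word (us @ monomial m # vs))) \<in> ?R"
    using mpoly_eq_sum_monomials[OF assms(1), of a] Cons.prems(2)[of a] by simp
  have "word ((us @ [monomial m]) @ vs) - (\<Sum>ms\<in>?L.
      formal_scale (word_coeff vs ms) (word ((us @ [monomial m]) @ map monomial ms))) \<in> ?R" if "m \<in> S" for m
    using Cons.prems carrier[OF that] by (intro Cons.IH) auto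
  then have 2: "(\<Sum>m\<in>S. formal_scale (Poly_Mapping.lookup a m) (word (us @ monomial m # vs) - (\<Sum>ms\<in>?L.
      formal_scale (word_coeff vs ms) (word (us @ monomial m # map monomial ms))))) \<in> ?R"
    by (intro tensor_relations_subspace(5,6)) simp
  have "{ms. set ms \<subseteq> S \<and> length ms = length (a # vs)} = (\<lambda>(m, ms). m # ms) ` (S \<times> ?L)"
    by (auto simp: length_Suc_conv)
  then have "(\<Sum>ms | set ms \<subseteq> S \<and> length ms = length (a # vs).
      formal_scale (word_coeff (a # vs) ms) (word (us @ map monomial ms))) =
    (\<Sum>m\<in>S. \<Sum>ms\<in>?L. formal_scale (Poly_Mapping.lookup a m * word_coeff vs ms)
      (word (us @ monomial m # map monomial ms)))"
    by (simp add: sum.reindex inj_on_def sum.cartesian_product case_prod_beta)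
  then show ?case
    using tensor_relations_subspace(2)[OF 1 2]
    by (simp add: formal_module.scale_right_diff_distrib formal_module.scale_sum_right sum_subtractf)
qed

text \<open>Modulo the relations, \<open>p\<close> is the combination of words of monomials with its
  coordinates as coefficients. Hence it is a relation once all coordinates vanish; conversely,
  coordinates are multilinear in the letters.\<close>

lemma tensor_relations_iff_coord:
  fixes V :: "'x set" and p :: "(('x \<Rightarrow>\<^sub>0 nat) \<Rightarrow>\<^sub>0 'c::comm_ring_1) list \<Rightarrow>\<^sub>0 'c"
  assumes p: "p \<in> formal_tensors (mpoly_algebra V) n"
  shows "p \<in> tensor_relations (mpoly_algebra V) n \<longleftrightarrow> (\<forall>t. coord p t = 0)"
proof
  let ?A = "mpoly_algebra V :: ('c, ('x \<Rightarrow>\<^sub>0 nat) \<Rightarrow>\<^sub>0 'c) module"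
  let ?R = "tensor_relations ?A n"
  assume zero: "\<forall>t. coord p t = 0"
  define S where "S = (\<Union>w\<in>Poly_Mapping.keys p. \<Union>a\<in>set w. Poly_Mapping.keys a)"
  let ?L = "{ms. set ms \<subseteq> S \<and> length ms = n}"
  have "finite S" by (simp add: S_def)
  have "word w - (\<Sum>ms\<in>?L. formal_scale (word_coeff w ms) (word (map monomial ms))) \<in> ?R"
    if w: "w \<in> Poly_Mapping.keys p" for w
  proof -
    have "length w = n" using w p by (simp add: formal_tensors_def)
    moreover have "Poly_Mapping.keys m \<subseteq> V" if "m \<in> S" for m
      using that p by (fastforce simp: S_def formal_tensors_def mem_carrier_mpoly_algebra)
    moreover have "Poly_Mapping.keys a \<subseteq> S" if "a \<in> set w" for a
      using that w by (auto simp: S_def)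
    ultimately show ?thesis
      using word_expand[OF \<open>finite S\<close>, of V "[]" w n] by simp
  qed
  then have "(\<Sum>w\<in>Poly_Mapping.keys p. formal_scale (Poly_Mapping.lookup p w)
      (word w - (\<Sum>ms\<in>?L. formal_scale (word_coeff w ms) (word (map monomial ms))))) \<in> ?R"
    by (intro tensor_relations_subspace(5,6))
  moreover have expand: "(\<Sum>w\<in>Poly_Mapping.keys p. formal_scale (Poly_Mapping.lookup p w) (word w)) = p"
  proof (rule poly_mapping_eqI)
    fix w
    show "Poly_Mapping.lookup (\<Sum>w\<in>Poly_Mapping.keys p. formal_scale (Poly_Mapping.lookup p w) (word w)) w =
      Poly_Mapping.lookup p w"
      by (simp add: lookup_sum lookup_single when_def in_keys_iff if_distrib sum.delta cong: if_cong)
  qed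
  moreover have swap: "(\<Sum>w\<in>Poly_Mapping.keys p. formal_scale (Poly_Mapping.lookup p w)
      (\<Sum>ms\<in>?L. formal_scale (word_coeff w ms) (word (map monomial ms)))) =
    (\<Sum>ms\<in>?L. formal_scale (coord p ms) (word (map monomial ms)))"
    by (simp add: formal_module.scale_sum_right coord_def formal_module.scale_sum_left)
      (rule sum.swap)
  ultimately have "p - (\<Sum>ms\<in>?L. formal_scale (coord p ms) (word (map monomial ms))) \<in> ?R"
    by (simp only: formal_module.scale_right_diff_distrib sum_subtractf expand swap)
  then show "p \<in> ?R"
    using zero by simp
qed (simp add: coord_tensor_relations)

section \<open>The complete shuffle Baxter algebra in coordinates\<close>

lemma mem_tensor_class_iff: "q \<in> tensor_class A n p \<longleftrightarrow> q - p \<in> tensor_relations A n"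
  unfolding tensor_class_def by (rule set_minus_plus[symmetric])

lemma mem_tensor_class_self: "p \<in> tensor_class (mpoly_algebra V) n p"
  by (simp add: mem_tensor_class_iff tensor_relations_subspace)

lemma tensor_class_zero: "tensor_class A n 0 = tensor_relations A n"
  by (simp add: tensor_class_def)

lemma tensor_class_eqI:
  assumes "p - q \<in> tensor_relations (mpoly_algebra V) n"
  shows "tensor_class (mpoly_algebra V) n p = tensor_class (mpoly_algebra V) n q"
proof (rule Set.set_eqI)
  fix r
  have "r - p \<in> tensor_relations (mpoly_algebra V) n \<longleftrightarrow> r - q \<in> tensor_relations (mpoly_algebra V) n"
    using tensor_relations_subspace(2)[OF _ assms, of "r - p"]
      tensor_relations_subspace(3)[OF _ assms, of "r - q"] by auto
  then show "r \<in> tensor_class (mpoly_algebra V) n p \<longleftrightarrow> r \<in> tensor_class (mpoly_algebra V) n q"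
    by (simp add: mem_tensor_class_iff)
qed

lemma tensor_class_add:
  fixes p q :: "(('x \<Rightarrow>\<^sub>0 nat) \<Rightarrow>\<^sub>0 'c::comm_ring_1) list \<Rightarrow>\<^sub>0 'c" and V :: "'x set"
  shows "tensor_class (mpoly_algebra V) n p + tensor_class (mpoly_algebra V) n q =
   tensor_class (mpoly_algebra V) n (p + q)"
proof -
  let ?R = "tensor_relations (mpoly_algebra V :: ('c, ('x \<Rightarrow>\<^sub>0 nat) \<Rightarrow>\<^sub>0 'c) module) n"
  have "?R + ?R = ?R"
  proof (intro Set.equalityI subsetI)
    fix r assume "r \<in> ?R"
    then show "r \<in> ?R + ?R"
      using set_plus_intro[OF tensor_relations_subspace(1)] by fastforce
  qed (auto elim!: set_plus_elim intro: tensor_relations_subspace)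
  then show ?thesis
    by (simp add: tensor_class_def set_plus_rearrange)
qed

text \<open>The choice of a representative does not matter, as coordinates are constant on cosets
  (\<open>coord_tensor_class\<close>).\<close>

definition coset_coord ::
    "((('x \<Rightarrow>\<^sub>0 nat) \<Rightarrow>\<^sub>0 'c::comm_ring_1) list \<Rightarrow>\<^sub>0 'c) set \<Rightarrow> ('x \<Rightarrow>\<^sub>0 nat) list \<Rightarrow> 'c" where
  "coset_coord P = coord (SOME p. p \<in> P)"

lemma coord_tensor_class:
  assumes "q \<in> tensor_class (mpoly_algebra V) n p"
  shows "coord q t = coord p t"
  using coord_tensor_relations[of "q - p" V n t] assms by (simp add: mem_tensor_class_iff coord_diff)

lemma coset_coord_tensor_class [simp]:
  "coset_coord (tensor_class (mpoly_algebra V) n p) t = coord p t"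
  unfolding coset_coord_def
  using someI[of "\<lambda>q. q \<in> tensor_class (mpoly_algebra V) n p", OF mem_tensor_class_self]
  by (rule coord_tensor_class)

lemma coset_coord_tensor_relations [simp]:
  "coset_coord (tensor_relations (mpoly_algebra V) n) t = 0"
  using coset_coord_tensor_class[of V n 0 t] by (simp add: tensor_class_zero)

lemma tensor_powerE:
  assumes "P \<in> tensor_power A n"
  obtains p where "p \<in> formal_tensors A n" "P = tensor_class A n p"
  using assms by (auto simp: tensor_power_def)

lemma tensor_class_in_tensor_power:
  "p \<in> formal_tensors A n \<Longrightarrow> tensor_class A n p \<in> tensor_power A n"
  by (simp add: tensor_power_def)

lemma tensor_power_zero:
  "tensor_relations (mpoly_algebra V) n \<in> tensor_power (mpoly_algebra V) n"
  using tensor_class_in_tensor_power[OF formal_tensors_subspace(1), of V n]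
  by (simp add: tensor_class_zero)

lemma tensor_power_add:
  assumes "P \<in> tensor_power (mpoly_algebra V) n" "Q \<in> tensor_power (mpoly_algebra V) n"
  shows "P + Q \<in> tensor_power (mpoly_algebra V) n"
    and "coset_coord (P + Q) t = coset_coord P t + coset_coord Q t"
proof -
  from assms obtain p q where pq:
      "p \<in> formal_tensors (mpoly_algebra V) n" "P = tensor_class (mpoly_algebra V) n p"
      "q \<in> formal_tensors (mpoly_algebra V) n" "Q = tensor_class (mpoly_algebra V) n q"
    by (auto elim!: tensor_powerE)
  then show "P + Q \<in> tensor_power (mpoly_algebra V) n"
    by (simp add: tensor_class_add tensor_class_in_tensor_power formal_tensors_subspace)
  show "coset_coord (P + Q) t = coset_coord P t + coset_coord Q t"
    by (simp add: pq tensor_class_add coord_add)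
qed

lemma coord_length:
  assumes "p \<in> formal_tensors A n" "length t \<noteq> n"
  shows "coord p t = 0"
  unfolding coord_def using assms
  by (intro sum.neutral) (simp add: formal_tensors_def word_coeff_length)

lemma coset_coord_inject:
  assumes "P \<in> tensor_power (mpoly_algebra V) n" "Q \<in> tensor_power (mpoly_algebra V) n"
    and "\<And>t. length t = n \<Longrightarrow> coset_coord P t = coset_coord Q t"
  shows "P = Q"
proof -
  from assms obtain p q where pq:
      "p \<in> formal_tensors (mpoly_algebra V) n" "P = tensor_class (mpoly_algebra V) n p"
      "q \<in> formal_tensors (mpoly_algebra V) n" "Q = tensor_class (mpoly_algebra V) n q"
    by (auto elim!: tensor_powerE)
  have "coord p t = coord q t" for t
  proof (cases "length t = n")
    case True
    then show ?thesis using assms(3) pq by simp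
  next
    case False
    then show ?thesis using coord_length pq(1,3) by metis
  qed
  then have "p - q \<in> tensor_relations (mpoly_algebra V) n"
    using pq by (simp add: tensor_relations_iff_coord formal_tensors_subspace coord_diff)
  then show ?thesis
    using pq by (simp add: tensor_class_eqI)
qed

lemma coset_coord_length:
  assumes "P \<in> tensor_power (mpoly_algebra V) n" "length t \<noteq> n"
  shows "coset_coord P t = 0"
proof -
  from assms obtain p where "p \<in> formal_tensors (mpoly_algebra V) n" "P = tensor_class (mpoly_algebra V) n p"
    by (auto elim!: tensor_powerE)
  then show ?thesis
    using assms(2) by (simp add: coord_length)
qed

text \<open>A representative uses finitely many words with finitely many monomials in their letters,
  and a nonzero coordinate can occur only at words of length \<open>n\<close> spelled with these.
  Later this provides the maximum among the leading words.\<close>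

lemma finite_coset_coord:
  assumes "P \<in> tensor_power (mpoly_algebra V) n"
  shows "finite {t. coset_coord P t \<noteq> 0}"
proof -
  from assms obtain p where p: "p \<in> formal_tensors (mpoly_algebra V) n" "P = tensor_class (mpoly_algebra V) n p"
    by (auto elim!: tensor_powerE)
  let ?S = "\<Union>w\<in>Poly_Mapping.keys p. \<Union>a\<in>set w. Poly_Mapping.keys a"
  have sub: "set t \<subseteq> (\<Union>a\<in>set w. Poly_Mapping.keys a)" if "word_coeff w t \<noteq> 0" for w :: "(('a \<Rightarrow>\<^sub>0 nat) \<Rightarrow>\<^sub>0 'b) list" and t
    using that
  proof (induction w t rule: word_coeff.induct)
    case (2 a w m ms)
    then have "Poly_Mapping.lookup a m \<noteq> 0" "word_coeff w ms \<noteq> 0" by auto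
    then show ?case using 2(1) by (auto simp: in_keys_iff)
  qed auto
  have "{t. coset_coord P t \<noteq> 0} \<subseteq> {t. set t \<subseteq> ?S \<and> length t = n}"
  proof safe
    fix t assume nz: "coset_coord P t \<noteq> 0"
    show "length t = n"
      using coset_coord_length[OF assms] nz by blast
    fix m assume m: "m \<in> set t"
    have "(\<Sum>w\<in>Poly_Mapping.keys p. Poly_Mapping.lookup p w * word_coeff w t) \<noteq> 0"
      using nz by (simp add: p coord_def)
    then obtain w where w: "w \<in> Poly_Mapping.keys p" "word_coeff w t \<noteq> 0"
      by (metis (no_types, lifting) mult_zero_right sum.neutral)
    then show "m \<in> ?S"
      using sub[OF w(2)] m by blast
  qed
  then show ?thesis
    by (rule finite_subset) (rule finite_lists_length_eq, simp)
qed

lemma sum_tensor_power: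
  assumes "finite I" "\<And>i. i \<in> I \<Longrightarrow> P i \<in> tensor_power (mpoly_algebra V) n"
  shows "tensor_relations (mpoly_algebra V) n + (\<Sum>i\<in>I. P i) \<in> tensor_power (mpoly_algebra V) n \<and>
    coset_coord (tensor_relations (mpoly_algebra V) n + (\<Sum>i\<in>I. P i)) t = (\<Sum>i\<in>I. coset_coord (P i) t)"
  using assms
proof (induction I)
  case (insert i I)
  have "tensor_relations (mpoly_algebra V) n + (\<Sum>i\<in>insert i I. P i) =
      P i + (tensor_relations (mpoly_algebra V) n + (\<Sum>i\<in>I. P i))"
    using insert(1,2) by (simp add: ac_simps)
  then show ?case
    using insert tensor_power_add[of "P i" V n "tensor_relations (mpoly_algebra V) n + (\<Sum>i\<in>I. P i)"]
    by simp
qed (simp add: tensor_power_zero)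

section \<open>The product on cosets\<close>

lemma keys_sumD:
  assumes "w \<in> Poly_Mapping.keys (\<Sum>i\<in>I. f i)"
  obtains i where "i \<in> I" "w \<in> Poly_Mapping.keys (f i)"
proof -
  have "(\<Sum>i\<in>I. Poly_Mapping.lookup (f i) w) \<noteq> 0"
    using assms by (simp add: in_keys_iff lookup_sum)
  then obtain i where "i \<in> I" "Poly_Mapping.lookup (f i) w \<noteq> 0"
    by (rule sum.not_neutral_contains_not_neutral)
  then show ?thesis
    by (intro that) (simp_all add: in_keys_iff)
qed

lemma keys_formal_scale: "w \<in> Poly_Mapping.keys (formal_scale c p) \<Longrightarrow> w \<in> Poly_Mapping.keys p"
  by (auto simp: in_keys_iff)

lemma set_mixed_word:
  assumes "\<sigma> \<in> shuffle_perms (length xs) (length ys)" "T \<subseteq> admissible_pairs (length xs) (length ys) \<sigma>"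
    and "set xs \<subseteq> carrier (mpoly_algebra V)" "set ys \<subseteq> carrier (mpoly_algebra V)"
  shows "set (mixed_word (mpoly_algebra V) xs ys \<sigma> T) \<subseteq> carrier (mpoly_algebra V)"
proof -
  let ?N = "length xs + length ys"
  have letter: "(xs @ ys) ! (\<sigma> k - 1) \<in> carrier (mpoly_algebra V)" if "k \<in> {1..?N}" for k
  proof -
    have "\<sigma> k \<in> {1..?N}"
      using assms(1) that permutes_in_image[of \<sigma> "{1..?N}" k] by (simp add: shuffle_perms_def)
    then have "(xs @ ys) ! (\<sigma> k - 1) \<in> set (xs @ ys)"
      by (intro nth_mem) auto
    then show ?thesis using assms(3,4) by auto
  qed
  have "k + 1 \<in> {1..?N}" if "(k, k + 1) \<in> T" for k
    using that assms(2) by (auto simp: admissible_pairs_def)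
  then show ?thesis
    using letter letter[of "k + 1" for k]
    by (auto simp: mixed_word_def Let_def mpoly_algebra_closed simp del: upt_Suc)
qed

lemma set_word_product:
  fixes xs ys :: "(('x \<Rightarrow>\<^sub>0 nat) \<Rightarrow>\<^sub>0 'c::comm_ring_1) list"
  assumes "w \<in> Poly_Mapping.keys (word_product lam (mpoly_algebra V) xs ys)" "xs \<noteq> []" "ys \<noteq> []"
    and "set xs \<subseteq> carrier (mpoly_algebra V)" "set ys \<subseteq> carrier (mpoly_algebra V)"
  shows "set w \<subseteq> carrier (mpoly_algebra V)"
proof -
  obtain x xp y yp where xy: "xs = x # xp" "ys = y # yp"
    using assms(2,3) by (auto simp: neq_Nil_conv)
  show ?thesis
  proof (cases "xp = [] \<or> yp = []")
    case True
    then have "w = x * y # xp @ yp"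
      using assms(1) by (auto simp: word_product_def xy split: if_splits)
    then show ?thesis
      using assms(4,5) by (auto simp: xy mpoly_algebra_closed)
  next
    case False
    then have "w \<in> Poly_Mapping.keys (\<Sum>(\<sigma>, T)\<in>mixable_shuffles (length xp) (length yp).
        formal_scale (lam ^ card T) (word (x * y # mixed_word (mpoly_algebra V) xp yp \<sigma> T)))"
      using assms(1) by (simp add: word_product_def xy)
    then obtain s where s: "s \<in> mixable_shuffles (length xp) (length yp)"
        "w \<in> Poly_Mapping.keys (case s of (\<sigma>, T) \<Rightarrow>
          formal_scale (lam ^ card T) (word (x * y # mixed_word (mpoly_algebra V) xp yp \<sigma> T)))"
      by (rule keys_sumD)
    obtain \<sigma> T where \<sigma>T: "s = (\<sigma>, T)" by (cases s)
    then have "w \<in> Poly_Mapping.keys (word (x * y # mixed_word (mpoly_algebra V) xp yp \<sigma> T) ::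
        _ \<Rightarrow>\<^sub>0 'c)"
      using s(2) by (auto dest: keys_formal_scale)
    then have "w = x * y # mixed_word (mpoly_algebra V) xp yp \<sigma> T"
      by simp
    then show ?thesis
      using assms(4,5) set_mixed_word[of \<sigma> xp yp T V] s(1)
      by (simp add: xy \<sigma>T mpoly_algebra_closed mixable_shuffles_def)
  qed
qed

lemma length_part_formal_product:
  assumes "p \<in> formal_tensors (mpoly_algebra V) (Suc i)" "q \<in> formal_tensors (mpoly_algebra V) (Suc j)"
  shows "length_part n (formal_product lam (mpoly_algebra V) p q) \<in> formal_tensors (mpoly_algebra V) n"
proof -
  have letters: "set w \<subseteq> carrier (mpoly_algebra V)"
    if w: "w \<in> Poly_Mapping.keys (formal_product lam (mpoly_algebra V) p q)" for w
  proof -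
    obtain xs ys where "xs \<in> Poly_Mapping.keys p" "ys \<in> Poly_Mapping.keys q"
        "w \<in> Poly_Mapping.keys (word_product lam (mpoly_algebra V) xs ys)"
      using w unfolding formal_product_def by (elim keys_sumD) (blast dest: keys_formal_scale)
    then show ?thesis
      using assms by (intro set_word_product[of w lam V xs ys]) (auto simp: formal_tensors_def)
  qed
  have "length w = n \<and> set w \<subseteq> carrier (mpoly_algebra V)"
    if w: "w \<in> Poly_Mapping.keys (length_part n (formal_product lam (mpoly_algebra V) p q))" for w
  proof -
    obtain v where v: "v \<in> Poly_Mapping.keys (formal_product lam (mpoly_algebra V) p q)" "length v = n"
        "w \<in> Poly_Mapping.keys (Poly_Mapping.single v
          (Poly_Mapping.lookup (formal_product lam (mpoly_algebra V) p q) v))"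
      using w unfolding length_part_def by (elim keys_sumD) blast
    then have "w = v"
      by (simp split: if_splits)
    then show ?thesis
      using v letters[OF v(1)] by simp
  qed
  then show ?thesis
    unfolding formal_tensors_def by blast
qed

lemma UN_UN_constant:
  assumes "a \<in> P" "b \<in> Q" "\<And>p q. p \<in> P \<Longrightarrow> q \<in> Q \<Longrightarrow> f p q = c"
  shows "(\<Union>p\<in>P. \<Union>q\<in>Q. f p q) = c"
proof (intro Set.equalityI subsetI)
  fix x assume "x \<in> c"
  then have "x \<in> f a b" using assms by simp
  then show "x \<in> (\<Union>p\<in>P. \<Union>q\<in>Q. f p q)" using assms(1,2) by blast
next
  fix x assume "x \<in> (\<Union>p\<in>P. \<Union>q\<in>Q. f p q)"
  then obtain p q where "p \<in> P" "q \<in> Q" "x \<in> f p q" by blast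
  then show "x \<in> c" using assms(3) by simp
qed

text \<open>The coordinates of a product depend only on the coordinates of its factors, and
  coordinates separate cosets. So the product is independent of the representatives without any
  computation with the generators of the relations.\<close>

lemma component_product_tensor_class:
  assumes p: "p \<in> formal_tensors (mpoly_algebra V) (Suc i)" and q: "q \<in> formal_tensors (mpoly_algebra V) (Suc j)"
  shows "component_product lam (mpoly_algebra V) k (tensor_class (mpoly_algebra V) (Suc i) p)
      (tensor_class (mpoly_algebra V) (Suc j) q) =
    tensor_class (mpoly_algebra V) (Suc k) (length_part (Suc k) (formal_product lam (mpoly_algebra V) p q))"
proof -
  have formal: "r \<in> formal_tensors (mpoly_algebra V) n"
    if "r \<in> tensor_class (mpoly_algebra V) n r'" "r' \<in> formal_tensors (mpoly_algebra V) n" for r r' n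
  proof -
    have "r - r' \<in> formal_tensors (mpoly_algebra V) n"
      using that(1) tensor_relations_subset_formal_tensors unfolding mem_tensor_class_iff by blast
    from formal_tensors_subspace(2)[OF this that(2)] show ?thesis by simp
  qed
  have "tensor_class (mpoly_algebra V) (Suc k) (length_part (Suc k) (formal_product lam (mpoly_algebra V) p' q')) =
      tensor_class (mpoly_algebra V) (Suc k) (length_part (Suc k) (formal_product lam (mpoly_algebra V) p q))"
    if p': "p' \<in> tensor_class (mpoly_algebra V) (Suc i) p" and q': "q' \<in> tensor_class (mpoly_algebra V) (Suc j) q" for p' q'
  proof (rule coset_coord_inject)
    have p'q': "p' \<in> formal_tensors (mpoly_algebra V) (Suc i)" "q' \<in> formal_tensors (mpoly_algebra V) (Suc j)"
      using formal p p' q q' by blast+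
    show "tensor_class (mpoly_algebra V) (Suc k) (length_part (Suc k)
        (formal_product lam (mpoly_algebra V) p' q')) \<in> tensor_power (mpoly_algebra V) (Suc k)"
      "tensor_class (mpoly_algebra V) (Suc k) (length_part (Suc k)
        (formal_product lam (mpoly_algebra V) p q)) \<in> tensor_power (mpoly_algebra V) (Suc k)"
      using p q p'q' by (auto intro!: tensor_class_in_tensor_power length_part_formal_product)
    have nonempty: "[] \<notin> Poly_Mapping.keys r" if "r \<in> formal_tensors (mpoly_algebra V) (Suc n)" for r n
      using that by (auto simp: formal_tensors_def)
    have "coord p' = coord p" "coord q' = coord q"
      using coord_tensor_class p' q' by blast+
    then show "coset_coord (tensor_class (mpoly_algebra V) (Suc k) (length_part (Suc k)
          (formal_product lam (mpoly_algebra V) p' q'))) t =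
        coset_coord (tensor_class (mpoly_algebra V) (Suc k) (length_part (Suc k)
          (formal_product lam (mpoly_algebra V) p q))) t" for t
      by (simp add: coord_length_part coord_formal_product nonempty[OF p] nonempty[OF q]
          nonempty[OF p'q'(1)] nonempty[OF p'q'(2)])
  qed
  then show ?thesis
    unfolding component_product_def Suc_eq_plus1[symmetric]
    by (intro UN_UN_constant[OF mem_tensor_class_self mem_tensor_class_self])
qed

lemma component_product_tensor_power:
  assumes "P \<in> tensor_power (mpoly_algebra V) (Suc i)" "Q \<in> tensor_power (mpoly_algebra V) (Suc j)"
  shows "component_product lam (mpoly_algebra V) k P Q \<in> tensor_power (mpoly_algebra V) (Suc k)"
    and "length t = Suc k \<Longrightarrow> coset_coord (component_product lam (mpoly_algebra V) k P Q) t =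
      baxter_prod lam (coset_coord P) (coset_coord Q) t"
proof -
  from assms obtain p q where pq:
      "p \<in> formal_tensors (mpoly_algebra V) (Suc i)" "P = tensor_class (mpoly_algebra V) (Suc i) p"
      "q \<in> formal_tensors (mpoly_algebra V) (Suc j)" "Q = tensor_class (mpoly_algebra V) (Suc j) q"
    by (auto elim!: tensor_powerE)
  then show "component_product lam (mpoly_algebra V) k P Q \<in> tensor_power (mpoly_algebra V) (Suc k)"
    by (simp add: component_product_tensor_class tensor_class_in_tensor_power length_part_formal_product)
  have nonempty: "[] \<notin> Poly_Mapping.keys p" "[] \<notin> Poly_Mapping.keys q"
    using pq by (auto simp: formal_tensors_def)
  have coords: "coset_coord P = coord p" "coset_coord Q = coord q"
    by (rule ext, simp only: pq coset_coord_tensor_class)+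
  assume "length t = Suc k"
  then show "coset_coord (component_product lam (mpoly_algebra V) k P Q) t =
      baxter_prod lam (coset_coord P) (coset_coord Q) t"
    unfolding coords unfolding pq component_product_tensor_class[OF pq(1,3)] coset_coord_tensor_class
    by (simp only: coord_length_part coord_formal_product[OF nonempty] simp_thms if_True)
qed

section \<open>Coordinates of families and the ring axioms\<close>

definition family_coord ::
    "(nat \<Rightarrow> ((('x \<Rightarrow>\<^sub>0 nat) \<Rightarrow>\<^sub>0 'c::comm_ring_1) list \<Rightarrow>\<^sub>0 'c) set) \<Rightarrow> ('x \<Rightarrow>\<^sub>0 nat) list \<Rightarrow> 'c" where
  "family_coord f t = (if t = [] then 0 else coset_coord (f (length t - 1)) t)"

lemma family_coord_Nil [simp]: "family_coord f [] = 0"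
  by (simp add: family_coord_def)

lemma family_coord_length: "length t = Suc k \<Longrightarrow> family_coord f t = coset_coord (f k) t"
  by (auto simp: family_coord_def)

lemma complete_carrier_iff:
  "f \<in> carrier (complete_shuffle_algebra lam A) \<longleftrightarrow> (\<forall>k. f k \<in> tensor_power A (Suc k))"
  by (simp add: complete_shuffle_algebra_def)

text \<open>Turns each equation between elements of the completion into an identity of functions on
  words.\<close>

lemma family_coord_inject:
  assumes "f \<in> carrier (complete_shuffle_algebra lam (mpoly_algebra V))"
    "g \<in> carrier (complete_shuffle_algebra lam (mpoly_algebra V))"
    "\<And>t. family_coord f t = family_coord g t"
  shows "f = g"
proof
  fix k
  have "coset_coord (f k) t = coset_coord (g k) t" if "length t = Suc k" for t
    using assms(3)[of t] that by (simp add: family_coord_length)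
  then show "f k = g k"
    using assms(1,2) by (intro coset_coord_inject[of _ V "Suc k"]) (auto simp: complete_carrier_iff)
qed

lemma complete_add:
  assumes "f \<in> carrier (complete_shuffle_algebra lam (mpoly_algebra V))"
    "g \<in> carrier (complete_shuffle_algebra lam (mpoly_algebra V))"
  shows "f \<oplus>\<^bsub>complete_shuffle_algebra lam (mpoly_algebra V)\<^esub> g \<in>
      carrier (complete_shuffle_algebra lam (mpoly_algebra V))"
    and "family_coord (f \<oplus>\<^bsub>complete_shuffle_algebra lam (mpoly_algebra V)\<^esub> g) t =
      family_coord f t + family_coord g t"
proof -
  have fg: "f k \<in> tensor_power (mpoly_algebra V) (Suc k)" "g k \<in> tensor_power (mpoly_algebra V) (Suc k)" for k
    using assms by (simp_all add: complete_carrier_iff)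
  have sum: "f \<oplus>\<^bsub>complete_shuffle_algebra lam (mpoly_algebra V)\<^esub> g = (\<lambda>k. f k + g k)"
    by (simp add: complete_shuffle_algebra_def)
  show "f \<oplus>\<^bsub>complete_shuffle_algebra lam (mpoly_algebra V)\<^esub> g \<in>
      carrier (complete_shuffle_algebra lam (mpoly_algebra V))"
    using tensor_power_add(1)[OF fg] by (simp add: sum complete_carrier_iff)
  show "family_coord (f \<oplus>\<^bsub>complete_shuffle_algebra lam (mpoly_algebra V)\<^esub> g) t =
      family_coord f t + family_coord g t"
    using tensor_power_add(2)[OF fg] by (simp add: sum family_coord_def)
qed

lemma complete_zero:
  "\<zero>\<^bsub>complete_shuffle_algebra lam (mpoly_algebra V)\<^esub> \<in>
      carrier (complete_shuffle_algebra lam (mpoly_algebra V))"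
  "family_coord \<zero>\<^bsub>complete_shuffle_algebra lam (mpoly_algebra V)\<^esub> t = 0"
  by (simp_all add: complete_carrier_iff complete_shuffle_algebra_def shuffle_algebra_def
      tensor_power_zero family_coord_def)

lemma complete_one:
  fixes V :: "'x set" and lam :: "'c::comm_ring_1"
  shows "\<one>\<^bsub>complete_shuffle_algebra lam (mpoly_algebra V)\<^esub> \<in>
      carrier (complete_shuffle_algebra lam (mpoly_algebra V))"
  and "family_coord \<one>\<^bsub>complete_shuffle_algebra lam (mpoly_algebra V)\<^esub> t = (if t = [0] then 1 else 0)"
proof -
  let ?A = "mpoly_algebra V :: ('c, ('x \<Rightarrow>\<^sub>0 nat) \<Rightarrow>\<^sub>0 'c) module"
  have one: "\<one>\<^bsub>complete_shuffle_algebra lam ?A\<^esub> =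
      (\<lambda>k. if k = 0 then tensor_class ?A (Suc 0) (word [1]) else tensor_relations ?A (Suc k))"
    by (simp add: complete_shuffle_algebra_def shuffle_algebra_def cong: if_cong)
  have "tensor_class ?A (Suc 0) (word [1]) \<in> tensor_power ?A (Suc 0)"
    by (intro tensor_class_in_tensor_power single_in_formal_tensors) (auto simp: mpoly_algebra_closed)
  then show "\<one>\<^bsub>complete_shuffle_algebra lam ?A\<^esub> \<in> carrier (complete_shuffle_algebra lam ?A)"
    by (simp add: one complete_carrier_iff tensor_power_zero)
  show "family_coord \<one>\<^bsub>complete_shuffle_algebra lam ?A\<^esub> t = (if t = [0] then 1 else 0)"
  proof (cases t)
    case (Cons m s)
    then show ?thesis
      by (cases s) (auto simp: family_coord_def one lookup_one when_def)
  qed simp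
qed

text \<open>By bilinearity the double sum over the supports can be moved into the two arguments of
  \<open>baxter_prod\<close>. The bound on the supports makes these sums finite.\<close>

lemma shuffle_algebra_mult_component:
  assumes f: "\<And>k. f k \<in> tensor_power (mpoly_algebra V) (Suc k)" "family_support (mpoly_algebra V) f \<subseteq> {..k}"
    and g: "\<And>k. g k \<in> tensor_power (mpoly_algebra V) (Suc k)" "family_support (mpoly_algebra V) g \<subseteq> {..k}"
  shows "(f \<otimes>\<^bsub>shuffle_algebra lam (mpoly_algebra V)\<^esub> g) k \<in> tensor_power (mpoly_algebra V) (Suc k)"
    and "length t = Suc k \<Longrightarrow> coset_coord ((f \<otimes>\<^bsub>shuffle_algebra lam (mpoly_algebra V)\<^esub> g) k) t =
      baxter_prod lam (family_coord f) (family_coord g) t"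
proof -
  let ?I = "family_support (mpoly_algebra V) f" and ?J = "family_support (mpoly_algebra V) g"
  let ?P = "\<lambda>(i, j). component_product lam (mpoly_algebra V) k (f i) (g j)"
  have finite: "finite ?I" "finite ?J"
    using f(2) g(2) by (auto intro: finite_subset)
  have prod: "(f \<otimes>\<^bsub>shuffle_algebra lam (mpoly_algebra V)\<^esub> g) k =
      tensor_relations (mpoly_algebra V) (Suc k) + (\<Sum>p\<in>?I \<times> ?J. ?P p)"
    by (simp add: shuffle_algebra_def sum.cartesian_product)
  have mem: "?P p \<in> tensor_power (mpoly_algebra V) (Suc k)" for p
    using component_product_tensor_power(1)[OF f(1) g(1)] by (simp add: case_prod_beta)
  note sum = sum_tensor_power[of "?I \<times> ?J" ?P V "Suc k", OF _ mem]
  show "(f \<otimes>\<^bsub>shuffle_algebra lam (mpoly_algebra V)\<^esub> g) k \<in> tensor_power (mpoly_algebra V) (Suc k)"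
    unfolding prod using sum finite by blast
  assume t: "length t = Suc k"
  have outside: "coset_coord (h i) u = 0" if "i \<notin> family_support (mpoly_algebra V) h" for h i u
    using that by (simp add: family_support_def)
  \<comment> \<open>Of all components only the one with index \<open>length u - 1\<close> has a
    coordinate at \<open>u\<close>; it is inserted into the index set in case it is zero and thus
    missing from the support.\<close>
  have family: "(\<Sum>i\<in>family_support (mpoly_algebra V) h. coset_coord (h i) u) = family_coord h u"
    if h: "\<And>k. h k \<in> tensor_power (mpoly_algebra V) (Suc k)" "finite (family_support (mpoly_algebra V) h)" for h u
  proof (cases u)
    case Nil
    then show ?thesis
      using coset_coord_length[OF h(1)] by simp
  next
    case (Cons m s)
    have "(\<Sum>i\<in>family_support (mpoly_algebra V) h. coset_coord (h i) u) =
      (\<Sum>i\<in>insert (length s) (family_support (mpoly_algebra V) h). coset_coord (h i) u)"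
      using h(2) outside by (intro sum.mono_neutral_left) auto
    also have "\<dots> = (\<Sum>i\<in>{length s}. coset_coord (h i) u)"
      using h coset_coord_length[OF h(1), of u] Cons by (intro sum.mono_neutral_right) auto
    finally show ?thesis
      by (simp add: Cons family_coord_def)
  qed
  have "coset_coord ((f \<otimes>\<^bsub>shuffle_algebra lam (mpoly_algebra V)\<^esub> g) k) t =
      (\<Sum>i\<in>?I. \<Sum>j\<in>?J. coset_coord (component_product lam (mpoly_algebra V) k (f i) (g j)) t)"
    unfolding prod using sum[of t] finite by (simp add: sum.cartesian_product case_prod_beta)
  also have "\<dots> = (\<Sum>i\<in>?I. \<Sum>j\<in>?J. baxter_prod lam (coset_coord (f i)) (coset_coord (g j)) t)"
    using component_product_tensor_power(2)[OF f(1) g(1) t] by simp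
  also have "\<dots> = baxter_prod lam (\<lambda>u. \<Sum>i\<in>?I. coset_coord (f i) u) (\<lambda>u. \<Sum>j\<in>?J. coset_coord (g j) u) t"
    by (simp only: baxter_prod_sum_left baxter_prod_sum_right)
  finally show "coset_coord ((f \<otimes>\<^bsub>shuffle_algebra lam (mpoly_algebra V)\<^esub> g) k) t =
      baxter_prod lam (family_coord f) (family_coord g) t"
    using family[OF f(1) finite(1)] family[OF g(1) finite(2)] by simp
qed

text \<open>At a word of length \<open>k + 1\<close> the product reads only words of at most this
  length, and there the truncation at \<open>k\<close> agrees with the whole family.\<close>

lemma complete_mult:
  assumes "f \<in> carrier (complete_shuffle_algebra lam (mpoly_algebra V))"
    "g \<in> carrier (complete_shuffle_algebra lam (mpoly_algebra V))"
  shows "f \<otimes>\<^bsub>complete_shuffle_algebra lam (mpoly_algebra V)\<^esub> g \<in>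
      carrier (complete_shuffle_algebra lam (mpoly_algebra V))"
    and "family_coord (f \<otimes>\<^bsub>complete_shuffle_algebra lam (mpoly_algebra V)\<^esub> g) t =
      baxter_prod lam (family_coord f) (family_coord g) t"
proof -
  let ?tr = "truncate_family (mpoly_algebra V)"
  have fg: "f k \<in> tensor_power (mpoly_algebra V) (Suc k)" "g k \<in> tensor_power (mpoly_algebra V) (Suc k)" for k
    using assms by (simp_all add: complete_carrier_iff)
  have tr: "?tr n h k \<in> tensor_power (mpoly_algebra V) (Suc k)"
    if "h k \<in> tensor_power (mpoly_algebra V) (Suc k)" for h n k
    using that by (simp add: truncate_family_def tensor_power_zero)
  have supp: "family_support (mpoly_algebra V) (?tr n h) \<subseteq> {..n}" for h n
    by (auto simp: family_support_def truncate_family_def)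
  have prod: "f \<otimes>\<^bsub>complete_shuffle_algebra lam (mpoly_algebra V)\<^esub> g =
    (\<lambda>k. (?tr k f \<otimes>\<^bsub>shuffle_algebra lam (mpoly_algebra V)\<^esub> ?tr k g) k)"
    by (simp add: complete_shuffle_algebra_def)
  note comp = shuffle_algebra_mult_component[OF tr[OF fg(1)] supp tr[OF fg(2)] supp]
  show "f \<otimes>\<^bsub>complete_shuffle_algebra lam (mpoly_algebra V)\<^esub> g \<in>
      carrier (complete_shuffle_algebra lam (mpoly_algebra V))"
    using comp(1) by (simp add: prod complete_carrier_iff)
  show "family_coord (f \<otimes>\<^bsub>complete_shuffle_algebra lam (mpoly_algebra V)\<^esub> g) t =
      baxter_prod lam (family_coord f) (family_coord g) t"
  proof (cases t)
    case (Cons m s)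
    then have t: "length t = Suc (length s)" by simp
    have "family_coord (?tr (length s) h) u = family_coord h u" if "length u \<le> length t" for h u
      using that t by (auto simp: family_coord_def truncate_family_def)
    then show ?thesis
      unfolding prod family_coord_length[OF t] comp(2)[OF t] by (intro baxter_prod_cong) auto
  qed simp
qed

lemma complete_uminus:
  assumes "f \<in> carrier (complete_shuffle_algebra lam (mpoly_algebra V))"
  obtains g where "g \<in> carrier (complete_shuffle_algebra lam (mpoly_algebra V))"
    "\<And>t. family_coord g t = - family_coord f t"
proof -
  have "\<exists>Q. Q \<in> tensor_power (mpoly_algebra V) (Suc k) \<and> (\<forall>t. coset_coord Q t = - coset_coord (f k) t)" for k
  proof -
    have "f k \<in> tensor_power (mpoly_algebra V) (Suc k)"
      using assms by (simp add: complete_carrier_iff)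
    then obtain p where p: "p \<in> formal_tensors (mpoly_algebra V) (Suc k)" "f k = tensor_class (mpoly_algebra V) (Suc k) p"
      by (rule tensor_powerE)
    then show ?thesis
      by (intro exI[of _ "tensor_class (mpoly_algebra V) (Suc k) (- p)"])
        (simp add: tensor_class_in_tensor_power formal_tensors_subspace coord_uminus)
  qed
  then obtain g where "\<And>k. g k \<in> tensor_power (mpoly_algebra V) (Suc k)"
      "\<And>k t. coset_coord (g k) t = - coset_coord (f k) t"
    by metis
  then show ?thesis
    by (intro that[of g]) (auto simp: complete_carrier_iff family_coord_def)
qed

lemma cring_complete_shuffle_algebra: "cring (complete_shuffle_algebra lam (mpoly_algebra V))"
proof -
  let ?S = "complete_shuffle_algebra lam (mpoly_algebra V)"
  note closed = complete_add(1) complete_zero(1) complete_one(1) complete_mult(1)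
  note coords = complete_add(2) complete_zero(2) complete_one(2) complete_mult(2)
  have mult_coord: "family_coord (f \<otimes>\<^bsub>?S\<^esub> g) = baxter_prod lam (family_coord f) (family_coord g)"
    "family_coord (f \<oplus>\<^bsub>?S\<^esub> g) = (\<lambda>t. family_coord f t + family_coord g t)"
    if "f \<in> carrier ?S" "g \<in> carrier ?S" for f g
    using that by (auto simp: coords)
  have one_coord: "family_coord \<one>\<^bsub>?S\<^esub> = (\<lambda>t. if t = [0] then 1 else 0)"
    by (rule ext) (rule coords)
  show ?thesis
  proof (rule cringI)
    show "abelian_group ?S"
    proof (rule abelian_groupI)
      fix f assume f: "f \<in> carrier ?S"
      then obtain g where g: "g \<in> carrier ?S" "\<And>t. family_coord g t = - family_coord f t"
        by (rule complete_uminus) blast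
      then have "g \<oplus>\<^bsub>?S\<^esub> f = \<zero>\<^bsub>?S\<^esub>"
        using f by (intro family_coord_inject[of _ lam V]) (auto simp: closed coords)
      then show "\<exists>g\<in>carrier ?S. g \<oplus>\<^bsub>?S\<^esub> f = \<zero>\<^bsub>?S\<^esub>"
        using g by blast
    qed (auto intro!: family_coord_inject[of _ lam V] simp: closed coords add_ac)
    show "comm_monoid ?S"
    proof (rule comm_monoidI)
      fix f g h assume "f \<in> carrier ?S" "g \<in> carrier ?S" "h \<in> carrier ?S"
      then show "f \<otimes>\<^bsub>?S\<^esub> g \<otimes>\<^bsub>?S\<^esub> h = f \<otimes>\<^bsub>?S\<^esub> (g \<otimes>\<^bsub>?S\<^esub> h)"
        by (intro family_coord_inject[of _ lam V]) (auto simp: closed mult_coord baxter_prod_assoc)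
    next
      fix f g assume "f \<in> carrier ?S" "g \<in> carrier ?S"
      then show "f \<otimes>\<^bsub>?S\<^esub> g = g \<otimes>\<^bsub>?S\<^esub> f"
        by (intro family_coord_inject[of _ lam V])
          (auto simp: closed mult_coord baxter_prod_commute[of lam "family_coord f"])
    next
      fix f assume "f \<in> carrier ?S"
      then show "\<one>\<^bsub>?S\<^esub> \<otimes>\<^bsub>?S\<^esub> f = f"
        by (intro family_coord_inject[of _ lam V])
          (auto simp: closed mult_coord one_coord baxter_prod_unit_left)
    qed (auto simp: closed)
    fix f g h assume "f \<in> carrier ?S" "g \<in> carrier ?S" "h \<in> carrier ?S"
    then show "(f \<oplus>\<^bsub>?S\<^esub> g) \<otimes>\<^bsub>?S\<^esub> h = f \<otimes>\<^bsub>?S\<^esub> h \<oplus>\<^bsub>?S\<^esub> g \<otimes>\<^bsub>?S\<^esub> h"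
      by (intro family_coord_inject[of _ lam V]) (auto simp: closed mult_coord baxter_prod_add_left)
  qed
qed

section \<open>Leading terms\<close>

text \<open>\<open>I n\<close> stands for the elements of value at least \<open>n\<close> under a valuation.\<close>

locale valuation_filtration =
  fixes I :: "nat \<Rightarrow> 'c::idom set"
  assumes I_0: "I 0 = UNIV"
    and zero_mem: "0 \<in> I n"
    and add_mem: "a \<in> I n \<Longrightarrow> b \<in> I n \<Longrightarrow> a + b \<in> I n"
    and mult_mem: "a \<in> I m \<Longrightarrow> b \<in> I n \<Longrightarrow> a * b \<in> I (m + n)"
    and mult_not_mem: "a \<notin> I (Suc m) \<Longrightarrow> b \<notin> I (Suc n) \<Longrightarrow> a * b \<notin> I (Suc (m + n))"
    and separated: "(\<And>n. a \<in> I n) \<Longrightarrow> a = 0"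
begin

lemma uminus_mem: "a \<in> I n \<Longrightarrow> - a \<in> I n"
  using mult_mem[of "-1" 0 a n] by (simp add: I_0)

lemma sum_mem: "(\<And>i. i \<in> A \<Longrightarrow> f i \<in> I n) \<Longrightarrow> (\<Sum>i\<in>A. f i) \<in> I n"
  by (induction A rule: infinite_finite_induct) (auto simp: zero_mem add_mem)

text \<open>The values are natural numbers, so the least one is attained although infinitely many
  coefficients compete.\<close>

lemma level_exists:
  assumes "F u \<noteq> 0"
  obtains a where "\<And>u. F u \<in> I a" "\<exists>u. F u \<notin> I (Suc a)"
proof -
  obtain n where n: "F u \<notin> I n"
    using separated[of "F u"] assms by blast
  define l where "l = (LEAST n. \<exists>u. F u \<notin> I n)"
  have l: "\<exists>u. F u \<notin> I l"
    unfolding l_def by (rule LeastI[of _ n]) (use n in blast)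
  then obtain a where a: "l = Suc a"
    using I_0 by (cases l) auto
  have "F u \<in> I a" for u
    using not_less_Least[of a "\<lambda>n. \<exists>u. F u \<notin> I n"] a by (auto simp: l_def)
  then show ?thesis
    using that l a by blast
qed

lemma qsh_mem:
  assumes "\<And>u. F u \<in> I a" "\<And>u. G u \<in> I b"
  shows "qsh lam F G t \<in> I (a + b)"
  using assms
proof (induction t arbitrary: F G)
  case (Cons c t)
  have "lam * (\<Sum>(x, y)\<in>decompositions c. qsh lam (\<lambda>u. F (x # u)) (\<lambda>u. G (y # u)) t) \<in> I (0 + (a + b))"
    using Cons by (intro mult_mem sum_mem) (auto simp: I_0)
  then show ?case
    using Cons by (auto intro!: add_mem)
qed (simp add: mult_mem)

text \<open>Each use of a shared letter brings in a factor \<open>lam\<close> of value at least 1,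
  so dropping all of them changes the result only in higher value.\<close>

lemma qsh_weight_zero:
  assumes "lam \<in> I 1" "\<And>u. F u \<in> I a" "\<And>u. G u \<in> I b"
  shows "qsh lam F G t - qsh 0 F G t \<in> I (Suc (a + b))"
  using assms(2,3)
proof (induction t arbitrary: F G)
  case (Cons c t)
  let ?s = "\<Sum>(x, y)\<in>decompositions c. qsh lam (\<lambda>u. F (x # u)) (\<lambda>u. G (y # u)) t"
  have "?s \<in> I (a + b)"
    using Cons.prems by (intro sum_mem) (auto intro!: qsh_mem)
  then have "lam * ?s \<in> I (Suc (a + b))"
    using mult_mem[OF assms(1)] by fastforce
  then have "(qsh lam (\<lambda>u. F (c # u)) G t - qsh 0 (\<lambda>u. F (c # u)) G t) +
      (qsh lam F (\<lambda>u. G (c # u)) t - qsh 0 F (\<lambda>u. G (c # u)) t) + lam * ?s \<in> I (Suc (a + b))"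
    using Cons by (intro add_mem) auto
  then show ?case
    by (simp add: algebra_simps)
qed (simp add: zero_mem)

end

section \<open>Ordinary shuffles and the lexicographic order\<close>

primrec select :: "bool \<Rightarrow> bool list \<Rightarrow> 'a list \<Rightarrow> 'a list" where
  "select b [] t = []"
| "select b (c # bs) t = (if c = b then hd t # select b bs (tl t) else select b bs (tl t))"

lemma length_select [simp]: "length (select b bs t) = count_list bs b"
  by (induction bs arbitrary: t) auto

lemma riffle_select: "length bs = length t \<Longrightarrow> riffle bs (select True bs t) (select False bs t) = t"
proof (induction bs arbitrary: t)
  case (Cons b bs)
  then show ?case by (cases t) auto
qed simp

lemma select_riffle:
  assumes "bs \<in> masks (length xs) (length ys)"
  shows "select True bs (riffle bs xs ys) = xs" "select False bs (riffle bs xs ys) = ys"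
proof -
  have "select True bs (riffle bs xs ys) = xs \<and> select False bs (riffle bs xs ys) = ys"
    using assms
  proof (induction bs arbitrary: xs ys)
    case (Cons b bs)
    then show ?case
      by (cases b; cases xs; cases ys) (auto simp: masks_def)
  qed (auto simp: masks_def)
  then show "select True bs (riffle bs xs ys) = xs" "select False bs (riffle bs xs ys) = ys"
    by simp_all
qed

lemma map_riffle:
  assumes "bs \<in> masks (length xs) (length ys)"
  shows "map f (riffle bs xs ys) = riffle bs (map f xs) (map f ys)"
  using assms
proof (induction bs arbitrary: xs ys)
  case (Cons b bs)
  then show ?case
    by (cases b; cases xs; cases ys) (auto simp: masks_def)
qed simp

lemma lists_Suc_bool: "{bs :: bool list. length bs = Suc n} =
    (#) True ` {bs. length bs = n} \<union> (#) False ` {bs. length bs = n}"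
  by (auto simp: length_Suc_conv)

lemma finite_bool_lists [simp]: "finite {bs :: bool list. length bs = n}"
  using finite_lists_length_eq[of "UNIV :: bool set" n] by simp

text \<open>In weight zero no letter is shared, so each way of distributing the positions of
  \<open>t\<close> among the two factors contributes one term.\<close>

lemma qsh_0_eq_sum_masks:
  "qsh 0 F G t = (\<Sum>bs | length bs = length t. F (select True bs t) * G (select False bs t))"
proof (induction t arbitrary: F G)
  case (Cons c t)
  have "(#) True ` {bs. length bs = length t} \<inter> (#) False ` {bs. length bs = length t} = {}"
    by auto
  then show ?case
    by (simp add: Cons lists_Suc_bool sum.union_disjoint sum.reindex)
qed simp

text \<open>For a fixed mask, letters are compared position by position, and the first difference
  between two riffled words comes from a first difference in one of the factors. The second conjunct
  is strictness, which later forces equality of the factors at the maximum.\<close>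

lemma riffle_mono:
  fixes xs xs' ys ys' :: "'a::linorder list"
  assumes "bs \<in> masks (length xs) (length ys)" "length xs' = length xs" "length ys' = length ys"
    and "xs \<le> xs'" "ys \<le> ys'"
  shows "riffle bs xs ys \<le> riffle bs xs' ys' \<and>
    (riffle bs xs ys = riffle bs xs' ys' \<longrightarrow> xs = xs' \<and> ys = ys')"
  using assms
proof (induction bs arbitrary: xs ys xs' ys')
  case (Cons b bs)
  show ?case
  proof (cases b)
    case True
    then obtain x z x' z' where "xs = x # z" "xs' = x' # z'"
      using Cons.prems(1,2) by (cases xs; cases xs') (auto simp: masks_def)
    then show ?thesis
      using True Cons.prems Cons.IH[of z ys z' ys'] by (auto simp: masks_def)
  next
    case False
    then obtain x z x' z' where "ys = x # z" "ys' = x' # z'"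
      using Cons.prems(1,3) by (cases ys; cases ys') (auto simp: masks_def)
    then show ?thesis
      using False Cons.prems Cons.IH[of xs z xs' z'] by (auto simp: masks_def)
  qed
qed (auto simp: masks_def)

text \<open>The weights give the \<open>i\<close>-th variable the value \<open>z\<^sup>i\<close> for a number \<open>z\<close> that avoids the
  finitely many roots of the polynomials by which the given monomials differ.\<close>

lemma exists_separating_weight:
  fixes K :: "('x \<Rightarrow>\<^sub>0 nat) set"
  assumes "finite K"
  shows "\<exists>\<theta> :: ('x \<Rightarrow>\<^sub>0 nat) \<Rightarrow> nat. (\<forall>a b. \<theta> (a + b) = \<theta> a + \<theta> b) \<and> inj_on \<theta> K"
proof -
  define Y where "Y = (\<Union>a\<in>K. Poly_Mapping.keys a)"
  have finite_Y: "finite Y"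
    using assms by (simp add: Y_def)
  then obtain e :: "'x \<Rightarrow> nat" where e: "inj_on e Y"
    using finite_imp_inj_to_nat_seg by blast
  define P where "P a b = (\<Sum>x\<in>Y. Polynomial.monom
      (int (Poly_Mapping.lookup a x) - int (Poly_Mapping.lookup b x)) (e x))" for a b :: "'x \<Rightarrow>\<^sub>0 nat"
  have P_nz: "P a b \<noteq> 0" if ab: "a \<in> K" "b \<in> K" "a \<noteq> b" for a b
  proof -
    obtain x where x: "Poly_Mapping.lookup a x \<noteq> Poly_Mapping.lookup b x"
      using ab(3) poly_mapping_eqI[of a b] by blast
    then have "x \<in> Y"
      using ab(1,2) by (cases "Poly_Mapping.lookup a x = 0") (auto simp: Y_def in_keys_iff)
    have "poly.coeff (P a b) (e x) = (\<Sum>x'\<in>Y. if x' = x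
        then int (Poly_Mapping.lookup a x') - int (Poly_Mapping.lookup b x') else 0)"
      unfolding P_def Polynomial.coeff_sum using e \<open>x \<in> Y\<close>
      by (intro sum.cong) (auto simp: inj_on_def)
    also have "\<dots> \<noteq> 0"
      using x \<open>x \<in> Y\<close> finite_Y by (simp add: sum.delta')
    finally show ?thesis by auto
  qed
  define R where "R = (\<Union>a\<in>K. \<Union>b\<in>K - {a}. {z. poly (P a b) z = 0})"
  have "finite R"
    using assms P_nz by (auto simp: R_def intro!: poly_roots_finite)
  then have "finite (int -` R)"
    by (intro finite_vimageI) simp_all
  then obtain z :: nat where z: "int z \<notin> R"
    using ex_new_if_finite[OF infinite_UNIV_nat] by blast
  define \<theta> where "\<theta> a = (\<Sum>x\<in>Y. Poly_Mapping.lookup a x * z ^ e x)" for a :: "'x \<Rightarrow>\<^sub>0 nat"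
  have "inj_on \<theta> K"
  proof (rule inj_onI, rule ccontr)
    fix a b assume ab: "a \<in> K" "b \<in> K" "\<theta> a = \<theta> b" "a \<noteq> b"
    have "poly (P a b) (int z) = int (\<theta> a) - int (\<theta> b)"
      by (simp add: P_def \<theta>_def poly_sum Polynomial.poly_monom algebra_simps sum_subtractf)
    then show False
      using ab z by (auto simp: R_def)
  qed
  then show ?thesis
    by (intro exI[of _ \<theta>]) (auto simp: \<theta>_def lookup_add algebra_simps sum.distrib)
qed

lemma exists_max_image:
  fixes f :: "'a \<Rightarrow> 'b::linorder"
  assumes "finite A" "A \<noteq> {}"
  obtains x where "x \<in> A" "\<And>y. y \<in> A \<Longrightarrow> f y \<le> f x"
proof -
  have "Max (f ` A) \<in> f ` A"
    using assms by (intro Max_in) auto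
  then obtain x where x: "x \<in> A" "Max (f ` A) = f x" by blast
  have "f y \<le> f x" if "y \<in> A" for y
    unfolding x(2)[symmetric] using assms(1) that by (intro Max_ge) auto
  with x(1) show ?thesis
    by (rule that)
qed

context valuation_filtration
begin

text \<open>The least length is positive because the value at \<open>[]\<close> is \<open>0\<close>;
  at this length only finitely many coefficients are nonzero, so \<open>L\<close> is finite.\<close>

lemma leading_words:
  assumes "F [] = 0" "\<And>n. finite {u. length u = n \<and> F u \<noteq> 0}" "F u \<noteq> 0"
  obtains a n L where "\<And>u. F u \<in> I a" "L = {u. length u = Suc n \<and> F u \<notin> I (Suc a)}"
    "finite L" "L \<noteq> {}" "\<And>u. F u \<notin> I (Suc a) \<Longrightarrow> Suc n \<le> length u"
proof -
  obtain a where a: "\<And>u. F u \<in> I a" "\<exists>u. F u \<notin> I (Suc a)"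
    using level_exists[of F u, OF assms(3)] by blast
  define l where "l = (LEAST l. \<exists>u. F u \<notin> I (Suc a) \<and> length u = l)"
  have l: "\<exists>u. F u \<notin> I (Suc a) \<and> length u = l"
    unfolding l_def by (rule LeastI_ex) (use a in blast)
  have le: "l \<le> length u" if "F u \<notin> I (Suc a)" for u
    unfolding l_def by (rule Least_le) (use that in blast)
  obtain n where n: "l = Suc n"
    using l assms(1) zero_mem by (cases l) auto
  have "{u. length u = Suc n \<and> F u \<notin> I (Suc a)} \<subseteq> {u. length u = Suc n \<and> F u \<noteq> 0}"
    using zero_mem by auto
  then have "finite {u. length u = Suc n \<and> F u \<notin> I (Suc a)}"
    by (rule finite_subset) (rule assms(2))
  then show ?thesis
    using a(1) l le n by (intro that[of a _ n]) auto
qed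

lemma baxter_prod_nonzero:
  fixes F G :: "('x \<Rightarrow>\<^sub>0 nat) list \<Rightarrow> 'c"
  assumes lam: "lam \<in> I 1" and of_nat: "\<And>n. n > 0 \<Longrightarrow> of_nat n \<notin> I 1"
    and F: "F [] = 0" "\<And>n. finite {u. length u = n \<and> F u \<noteq> 0}" "F u1 \<noteq> 0"
    and G: "G [] = 0" "\<And>n. finite {u. length u = n \<and> G u \<noteq> 0}" "G w1 \<noteq> 0"
  shows "\<exists>t. baxter_prod lam F G t \<noteq> 0"
proof -
  obtain a m L where L: "\<And>u. F u \<in> I a" "L = {u. length u = Suc m \<and> F u \<notin> I (Suc a)}"
      "finite L" "L \<noteq> {}" "\<And>u. F u \<notin> I (Suc a) \<Longrightarrow> Suc m \<le> length u"
    by (rule leading_words[of F, OF F]) blast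
  obtain b n M where M: "\<And>u. G u \<in> I b" "M = {u. length u = Suc n \<and> G u \<notin> I (Suc b)}"
      "finite M" "M \<noteq> {}" "\<And>u. G u \<notin> I (Suc b) \<Longrightarrow> Suc n \<le> length u"
    by (rule leading_words[of G, OF G]) blast
  \<comment> \<open>Only letters of words that compete for the lead have to be told apart by the
    weight.\<close>
  define K where "K = (\<Union>u\<in>L \<union> M. set u)"
  have "finite K"
    using L(3) M(3) by (simp add: K_def)
  then obtain \<theta> :: "('x \<Rightarrow>\<^sub>0 nat) \<Rightarrow> nat" where \<theta>: "\<And>a b. \<theta> (a + b) = \<theta> a + \<theta> b" "inj_on \<theta> K"
    using exists_separating_weight by meson
  obtain u0 where u0: "u0 \<in> L" "\<And>u. u \<in> L \<Longrightarrow> map \<theta> u \<le> map \<theta> u0"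
    using exists_max_image[OF L(3,4), of "map \<theta>"] by blast
  obtain w0 where w0: "w0 \<in> M" "\<And>w. w \<in> M \<Longrightarrow> map \<theta> w \<le> map \<theta> w0"
    using exists_max_image[OF M(3,4), of "map \<theta>"] by blast
  obtain x0 xp where u0_eq: "u0 = x0 # xp" "length xp = m"
    using u0(1) L(2) by (auto simp: length_Suc_conv)
  obtain y0 yp where w0_eq: "w0 = y0 # yp" "length yp = n"
    using w0(1) M(2) by (auto simp: length_Suc_conv)
  have "replicate m True @ replicate n False \<in> masks m n"
    using masks_0_left[of n] masks_0_right[of m] by (auto simp: masks_def)
  then have "masks m n \<noteq> {}" by blast
  \<comment> \<open>The largest shuffle \<open>tp\<close> of the two tails, preceded by the product
    \<open>x0 + y0\<close> of the first letters, is the word at which the product will be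
    nonzero.\<close>
  then obtain bs0 where bs0: "bs0 \<in> masks m n"
      "\<And>bs. bs \<in> masks m n \<Longrightarrow> map \<theta> (riffle bs xp yp) \<le> map \<theta> (riffle bs0 xp yp)"
    using exists_max_image[OF finite_masks, of m n "\<lambda>bs. map \<theta> (riffle bs xp yp)"] by blast
  define tp where "tp = riffle bs0 xp yp"
  have length_tp: "length tp = m + n"
    using length_masks[OF bs0(1)] by (simp add: tp_def)
  \<comment> \<open>The values of \<open>f\<close> on \<open>D\<close> are the terms of the weight
    zero coefficient at that word.\<close>
  define f where "f = (\<lambda>((x, y), bs). F (x # select True bs tp) * G (y # select False bs tp))"
  define D where "D = decompositions (x0 + y0) \<times> {bs :: bool list. length bs = length tp}"
  \<comment> \<open>The size of \<open>B\<close> is the multiplicity of \<open>tp\<close> as a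
    shuffle of \<open>xp\<close> and \<open>yp\<close>.\<close>
  define B where "B = {bs. length bs = length tp \<and> select True bs tp = xp \<and> select False bs tp = yp}"
  have "finite D"
    by (simp add: D_def)
  \<comment> \<open>A term that is not of higher value must come from the two leading words
    themselves.\<close>
  have good: "p \<in> {(x0, y0)} \<times> B" if p: "p \<in> D" "f p \<notin> I (Suc (a + b))" for p
  proof -
    obtain x y bs where p_eq: "p = ((x, y), bs)"
      by (cases p) auto
    have xy: "x + y = x0 + y0" and length_bs: "length bs = length tp"
      using p(1) by (auto simp: p_eq D_def decompositions_def)
    let ?u = "select True bs tp" and ?w = "select False bs tp"
    have prod: "F (x # ?u) * G (y # ?w) \<notin> I (Suc (a + b))"
      using p(2) by (simp add: f_def p_eq)
    have F_nm: "F (x # ?u) \<notin> I (Suc a)"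
      using mult_mem[of "F (x # ?u)" "Suc a" "G (y # ?w)" b] M(1) prod by auto
    have G_nm: "G (y # ?w) \<notin> I (Suc b)"
      using mult_mem[of "F (x # ?u)" a "G (y # ?w)" "Suc b"] L(1) prod by auto
    \<comment> \<open>Neither word is shorter than a leading one and the two tails have total length
      \<open>m + n\<close>, so both lengths are the least ones.\<close>
    have len: "length ?u = m" "length ?w = n"
      using L(5)[OF F_nm] M(5)[OF G_nm] count_list_True_False[of bs] length_bs length_tp by auto
    then have mem: "x # ?u \<in> L" "y # ?w \<in> M"
      using F_nm G_nm L(2) M(2) by auto
    have le: "\<theta> x # map \<theta> ?u \<le> \<theta> x0 # map \<theta> xp" "\<theta> y # map \<theta> ?w \<le> \<theta> y0 # map \<theta> yp"
      using u0(2)[OF mem(1)] w0(2)[OF mem(2)] by (simp_all add: u0_eq w0_eq)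
    moreover have "\<theta> x + \<theta> y = \<theta> x0 + \<theta> y0"
      using xy \<theta>(1) by metis
    \<comment> \<open>Two upper bounds whose sum is attained are both attained.\<close>
    ultimately have \<theta>_eq: "\<theta> x = \<theta> x0" "\<theta> y = \<theta> y0" by auto
    then have le': "map \<theta> ?u \<le> map \<theta> xp" "map \<theta> ?w \<le> map \<theta> yp"
      using le by auto
    have sub: "set (x # ?u) \<subseteq> K" "set (y # ?w) \<subseteq> K" "set u0 \<subseteq> K" "set w0 \<subseteq> K"
      unfolding K_def using mem u0(1) w0(1) by (blast intro: UN_upper)+
    have masks: "bs \<in> masks m n"
      using len by (simp add: masks_def)
    \<comment> \<open>A squeeze: monotonicity and the choice of \<open>bs0\<close> give \<open>map
      \<theta> tp \<le> riffle bs (map \<theta> xp) (map \<theta> yp) \<le> map \<theta> tp\<close>,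
      and strictness identifies the factors.\<close>
    have "riffle bs (map \<theta> ?u) (map \<theta> ?w) = map \<theta> tp"
      using riffle_select[OF length_bs] map_riffle[of bs ?u ?w \<theta>] masks len by simp
    moreover have "riffle bs (map \<theta> xp) (map \<theta> yp) \<le> map \<theta> tp"
      using bs0(2)[OF masks] map_riffle[of bs xp yp \<theta>] masks by (simp add: u0_eq w0_eq tp_def)
    moreover have mono: "riffle bs (map \<theta> ?u) (map \<theta> ?w) \<le> riffle bs (map \<theta> xp) (map \<theta> yp) \<and>
        (riffle bs (map \<theta> ?u) (map \<theta> ?w) = riffle bs (map \<theta> xp) (map \<theta> yp) \<longrightarrow>
          map \<theta> ?u = map \<theta> xp \<and> map \<theta> ?w = map \<theta> yp)"
      by (rule riffle_mono) (use masks len le' in \<open>simp_all only: length_map u0_eq w0_eq\<close>)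
    ultimately have "map \<theta> ?u = map \<theta> xp" "map \<theta> ?w = map \<theta> yp"
      by (metis order.antisym)+
    moreover have "inj_on \<theta> (set ?u \<union> set xp)" "inj_on \<theta> (set ?w \<union> set yp)"
      by (rule inj_on_subset[OF \<theta>(2)]; use sub in \<open>simp add: u0_eq w0_eq\<close>)+
    ultimately have "?u = xp" "?w = yp"
      by (auto intro: map_inj_on)
    moreover have "x = x0" "y = y0"
      using \<theta>_eq sub by (simp_all add: u0_eq w0_eq inj_onD[OF \<theta>(2)])
    ultimately show ?thesis
      using length_bs by (simp add: p_eq B_def)
  qed
  have "bs0 \<in> B"
    using select_riffle[of bs0 xp yp] bs0(1) u0_eq w0_eq length_masks[OF bs0(1)] length_tp
    by (simp add: B_def tp_def)
  moreover have "finite B"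
    by (rule finite_subset[of _ "{bs. length bs = length tp}"]) (auto simp: B_def)
  ultimately have "card B > 0"
    by (auto simp: card_gt_0_iff)
  have sub: "{(x0, y0)} \<times> B \<subseteq> D"
    by (auto simp: D_def B_def decompositions_def)
  have "(\<Sum>p\<in>{(x0, y0)} \<times> B. f p) = (\<Sum>p\<in>{(x0, y0)} \<times> B. F u0 * G w0)"
    by (intro sum.cong) (auto simp: f_def B_def u0_eq w0_eq)
  also have "\<dots> = of_nat (card B) * (F u0 * G w0)"
    by (simp add: card_cartesian_product)
  finally have lead: "(\<Sum>p\<in>{(x0, y0)} \<times> B. f p) = of_nat (card B) * (F u0 * G w0)" .
  have "(\<Sum>p\<in>D - {(x0, y0)} \<times> B. f p) \<in> I (Suc (a + b))"
    using good by (intro sum_mem) blast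
  moreover have "(\<Sum>p\<in>D. f p) = (\<Sum>p\<in>D - {(x0, y0)} \<times> B. f p) + of_nat (card B) * (F u0 * G w0)"
    using sum.subset_diff[OF sub \<open>finite D\<close>, of f] lead by simp
  moreover have "(\<Sum>p\<in>D. f p) = (\<Sum>(x, y)\<in>decompositions (x0 + y0).
      qsh 0 (\<lambda>u. F (x # u)) (\<lambda>u. G (y # u)) tp)"
    by (simp add: D_def f_def qsh_0_eq_sum_masks case_prod_beta sum.cartesian_product)
  moreover have "baxter_prod lam F G ((x0 + y0) # tp) - (\<Sum>(x, y)\<in>decompositions (x0 + y0).
      qsh 0 (\<lambda>u. F (x # u)) (\<lambda>u. G (y # u)) tp) \<in> I (Suc (a + b))"
    using L(1) M(1) by (auto simp: case_prod_beta simp flip: sum_subtractf intro!: sum_mem qsh_weight_zero[OF lam])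
  \<comment> \<open>Two errors of higher value are collected: the terms outside the leading ones and
    the passage from \<open>lam\<close> to weight zero.\<close>
  ultimately have diff: "baxter_prod lam F G ((x0 + y0) # tp) - of_nat (card B) * (F u0 * G w0) \<in> I (Suc (a + b))"
    using add_mem by fastforce
  have "F u0 * G w0 \<notin> I (Suc (a + b))"
    using u0(1) w0(1) L(2) M(2) by (intro mult_not_mem) auto
  \<comment> \<open>The multiplicity is positive, hence of value 0, and cannot raise the value of
    the leading product.\<close>
  then have "of_nat (card B) * (F u0 * G w0) \<notin> I (Suc (a + b))"
    using mult_not_mem[of "of_nat (card B)" 0] of_nat[OF \<open>card B > 0\<close>] by simp
  then have "baxter_prod lam F G ((x0 + y0) # tp) \<noteq> 0"
    using uminus_mem[OF diff] by auto
  then show ?thesis by blast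
qed

end

section \<open>The valuation of a prime factor of the weight\<close>

text \<open>The inverse is the image of \<open>1 / of_nat n\<close> under the structure map from the
  rationals.\<close>

lemma of_nat_unit:
  assumes "rat_algebra TYPE('c)" "n > 0"
  obtains u :: "'c::comm_ring_1" where "of_nat n * u = 1"
proof -
  obtain h where h: "h \<in> ring_hom (ring_of_type_algebra :: rat ring) (ring_of_type_algebra :: 'c ring)"
    using assms(1) by (auto simp: rat_algebra_def)
  have hom: "h (a * b) = h a * h b" "h (a + b) = h a + h b" "h 1 = 1" for a b
    using ring_hom_mult[OF h, of a b] ring_hom_add[OF h, of a b] ring_hom_one[OF h]
    by (simp_all add: ring_of_type_algebra_def)
  have "h 0 = 0"
    using hom(2)[of 0 0] by simp
  then have "h (of_nat n) = of_nat n" for n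
    by (induction n) (simp_all add: hom)
  then have "of_nat n * h (1 / of_nat n) = 1"
    using hom(1)[of "of_nat n" "1 / of_nat n"] assms(2) hom(3) by simp
  then show ?thesis by (rule that)
qed

lemma ideal_of_type_algebra:
  fixes J :: "'c::comm_ring_1 set"
  assumes "a \<in> J" "\<And>a b. a \<in> J \<Longrightarrow> b \<in> J \<Longrightarrow> a + b \<in> J" "\<And>a c. a \<in> J \<Longrightarrow> c * a \<in> J"
  shows "ideal J (ring_of_type_algebra :: 'c ring)"
proof -
  let ?R = "ring_of_type_algebra :: 'c ring"
  interpret R: cring ?R
    by (rule cring_from_type_algebra)
  have simps: "carrier ?R = UNIV" "a \<oplus>\<^bsub>?R\<^esub> b = a + b" "a \<otimes>\<^bsub>?R\<^esub> b = a * b" "\<zero>\<^bsub>?R\<^esub> = 0" for a b :: 'c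
    by (simp_all add: ring_of_type_algebra_def)
  have minus: "inv\<^bsub>add_monoid ?R\<^esub> x = - x" for x
    using R.minus_equality[of "- x" x] by (simp add: simps a_inv_def)
  show ?thesis
  proof (rule idealI)
    show "subgroup J (add_monoid ?R)"
    proof
      show "\<one>\<^bsub>add_monoid ?R\<^esub> \<in> J"
        using assms(3)[OF assms(1), of 0] by (simp add: simps)
      show "inv\<^bsub>add_monoid ?R\<^esub> x \<in> J" if "x \<in> J" for x
        using assms(3)[OF that, of "-1"] unfolding minus by simp
    qed (use assms(2) in \<open>auto simp: simps\<close>)
  qed (use assms(3) in \<open>auto simp: simps mult.commute R.ring_axioms\<close>)
qed

text \<open>Zorn's lemma for the ideals that contain \<open>lam\<close> but not \<open>1\<close>.
  The multiples of \<open>lam\<close> form such an ideal because \<open>lam\<close> is not a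
  unit.\<close>

lemma exists_maximalideal:
  fixes lam :: "'c::comm_ring_1"
  assumes "\<not> lam dvd 1"
  obtains M where "maximalideal M (ring_of_type_algebra :: 'c ring)" "lam \<in> M" "1 \<notin> M"
    "\<forall>a\<in>M. \<forall>c. c * a \<in> M"
proof -
  let ?R = "ring_of_type_algebra :: 'c ring"
  define \<J> where "\<J> = {J :: 'c set. lam \<in> J \<and> 1 \<notin> J \<and>
    (\<forall>a\<in>J. \<forall>b\<in>J. a + b \<in> J) \<and> (\<forall>a\<in>J. \<forall>c. c * a \<in> J)}"
  have "range (\<lambda>c. c * lam) \<in> \<J>"
    unfolding \<J>_def
  proof (intro CollectI conjI ballI allI)
    show "lam \<in> range (\<lambda>c. c * lam)"
      by (rule range_eqI[of _ _ 1]) simp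
    show "1 \<notin> range (\<lambda>c. c * lam)"
      using assms by (auto simp: dvd_def mult.commute)
    show "a + b \<in> range (\<lambda>c. c * lam)"
      if "a \<in> range (\<lambda>c. c * lam)" "b \<in> range (\<lambda>c. c * lam)" for a b
      using that by (auto simp flip: distrib_right)
    show "c * a \<in> range (\<lambda>c. c * lam)" if "a \<in> range (\<lambda>c. c * lam)" for a c
      using that by (auto simp flip: mult.assoc)
  qed
  moreover have "\<Union>\<C> \<in> \<J>" if "\<C> \<noteq> {}" "subset.chain \<J> \<C>" for \<C>
  proof -
    have sub: "J \<in> \<J>" if "J \<in> \<C>" for J
      using that \<open>subset.chain \<J> \<C>\<close> by (auto simp: subset.chain_def)
    have total: "J \<subseteq> J' \<or> J' \<subseteq> J" if "J \<in> \<C>" "J' \<in> \<C>" for J J'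
      using that \<open>subset.chain \<J> \<C>\<close> by (auto simp: subset_chain_def)
    have add: "a + b \<in> \<Union>\<C>" if ab: "a \<in> J" "b \<in> J'" "J \<in> \<C>" "J' \<in> \<C>" for a b J J'
    proof -
      obtain J'' where "J'' \<in> \<C>" "a \<in> J''" "b \<in> J''"
        using total[OF ab(3,4)] ab by blast
      then show ?thesis
        using sub[of J''] by (auto simp: \<J>_def)
    qed
    obtain J where "J \<in> \<C>"
      using \<open>\<C> \<noteq> {}\<close> by blast
    then have "lam \<in> \<Union>\<C>"
      using sub by (auto simp: \<J>_def)
    moreover have "1 \<notin> \<Union>\<C>" "\<forall>a\<in>\<Union>\<C>. \<forall>c. c * a \<in> \<Union>\<C>"
      using sub unfolding \<J>_def by blast+
    ultimately show ?thesis
      using add unfolding \<J>_def by blast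
  qed
  ultimately obtain M where M: "M \<in> \<J>" "\<And>J. J \<in> \<J> \<Longrightarrow> M \<subseteq> J \<Longrightarrow> J = M"
    using subset_Zorn_nonempty[of \<J>] by blast
  have "maximalideal M ?R"
  proof (rule maximalidealI)
    show "ideal M ?R"
      using M(1) by (intro ideal_of_type_algebra[of lam]) (auto simp: \<J>_def)
    show "carrier ?R \<noteq> M"
      using M(1) by (auto simp: \<J>_def ring_of_type_algebra_def)
    fix J assume J: "ideal J ?R" "M \<subseteq> J" "J \<subseteq> carrier ?R"
    have closed: "a + b \<in> J" if "a \<in> J" "b \<in> J" for a b
      using additive_subgroup.a_closed[OF ideal.axioms(1)[OF J(1)] that]
      by (simp add: ring_of_type_algebra_def)
    have closed': "c * a \<in> J" if "a \<in> J" for a c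
      using ideal.I_l_closed[OF J(1) that, of c] by (simp add: ring_of_type_algebra_def)
    show "J = M \<or> J = carrier ?R"
    proof (cases "1 \<in> J")
      case True
      then show ?thesis
        using closed'[of 1] by (auto simp: ring_of_type_algebra_def)
    next
      case False
      then have "J \<in> \<J>"
        using J(2) M(1) closed closed' by (auto simp: \<J>_def)
      then show ?thesis using M(2) J(2) by blast
    qed
  qed
  then show ?thesis
    using M(1) by (intro that[of M]) (auto simp: \<J>_def)
qed

text \<open>An irreducible factor of \<open>a\<close> is prime. That no nonzero element is divisible
  by all powers of \<open>p\<close> is included because the resulting valuation has to be finite on
  nonzero elements.\<close>

lemma factorial_domain_prime_divisor:
  assumes "factorial_domain R" "a \<in> carrier R" "a \<noteq> \<zero>\<^bsub>R\<^esub>" "a \<notin> Units R"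
  obtains p where "p \<in> carrier R" "p \<noteq> \<zero>\<^bsub>R\<^esub>" "p \<notin> Units R" "p divides\<^bsub>R\<^esub> a"
    "\<forall>x\<in>carrier R. \<forall>y\<in>carrier R. p divides\<^bsub>R\<^esub> (x \<otimes>\<^bsub>R\<^esub> y) \<longrightarrow> p divides\<^bsub>R\<^esub> x \<or> p divides\<^bsub>R\<^esub> y"
    "\<forall>x\<in>carrier R - {\<zero>\<^bsub>R\<^esub>}. \<exists>n::nat. \<not> (p [^]\<^bsub>R\<^esub> n) divides\<^bsub>R\<^esub> x"
proof -
  interpret factorial_domain R by fact
  let ?G = "mult_of R"
  have units: "Units ?G = Units R"
    by simp
  obtain fs where fs: "set fs \<subseteq> carrier ?G" "factors ?G fs a"
    using factorial_monoid.factors_exist[OF factorial_monoid_axioms, of a] assms by auto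
  have "fs \<noteq> []"
    using fs(2) assms(4) by (auto simp: factors_def)
  then obtain p where p: "p \<in> set fs"
    by (cases fs) auto
  have carrier: "p \<in> carrier ?G" and irreducible: "Divisibility.irreducible ?G p"
    using p fs by (auto simp: factors_def)
  have prime: "Divisibility.prime ?G p"
    by (rule factorial_monoid.irreducible_prime[OF factorial_monoid_axioms irreducible carrier])
  have "p divides\<^bsub>?G\<^esub> a"
    using comm_monoid.factors_dividesI[OF mult_of.comm_monoid_axioms fs(2) p fs(1)] .
  then have dvd: "p divides\<^bsub>R\<^esub> a"
    by simp
  have prime': "p divides\<^bsub>R\<^esub> x \<or> p divides\<^bsub>R\<^esub> y"
    if "x \<in> carrier R" "y \<in> carrier R" "p divides\<^bsub>R\<^esub> (x \<otimes>\<^bsub>R\<^esub> y)" for x y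
  proof (cases "x = \<zero>\<^bsub>R\<^esub> \<or> y = \<zero>\<^bsub>R\<^esub>")
    case True
    then show ?thesis using divides_zero[of p] carrier by auto
  next
    case False
    then have "p divides\<^bsub>?G\<^esub> (x \<otimes>\<^bsub>R\<^esub> y)"
      using that carrier integral_iff[of x y] by (intro divides_imp_divides_mult) auto
    then have "p divides\<^bsub>?G\<^esub> x \<or> p divides\<^bsub>?G\<^esub> y"
      using prime that False by (auto simp: Divisibility.prime_def)
    then show ?thesis by auto
  qed
  have separated: "\<exists>n::nat. \<not> (p [^]\<^bsub>R\<^esub> n) divides\<^bsub>R\<^esub> x" if x: "x \<in> carrier R" "x \<noteq> \<zero>\<^bsub>R\<^esub>" for x
  proof (rule ccontr)
    assume "\<not> ?thesis"
    then have dvd: "(p [^]\<^bsub>R\<^esub> n) divides\<^bsub>R\<^esub> x" for n :: nat by blast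
    have pow: "p [^]\<^bsub>R\<^esub> n \<in> carrier ?G" for n :: nat
      using mult_of.nat_pow_closed[OF carrier, of n] by (simp add: nat_pow_mult_of)
    \<comment> \<open>The number of irreducible factors grows strictly along the powers of
      \<open>p\<close>, whereas that of \<open>x\<close> bounds it for every power dividing
      \<open>x\<close>.\<close>
    have "n \<le> factorcount ?G (p [^]\<^bsub>R\<^esub> n)" for n :: nat
    proof (induction n)
      case (Suc n)
      have "properfactor ?G (p [^]\<^bsub>R\<^esub> n) (p [^]\<^bsub>R\<^esub> Suc n)"
        unfolding properfactor_def
      proof
        show "(p [^]\<^bsub>R\<^esub> n) divides\<^bsub>?G\<^esub> (p [^]\<^bsub>R\<^esub> Suc n)"
          using carrier by (auto simp: factor_def)
        show "\<not> (p [^]\<^bsub>R\<^esub> Suc n) divides\<^bsub>?G\<^esub> (p [^]\<^bsub>R\<^esub> n)"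
        proof
          assume "(p [^]\<^bsub>R\<^esub> Suc n) divides\<^bsub>?G\<^esub> (p [^]\<^bsub>R\<^esub> n)"
          then obtain c where c: "c \<in> carrier R" "p [^]\<^bsub>R\<^esub> n = p [^]\<^bsub>R\<^esub> Suc n \<otimes>\<^bsub>R\<^esub> c"
            by (auto simp: factor_def)
          then have "p [^]\<^bsub>R\<^esub> n \<otimes>\<^bsub>R\<^esub> \<one>\<^bsub>R\<^esub> = p [^]\<^bsub>R\<^esub> n \<otimes>\<^bsub>R\<^esub> (p \<otimes>\<^bsub>R\<^esub> c)"
            using carrier pow[of n] by (simp add: m_assoc)
          then have "p \<otimes>\<^bsub>R\<^esub> c = \<one>\<^bsub>R\<^esub>"
            using m_lcancel[of "p [^]\<^bsub>R\<^esub> n" "\<one>\<^bsub>R\<^esub>" "p \<otimes>\<^bsub>R\<^esub> c"] pow[of n] carrier c(1) by simp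
          then have "p \<in> Units R"
            using carrier c(1) divides_one[of p] unfolding factor_def by (metis DiffD1 carrier_mult_of)
          then show False
            using irreducible units by (auto simp: Divisibility.irreducible_def)
        qed
      qed
      then have "factorcount ?G (p [^]\<^bsub>R\<^esub> n) < factorcount ?G (p [^]\<^bsub>R\<^esub> Suc n)"
        by (intro factorial_monoid.properfactor_fcount[OF factorial_monoid_axioms] pow)
      then show ?case using Suc by simp
    qed simp
    moreover have "factorcount ?G (p [^]\<^bsub>R\<^esub> n) \<le> factorcount ?G x" for n :: nat
      using dvd[of n] x pow[of n] by (intro factorial_monoid.divides_fcount[OF factorial_monoid_axioms]) auto
    ultimately show False
      by (meson Suc_n_not_le_n order.trans)
  qed
  show ?thesis
  proof (rule that)
    show "p \<in> carrier R" "p \<noteq> \<zero>\<^bsub>R\<^esub>" "p \<notin> Units R"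
      using carrier irreducible units by (simp_all add: Divisibility.irreducible_def)
  qed (use dvd prime' separated in blast)+
qed

lemma localization_at_simps [simp]:
  "a \<oplus>\<^bsub>localization_at M\<^esub> b = a + b" "a \<otimes>\<^bsub>localization_at M\<^esub> b = a * b"
  "\<zero>\<^bsub>localization_at M\<^esub> = 0" "\<one>\<^bsub>localization_at M\<^esub> = 1"
  by (simp_all add: localization_at_def)

lemma localization_at_pow [simp]: "a [^]\<^bsub>localization_at M\<^esub> n = a ^ n" for n :: nat
proof (induction n)
  case 0
  then show ?case by (simp add: Group.nat_pow_0)
next
  case (Suc n)
  then show ?case by (simp add: Group.nat_pow_Suc mult.commute)
qed

lemma localization_at_divides:
  "a divides\<^bsub>localization_at M\<^esub> b \<longleftrightarrow> (\<exists>c\<in>carrier (localization_at M). b = a * c)"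
  by (simp add: factor_def)

text \<open>For nonzero \<open>lam\<close> this is the valuation of a prime factor of \<open>lam\<close> in the localization at
  a maximal ideal containing \<open>lam\<close>; for \<open>lam = 0\<close> the trivial valuation will do.\<close>

lemma exists_valuation_filtration:
  fixes lam :: "'c::idom"
  assumes "\<not> lam dvd 1"
    and "\<And>M. maximalideal M (ring_of_type_algebra :: 'c ring) \<Longrightarrow> factorial_domain (localization_at M)"
  obtains I :: "nat \<Rightarrow> 'c set" where "valuation_filtration I" "lam \<in> I 1" "1 \<notin> I 1"
proof (cases "lam = 0")
  case True
  define I :: "nat \<Rightarrow> 'c set" where "I n = (if n = 0 then UNIV else {0})" for n
  have "valuation_filtration I"
  proof
    show "a * b \<in> I (m + n)" if "a \<in> I m" "b \<in> I n" for a b m n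
      using that by (auto simp: I_def split: if_splits)
    show "a = 0" if "\<And>n. a \<in> I n" for a
      using that[of 1] by (simp add: I_def)
  qed (auto simp: I_def split: if_splits)
  then show ?thesis
    by (rule that) (simp_all add: I_def True)
next
  case False
  obtain M where M: "maximalideal M (ring_of_type_algebra :: 'c ring)" "lam \<in> M" "1 \<notin> M"
      "\<forall>a\<in>M. \<forall>c. c * a \<in> M"
    by (rule exists_maximalideal[OF assms(1)])
  let ?R = "localization_at M"
  interpret R: factorial_domain ?R
    by (rule assms(2)[OF M(1)])
  have "0 \<in> M"
    using M(2,4) by (metis mult_zero_left)
  have frac: "Fract c 1 \<in> carrier ?R" for c
    using M(3) by (auto simp: localization_at_def)
  \<comment> \<open>An inverse of \<open>lam\<close> in the localization would make some denominator
    \<open>s\<close> outside \<open>M\<close> a multiple of \<open>lam\<close>, which lies in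
    \<open>M\<close>.\<close>
  have "Fract lam 1 \<notin> Units ?R"
  proof
    assume "Fract lam 1 \<in> Units ?R"
    then obtain q where "q \<in> carrier ?R" "Fract lam 1 * q = 1"
      by (auto simp: Units_def)
    then obtain a s where s: "s \<notin> M" "Fract lam 1 * Fract a s = 1"
      by (auto simp: localization_at_def)
    moreover have "s \<noteq> 0"
      using s(1) \<open>0 \<in> M\<close> by auto
    ultimately have "lam * a = s"
      by (simp add: One_fract_def eq_fract)
    then show False
      using M(2,4) s(1) by (metis mult.commute)
  qed
  moreover have "Fract lam 1 \<noteq> 0"
    using False by (simp add: Zero_fract_def eq_fract)
  ultimately obtain p where p: "p \<in> carrier ?R" "p \<noteq> 0" "p \<notin> Units ?R" "p divides\<^bsub>?R\<^esub> Fract lam 1"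
      "\<forall>x\<in>carrier ?R. \<forall>y\<in>carrier ?R. p divides\<^bsub>?R\<^esub> (x * y) \<longrightarrow>
        p divides\<^bsub>?R\<^esub> x \<or> p divides\<^bsub>?R\<^esub> y"
      "\<forall>x\<in>carrier ?R - {0}. \<exists>n::nat. \<not> (p ^ n) divides\<^bsub>?R\<^esub> x"
    using factorial_domain_prime_divisor[OF R.factorial_domain_axioms, of "Fract lam 1"] frac
    unfolding localization_at_simps localization_at_pow by blast
  \<comment> \<open>Divisibility is meant in the localization, so \<open>I n\<close> is the
    contraction to the base ring of the ideal generated by \<open>p ^ n\<close>.\<close>
  define I where "I n = {c. (p ^ n) divides\<^bsub>?R\<^esub> Fract c 1}" for n
  have closed: "x + y \<in> carrier ?R" "x * y \<in> carrier ?R" if "x \<in> carrier ?R" "y \<in> carrier ?R" for x y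
    using R.a_closed[OF that] R.m_closed[OF that] by simp_all
  have pow_closed: "x ^ n \<in> carrier ?R" if "x \<in> carrier ?R" for x and n :: nat
    using R.nat_pow_closed[OF that, of n] by simp
  \<comment> \<open>The exact power of \<open>p\<close> is split off: the least \<open>l\<close>
    with \<open>a \<notin> I l\<close> is positive, and \<open>i\<close> is its predecessor.\<close>
  have exact: "\<exists>x i. i \<le> m \<and> x \<in> carrier ?R \<and> Fract a 1 = p ^ i * x \<and> \<not> p divides\<^bsub>?R\<^esub> x"
    if "a \<notin> I (Suc m)" for a m
  proof -
    define l where "l = (LEAST n. a \<notin> I n)"
    have l: "a \<notin> I l" "l \<le> Suc m"
      unfolding l_def by (rule LeastI[of "\<lambda>n. a \<notin> I n", OF that],
        rule Least_le[of "\<lambda>n. a \<notin> I n", OF that])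
    have "a \<in> I 0"
      using frac by (auto simp: I_def localization_at_divides)
    then obtain i where i: "l = Suc i"
      using l(1) by (cases l) auto
    then have "a \<in> I i"
      using not_less_Least[of i "\<lambda>n. a \<notin> I n"] by (auto simp: l_def)
    then obtain x where x: "x \<in> carrier ?R" "Fract a 1 = p ^ i * x"
      by (auto simp: I_def localization_at_divides)
    have "\<not> p divides\<^bsub>?R\<^esub> x"
      using l(1) x by (auto simp: i I_def localization_at_divides mult_ac)
    then show ?thesis
      using x l(2) i by auto
  qed
  have "valuation_filtration I"
  proof
    show "I 0 = UNIV"
      using frac by (auto simp: I_def localization_at_divides)
    show "0 \<in> I n" for n
      using R.zero_closed by (auto simp: I_def localization_at_divides Zero_fract_def[symmetric] intro!: bexI[of _ 0])
    show "a + b \<in> I n" if ab: "a \<in> I n" "b \<in> I n" for a b n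
    proof -
      obtain x y where "x \<in> carrier ?R" "Fract a 1 = p ^ n * x" "y \<in> carrier ?R" "Fract b 1 = p ^ n * y"
        using ab by (auto simp: I_def localization_at_divides)
      moreover have "Fract (a + b) 1 = Fract a 1 + Fract b 1" by simp
      ultimately show ?thesis
        by (auto simp: I_def localization_at_divides distrib_left simp del: add_fract intro!: bexI[of _ "x + y"] closed)
    qed
    show "a * b \<in> I (m + n)" if ab: "a \<in> I m" "b \<in> I n" for a b m n
    proof -
      obtain x y where "x \<in> carrier ?R" "Fract a 1 = p ^ m * x" "y \<in> carrier ?R" "Fract b 1 = p ^ n * y"
        using ab by (auto simp: I_def localization_at_divides)
      moreover have "Fract (a * b) 1 = Fract a 1 * Fract b 1" by simp
      ultimately show ?thesis
        by (auto simp: I_def localization_at_divides power_add mult_ac simp del: mult_fract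
            intro!: bexI[of _ "x * y"] closed)
    qed
    show "a * b \<notin> I (Suc (m + n))" if ab: "a \<notin> I (Suc m)" "b \<notin> I (Suc n)" for a b m n
    proof
      assume "a * b \<in> I (Suc (m + n))"
      then obtain z where z: "z \<in> carrier ?R" "Fract (a * b) 1 = p ^ Suc (m + n) * z"
        unfolding I_def localization_at_divides by blast
      obtain x i where x: "i \<le> m" "x \<in> carrier ?R" "Fract a 1 = p ^ i * x" "\<not> p divides\<^bsub>?R\<^esub> x"
        using exact[OF ab(1)] by blast
      obtain y j where y: "j \<le> n" "y \<in> carrier ?R" "Fract b 1 = p ^ j * y" "\<not> p divides\<^bsub>?R\<^esub> y"
        using exact[OF ab(2)] by blast
      \<comment> \<open>After cancelling \<open>p ^ (i + j)\<close>, a factor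
        \<open>p ^ Suc d\<close> is left; one \<open>p\<close> suffices to contradict
        primality.\<close>
      define d where "d = (m - i) + (n - j)"
      have "p ^ (i + j) * (x * y) = Fract a 1 * Fract b 1"
        by (simp add: x y power_add mult_ac del: mult_fract)
      also have "\<dots> = p ^ Suc (m + n) * z"
        using z(2) by simp
      also have "Suc (m + n) = (i + j) + Suc d"
        using x(1) y(1) by (simp add: d_def)
      also have "p ^ ((i + j) + Suc d) * z = p ^ (i + j) * (p * (p ^ d * z))"
        by (simp only: power_add power_Suc mult.assoc)
      finally have "x * y = p * (p ^ d * z)"
        using p(2) by simp
      then have "p divides\<^bsub>?R\<^esub> (x * y)"
        using closed(2)[OF pow_closed[OF p(1)] z(1)] unfolding localization_at_divides by blast
      then show False
        using p(5) x(2,4) y(2,4) by blast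
    qed
    show "a = 0" if "\<And>n. a \<in> I n" for a
    proof -
      have "Fract a 1 = 0"
        using p(6) frac[of a] that unfolding I_def by blast
      then show ?thesis by (simp add: Zero_fract_def eq_fract)
    qed
  qed
  moreover have "lam \<in> I 1"
    using p(4) by (simp add: I_def)
  moreover have "1 \<notin> I 1"
    using p(3) R.divides_one[OF p(1)] by (simp add: I_def One_fract_def[symmetric])
  ultimately show ?thesis by (rule that)
qed

section \<open>The two directions of the equivalence\<close>

lemma finite_family_coord:
  assumes "f \<in> carrier (complete_shuffle_algebra lam (mpoly_algebra V))"
  shows "finite {t. length t = n \<and> family_coord f t \<noteq> 0}"
proof (cases n)
  case 0
  then have "{t. length t = n \<and> family_coord f t \<noteq> 0} = {}" by auto
  then show ?thesis by (simp only: finite.emptyI)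
next
  case (Suc k)
  have "finite {t. coset_coord (f k) t \<noteq> 0}"
    using assms by (intro finite_coset_coord[of _ V "Suc k"]) (simp add: complete_carrier_iff)
  then show ?thesis
    by (rule finite_subset[rotated]) (auto simp: Suc family_coord_length)
qed

lemma domain_complete_shuffle_algebra:
  fixes V :: "'x set" and lam :: "'c::idom"
  assumes "valuation_filtration I" "lam \<in> I 1" "\<And>n. n > 0 \<Longrightarrow> of_nat n \<notin> I 1"
  shows "domain (complete_shuffle_algebra lam (mpoly_algebra V))"
proof -
  let ?S = "complete_shuffle_algebra lam (mpoly_algebra V)"
  interpret S: cring ?S
    by (rule cring_complete_shuffle_algebra)
  interpret valuation_filtration I by fact
  show ?thesis
  proof
    show "\<one>\<^bsub>?S\<^esub> \<noteq> \<zero>\<^bsub>?S\<^esub>"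
    proof
      assume "\<one>\<^bsub>?S\<^esub> = \<zero>\<^bsub>?S\<^esub>"
      then show False
        using complete_one(2)[of lam V "[0]"] complete_zero(2)[of lam V "[0]"] by simp
    qed
    fix f g assume fg: "f \<otimes>\<^bsub>?S\<^esub> g = \<zero>\<^bsub>?S\<^esub>" "f \<in> carrier ?S" "g \<in> carrier ?S"
    have nonzero: "\<exists>t. family_coord h t \<noteq> 0" if "h \<in> carrier ?S" "h \<noteq> \<zero>\<^bsub>?S\<^esub>" for h
      using family_coord_inject[OF that(1) complete_zero(1)] that(2) complete_zero(2) by metis
    show "f = \<zero>\<^bsub>?S\<^esub> \<or> g = \<zero>\<^bsub>?S\<^esub>"
    proof (rule ccontr)
      assume "\<not> ?thesis"
      then obtain t u where "family_coord f t \<noteq> 0" "family_coord g u \<noteq> 0"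
        using nonzero fg by meson
      then have "\<exists>t. baxter_prod lam (family_coord f) (family_coord g) t \<noteq> 0"
        using assms(2,3) fg(2,3) by (intro baxter_prod_nonzero finite_family_coord) auto
      then show False
        using complete_mult(2)[OF fg(2,3)] complete_zero(2)[of lam V] by (simp add: fg(1))
    qed
  qed
qed

lemma sum_decompositions_single:
  "(\<Sum>(a, b)\<in>decompositions c. if a = 0 \<and> b = 0 then v else 0) = (if c = 0 then v else 0)"
proof -
  have "(\<Sum>(a, b)\<in>decompositions c. if a = 0 \<and> b = 0 then v else 0) =
    (\<Sum>p\<in>decompositions c. if p = (0, 0) then v else 0)"
    by (simp add: case_prod_beta prod_eq_iff)
  also have "\<dots> = (if (0, 0) \<in> decompositions c then v else 0)"
    by (simp add: sum.delta')
  also have "(0, 0) \<in> decompositions c \<longleftrightarrow> c = 0"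
    by (auto simp: decompositions_def)
  finally show ?thesis .
qed

text \<open>The left factor is the one-letter word \<open>1\<close>, the right one a geometric
  series in such letters. If the first output letter is \<open>0\<close>, taking it from the left
  factor gives the series at \<open>t\<close>, taking it from both gives
  \<open>lam * - mu = -1\<close> times the same, and taking it from the right factor gives nothing
  by induction.\<close>

lemma qsh_geometric_annihilator:
  fixes lam mu :: "'c::comm_ring_1" and t :: "('x \<Rightarrow>\<^sub>0 nat) list"
  assumes "lam * mu = 1"
  shows "qsh lam (\<lambda>u. if u = [0] then 1 else 0)
    (\<lambda>u. if set u \<subseteq> {0} then (- mu) ^ length u else 0) t = 0"
proof (induction t)
  case (Cons c t)
  let ?D = "\<lambda>u :: ('x \<Rightarrow>\<^sub>0 nat) list. if u = [0] then 1 else 0 :: 'c"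
  let ?H = "\<lambda>u :: ('x \<Rightarrow>\<^sub>0 nat) list. if set u \<subseteq> {0} then (- mu) ^ length u else 0"
  have D: "(\<lambda>u. ?D (a # u)) = (if a = 0 then (\<lambda>u. if u = [] then 1 else 0) else (\<lambda>u. 0))" for a
    by auto
  have H: "(\<lambda>u. ?H (b # u)) = (if b = 0 then (\<lambda>u. - mu * ?H u) else (\<lambda>u. 0))" for b
    by auto
  have "qsh lam (\<lambda>u. ?D (a # u)) (\<lambda>u. ?H (b # u)) t = (if a = 0 \<and> b = 0 then - mu * ?H t else 0)" for a b
    unfolding D H by (simp add: qsh_unit_left)
  then have "(\<Sum>(a, b)\<in>decompositions c. qsh lam (\<lambda>u. ?D (a # u)) (\<lambda>u. ?H (b # u)) t) =
      (if c = 0 then - mu * ?H t else 0)"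
    by (simp only: sum_decompositions_single)
  moreover have "qsh lam (\<lambda>u. ?D (c # u)) ?H t = (if c = 0 then ?H t else 0)"
    unfolding D by (simp add: qsh_unit_left)
  moreover have "qsh lam ?D (\<lambda>u. ?H (c # u)) t = 0"
    unfolding H using Cons by (simp only: qsh_scale_right qsh_zero_right mult_zero_right split: if_split) simp
  moreover have "lam * (- mu * ?H t) = - ?H t"
    using assms by (simp flip: mult.assoc)
  ultimately show ?case
    unfolding qsh.simps by (simp only: split: if_split) simp
qed simp

lemma word_coeff_replicate_one:
  "word_coeff (replicate n 1) t = (if t = replicate n 0 then 1 else 0)"
proof (induction n arbitrary: t)
  case 0
  then show ?case by (simp add: word_coeff_Nil)
next
  case (Suc n)
  then show ?case by (cases t) (auto simp: lookup_one when_def)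
qed

text \<open>Write \<open>e\<^sub>n\<close> for the pure tensor of length \<open>n + 1\<close> all of whose letters are \<open>1\<close>. As
  \<open>e\<^sub>1 \<diamond> e\<^sub>n = (n + 1) e\<^sub>n\<^sub>+\<^sub>1 + lam n e\<^sub>n\<close>, the element \<open>e\<^sub>1\<close> annihilates the sum of all \<open>(- mu)\<^sup>n e\<^sub>n\<close>
  if \<open>mu\<close> is inverse to \<open>lam\<close>.\<close>

lemma not_domain_complete_shuffle_algebra:
  fixes V :: "'x set" and lam :: "'c::idom"
  assumes "lam dvd 1"
  shows "\<not> domain (complete_shuffle_algebra lam (mpoly_algebra V))"
proof
  let ?A = "mpoly_algebra V :: ('c, ('x \<Rightarrow>\<^sub>0 nat) \<Rightarrow>\<^sub>0 'c) module"
  let ?S = "complete_shuffle_algebra lam ?A"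
  assume "domain ?S"
  then interpret domain ?S .
  obtain mu where mu: "lam * mu = 1"
    using assms by (metis dvdE)
  define e where "e k c = tensor_class ?A (Suc k) (Poly_Mapping.single (replicate (Suc k) 1) c)" for k c
  have e_mem: "e k c \<in> tensor_power ?A (Suc k)" for k c
    unfolding e_def by (intro tensor_class_in_tensor_power single_in_formal_tensors)
      (auto simp: mpoly_algebra_closed)
  have e_coord: "coset_coord (e k c) t = (if t = replicate (Suc k) 0 then c else 0)" for k c t
    by (simp add: e_def word_coeff_replicate_one del: replicate_Suc)
  \<comment> \<open>\<open>e k 0\<close> is the zero coset, so \<open>f\<close> has a single nonzero
    component, at index 1.\<close>
  define f where "f k = e k (if k = 1 then 1 else 0)" for k
  define g where "g k = e k ((- mu) ^ k)" for k
  have fg: "f \<in> carrier ?S" "g \<in> carrier ?S"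
    by (simp_all add: complete_carrier_iff f_def g_def e_mem)
  have f: "family_coord f t = (if t = [0, 0] then 1 else 0)" for t
  proof (cases t)
    case (Cons m s)
    then show ?thesis
      by (cases s; cases "tl s") (auto simp: family_coord_def f_def e_coord)
  qed simp
  have g: "family_coord g t = (if t \<noteq> [] \<and> set t \<subseteq> {0} then (- mu) ^ (length t - 1) else 0)" for t
  proof (cases t)
    case (Cons m s)
    have "t = replicate (length t) 0 \<longleftrightarrow> set t \<subseteq> {0}"
      by (induction t) auto
    then show ?thesis
      using Cons by (simp add: family_coord_def g_def e_coord)
  qed simp
  have "baxter_prod lam (family_coord f) (family_coord g) t = 0" for t
  proof (cases t)
    case (Cons c s)
    let ?D = "\<lambda>u :: ('x \<Rightarrow>\<^sub>0 nat) list. if u = [0] then 1 else 0 :: 'c"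
    let ?H = "\<lambda>u :: ('x \<Rightarrow>\<^sub>0 nat) list. if set u \<subseteq> {0} then (- mu) ^ length u else 0"
    \<comment> \<open>Removing the first letter, which is multiplied and not shuffled, turns
      \<open>[0, 0]\<close> into \<open>[0]\<close> and the exponent \<open>length t - 1\<close>
      into the length of the remaining word.\<close>
    have "(\<lambda>u. family_coord f (a # u)) = (if a = 0 then ?D else (\<lambda>u. 0))"
      "(\<lambda>u. family_coord g (b # u)) = (if b = 0 then ?H else (\<lambda>u. 0))" for a b
      by (auto simp: f g)
    then have "qsh lam (\<lambda>u. family_coord f (a # u)) (\<lambda>u. family_coord g (b # u)) s = 0" for a b
      using qsh_geometric_annihilator[OF mu, of s] by (simp only: qsh_zero_left qsh_zero_right split: if_split) simp
    then show ?thesis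
      by (simp add: Cons case_prod_beta)
  qed simp
  then have "f \<otimes>\<^bsub>?S\<^esub> g = \<zero>\<^bsub>?S\<^esub>"
    using fg by (intro family_coord_inject[of _ lam V]) (auto simp: complete_mult complete_zero)
  then have "f = \<zero>\<^bsub>?S\<^esub> \<or> g = \<zero>\<^bsub>?S\<^esub>"
    using fg integral by blast
  then have "family_coord f [0, 0] = 0 \<or> family_coord g [0] = 0"
    using complete_zero(2)[of lam V] by metis
  then show False
    by (simp add: f g)
qed

theorem theorem4p6:
  fixes V :: "'x set" and lam :: "'c::idom"
  assumes "rat_algebra TYPE('c)"
    and "\<And>M. maximalideal M (ring_of_type_algebra :: 'c ring) \<Longrightarrow> factorial_domain (localization_at M)"
  shows "domain (complete_shuffle_algebra lam (mpoly_algebra V)) \<longleftrightarrow> \<not> lam dvd 1"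
proof
  assume "\<not> lam dvd 1"
  then obtain I where I: "valuation_filtration I" "lam \<in> I 1" "1 \<notin> I 1"
    using exists_valuation_filtration assms(2) by blast
  interpret valuation_filtration I by (rule I(1))
  \<comment> \<open>This is where the rationals enter: an integer in \<open>I 1\<close> with an
    inverse in the base ring would put \<open>1\<close> into \<open>I 1\<close>.\<close>
  have "of_nat n \<notin> I 1" if n: "n > 0" for n
  proof
    assume "of_nat n \<in> I 1"
    moreover obtain u where "of_nat n * u = (1 :: 'c)"
      using of_nat_unit[OF assms(1) n] .
    ultimately show False
      using mult_mem[of "of_nat n" 1 u 0] I_0 I(3) by simp
  qed
  then show "domain (complete_shuffle_algebra lam (mpoly_algebra V))"
    by (rule domain_complete_shuffle_algebra[OF I(1,2)])
qed (use not_domain_complete_shuffle_algebra in blast)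

end
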